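(* Let $(M,\omega,L,h)$ be a polarized toric Kähler manifold of complex dimension $m$ with Delzant polytope $P\subset\mathbb{R}^m$, open orbit $M^o$, moment map $\mu_h$ and Kähler potential $\varphi$ on $M^o$. Let $z\in M^o$, and for $k\ge 1$ let $D_{\sqrt{k}}\tilde\mu_k^z$ be the centered and dilated probability measure on $\mathbb{R}^m$ $$D_{\sqrt{k}}\tilde{\mu}_k^z=\frac{1}{\Pi_{h^k}(z,z)}\sum_{\alpha\in kP\cap\mathbb{Z}^m}\frac{|s_\alpha(z)|_{h^k}^2}{\|s_\alpha\|_{h^k}^2}\,\delta_{\sqrt{k}\left(\frac{\alpha}{k}-\mu_h(z)\right)}.$$ Then $D_{\sqrt{k}}\tilde\mu_k^z$ converges as $k\to\infty$, in the weak* sense on $C_b(\mathbb{R}^m)$, to the centered Gaussian measure $\gamma_{0,\mathrm{Hess}\,\varphi(z)}$; that is, for every $f\in C_b(\mathbb{R}^m)$, $$\int_{\mathbb{R}^m} f(x)\, d\big(D_{\sqrt{k}}\tilde{\mu}_k^z\big)(x)\;\longrightarrow\;\int_{\mathbb{R}^m} f(x)\,d\gamma_{0,\mathrm{Hess}\,\varphi(z)}(x)\qquad (k\to\infty).$$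
   Context: Setting. $(M,\omega)$ is a smooth projective toric Kähler manifold of complex dimension $m$: $(\mathbb{C}^* )^m$ acts holomorphically with an open dense orbit $M^o$, identified with $(\mathbb{C}^* )^m$ by choosing a base point, and the real torus $\mathbf{T}^m$ acts in a Hamiltonian way. $L\to M$ is an ample toric (equivariant) line bundle, and $h$ is a smooth $\mathbf{T}^m$-invariant Hermitian metric on $L$ with positive curvature form $\omega$. $P\subset\mathbb{R}^m$ is the associated Delzant (convex lattice) polytope: there is an invariant holomorphic frame $e_L$ of $L$ over $M^o$ such that, for every $k\ge1$, the sections $s_\alpha=z^\alpha e_L^{\otimes k}$, $\alpha\in kP\cap\mathbb{Z}^m$, extend to $M$ and form a basis of $H^0(M,L^k)$. Kähler potential and moment map. On $M^o$ write $|e_L|_h^2=e^{-\varphi}$, so $\omega=i\partial\bar\partial\varphi$ and $|s_\alpha(z)|_{h^k}^2=|z^\alpha|^2e^{-k\varphi(z)}$. Use coordinates $z_j=e^{\rho_j/2+i\theta_j}$ on $M^o$, i.e. $\rho_j=\log|z_j|^2$. By invariance $\varphi$ is a function of $\rho\in\mathbb{R}^m$ only, and it is convex. The moment map on $M^o$ is $\mu_h(z)=\nabla_\rho\varphi(\rho)=(\partial_{\rho_1}\varphi,\dots,\partial_{\rho_m}\varphi)$, and $\mu_h(M)=P$. $\mathrm{Hess}\,\varphi(z)$ is the $m\times m$ matrix $\big(\partial^2\varphi/\partial\rho_i\partial\rho_j\big)$ at the point $\rho$ corresponding to $z$. Norms and kernel. $\|s_\alpha\|_{h^k}^2=\int_M|s_\alpha|_{h^k}^2\,\omega^m/m!$.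 The $s_\alpha$ are orthogonal for the corresponding inner product, and the Bergman/Szegő density is $\Pi_{h^k}(z,z)=\sum_{\alpha\in kP\cap\mathbb{Z}^m}|s_\alpha(z)|_{h^k}^2/\|s_\alpha\|_{h^k}^2$. Notation. $C_b(\mathbb{R}^m)$ is the space of bounded continuous functions. $\gamma_{\vec m,\Sigma}$ is the Gaussian probability measure on $\mathbb{R}^m$ with mean $\vec m$ and covariance matrix $\Sigma$, with density $(2\pi)^{-m/2}(\det\Sigma)^{-1/2}e^{-\frac12\langle\Sigma^{-1}(x-\vec m),x-\vec m\rangle}$. *)

theory Defs
  imports "HOL-Analysis.Analysis"
begin

section \<open>Smooth and holomorphic functions of several variables\<close>

text \<open>On an open set of a finite-dimensional space, membership in \<open>Ck n\<close> says that all iterated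
  directional derivatives up to order \<open>n\<close> exist and are continuous.\<close>

primrec Ck :: "nat \<Rightarrow> 'v::real_normed_vector set \<Rightarrow> ('v \<Rightarrow> real) \<Rightarrow> bool" where
  "Ck 0 S f \<longleftrightarrow> continuous_on S f"
| "Ck (Suc n) S f \<longleftrightarrow> (\<forall>x\<in>S. f differentiable (at x)) \<and>
     (\<forall>v. Ck n S (\<lambda>x. frechet_derivative f (at x) v))"

definition smooth :: "'v::real_normed_vector set \<Rightarrow> ('v \<Rightarrow> real) \<Rightarrow> bool" where
  "smooth S f \<longleftrightarrow> (\<forall>n. Ck n S f)"

definition holo :: "(complex^'n::finite) set \<Rightarrow> (complex^'n \<Rightarrow> complex) \<Rightarrow> bool" where
  "holo S f \<longleftrightarrow> (\<forall>w\<in>S. \<exists>D. (f has_derivative D) (at w) \<and> (\<forall>c v. D (c *s v) = c * D v))"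

text \<open>Joint holomorphy in two vector variables.\<close>

definition holo2 :: "((complex^'n::finite) \<times> (complex^'n)) set \<Rightarrow>
    ((complex^'n) \<times> (complex^'n) \<Rightarrow> complex) \<Rightarrow> bool" where
  "holo2 S f \<longleftrightarrow> (\<forall>x\<in>S. \<exists>D. (f has_derivative D) (at x) \<and>
     (\<forall>c u v. D (c *s u, c *s v) = c * D (u, v)))"

definition wirt :: "'n::finite \<Rightarrow> (complex^'n \<Rightarrow> complex) \<Rightarrow> complex^'n \<Rightarrow> complex" where
  "wirt j f w = (frechet_derivative f (at w) (axis j 1)
                  - \<i> * frechet_derivative f (at w) (axis j \<i>)) / 2"

definition wirt_bar :: "'n::finite \<Rightarrow> (complex^'n \<Rightarrow> complex) \<Rightarrow> complex^'n \<Rightarrow> complex" where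
  "wirt_bar j f w = (frechet_derivative f (at w) (axis j 1)
                  + \<i> * frechet_derivative f (at w) (axis j \<i>)) / 2"

definition levi :: "(complex^'n::finite \<Rightarrow> real) \<Rightarrow> complex^'n \<Rightarrow> complex^'n^'n" where
  "levi \<psi> w = (\<chi> j k. wirt j (wirt_bar k (\<lambda>w. complex_of_real (\<psi> w))) w)"

definition gradient :: "(real^'n::finite \<Rightarrow> real) \<Rightarrow> real^'n \<Rightarrow> real^'n" where
  "gradient f x = (\<chi> j. frechet_derivative f (at x) (axis j 1))"

definition hessian :: "(real^'n::finite \<Rightarrow> real) \<Rightarrow> real^'n \<Rightarrow> real^'n^'n" where
  "hessian f x =
     (\<chi> i j. frechet_derivative (\<lambda>y. frechet_derivative f (at y) (axis j 1)) (at x) (axis i 1))"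


section \<open>The data of a polarized toric manifold\<close>

text \<open>
  The complex manifold is the whole type \<open>'a\<close>, of dimension \<open>CARD('m)\<close>.  The line bundle \<open>L\<close> is
  given by a trivializing cover with local holomorphic frames \<open>e\<^sub>i\<close> on \<open>triv X i\<close>:

  \<^item> \<open>e\<^sub>j = trans X i j * e\<^sub>i\<close>, so that the coefficients of a section of the \<open>k\<close>-th power
    satisfy \<open>s\<^sub>i = trans X i j ^ k * s\<^sub>j\<close>;
  \<^item> \<open>lin X t i j p\<close> is the coefficient of the lift of the action: \<open>t\<close> maps \<open>e\<^sub>i(p)\<close> to
    \<open>lin X t i j p * e\<^sub>j(t p)\<close>;
  \<^item> \<open>frame X i\<close> is the coefficient in \<open>e\<^sub>i\<close> of the invariant frame \<open>e\<^sub>L\<close> over the open orbit;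
  \<^item> \<open>hmet X i\<close> is the squared norm of \<open>e\<^sub>i\<close>.

  Sections are families of coefficients, set to zero outside their domain so that equality of
  families is equality of sections.
\<close>

record ('a, 'i, 'm) toric_data =
  atlas :: "('a set \<times> ('a \<Rightarrow> complex^'m)) set"
  act :: "complex^'m \<Rightarrow> 'a \<Rightarrow> 'a"
  base :: 'a
  triv :: "'i \<Rightarrow> 'a set"
  trans :: "'i \<Rightarrow> 'i \<Rightarrow> 'a \<Rightarrow> complex"
  lin :: "complex^'m \<Rightarrow> 'i \<Rightarrow> 'i \<Rightarrow> 'a \<Rightarrow> complex"
  frame :: "'i \<Rightarrow> 'a \<Rightarrow> complex"
  hmet :: "'i \<Rightarrow> 'a \<Rightarrow> real"
  vol :: "'a measure"
  poly :: "(real^'m) set"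

definition ctorus :: "(complex^'m::finite) set" where
  "ctorus = {t. \<forall>j. t $ j \<noteq> 0}"

definition rtorus :: "(complex^'m::finite) set" where
  "rtorus = {t. \<forall>j. norm (t $ j) = 1}"


section \<open>The complex manifold\<close>

definition top_chart :: "'a::topological_space set \<times> ('a \<Rightarrow> complex^'m::finite) \<Rightarrow> bool" where
  "top_chart C \<longleftrightarrow> (case C of (U, c) \<Rightarrow>
     open U \<and> open (c ` U) \<and> homeomorphism U (c ` U) c (inv_into U c))"

definition holo_transition ::
    "'a set \<times> ('a \<Rightarrow> complex^'m::finite) \<Rightarrow> 'a set \<times> ('a \<Rightarrow> complex^'m) \<Rightarrow> bool" where
  "holo_transition C C' \<longleftrightarrow> (case (C, C') of ((U, c), (V, d)) \<Rightarrow>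
     \<forall>j. holo (c ` (U \<inter> V)) (\<lambda>w. d (inv_into U c w) $ j))"

text \<open>All holomorphic charts, i.e. the elements of the maximal atlas.\<close>

definition holo_chart :: "('a::topological_space, 'i, 'm::finite) toric_data \<Rightarrow>
    'a set \<times> ('a \<Rightarrow> complex^'m) \<Rightarrow> bool" where
  "holo_chart X C \<longleftrightarrow> top_chart C \<and>
     (\<forall>C'\<in>atlas X. holo_transition C C' \<and> holo_transition C' C)"

definition complex_manifold :: "('a::t2_space, 'i, 'm::finite) toric_data \<Rightarrow> bool" where
  "complex_manifold X \<longleftrightarrow> (\<forall>C\<in>atlas X. holo_chart X C) \<and> (\<Union>C\<in>atlas X. fst C) = UNIV"

definition mholo :: "('a, 'i, 'm::finite) toric_data \<Rightarrow> 'a set \<Rightarrow> ('a \<Rightarrow> complex) \<Rightarrow> bool" where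
  "mholo X W f \<longleftrightarrow> (\<forall>(U, c)\<in>atlas X. holo (c ` (U \<inter> W)) (\<lambda>w. f (inv_into U c w)))"

definition msmooth :: "('a, 'i, 'm::finite) toric_data \<Rightarrow> 'a set \<Rightarrow> ('a \<Rightarrow> real) \<Rightarrow> bool" where
  "msmooth X W f \<longleftrightarrow> (\<forall>(U, c)\<in>atlas X. smooth (c ` (U \<inter> W)) (\<lambda>w. f (inv_into U c w)))"


section \<open>The torus action and its open orbit\<close>

definition holo_action :: "('a::topological_space, 'i, 'm::finite) toric_data \<Rightarrow> bool" where
  "holo_action X \<longleftrightarrow>
     (\<forall>p. act X 1 p = p) \<and>
     (\<forall>s\<in>ctorus. \<forall>t\<in>ctorus. \<forall>p. act X (s * t) p = act X s (act X t p)) \<and>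
     continuous_on (ctorus \<times> UNIV) (\<lambda>(t, p). act X t p) \<and>
     (\<forall>(U, c)\<in>atlas X. \<forall>(V, d)\<in>atlas X. \<forall>j.
        holo2 {(t, w). t \<in> ctorus \<and> w \<in> c ` U \<and> act X t (inv_into U c w) \<in> V}
              (\<lambda>(t, w). d (act X t (inv_into U c w)) $ j))"

definition orbit :: "('a, 'i, 'm::finite) toric_data \<Rightarrow> 'a set" where
  "orbit X = (\<lambda>t. act X t (base X)) ` ctorus"

text \<open>The coordinates \<open>z\<close> on the open orbit determined by the base point.\<close>

definition zcoord :: "('a, 'i, 'm::finite) toric_data \<Rightarrow> 'a \<Rightarrow> complex^'m" where
  "zcoord X = inv_into ctorus (\<lambda>t. act X t (base X))"

definition open_dense_orbit :: "('a::topological_space, 'i, 'm::finite) toric_data \<Rightarrow> bool" where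
  "open_dense_orbit X \<longleftrightarrow>
     inj_on (\<lambda>t. act X t (base X)) ctorus \<and>
     open (orbit X) \<and> closure (orbit X) = UNIV \<and>
     holo_chart X (orbit X, zcoord X)"


section \<open>The equivariant line bundle and its sections\<close>

definition line_bundle :: "('a::topological_space, 'i, 'm::finite) toric_data \<Rightarrow> bool" where
  "line_bundle X \<longleftrightarrow>
     (\<forall>i. open (triv X i)) \<and> (\<Union>i. triv X i) = UNIV \<and>
     (\<forall>i. \<forall>p\<in>triv X i. trans X i i p = 1) \<and>
     (\<forall>i j l. \<forall>p\<in>triv X i \<inter> triv X j \<inter> triv X l. trans X i j p * trans X j l p = trans X i l p) \<and>
     (\<forall>i j. mholo X (triv X i \<inter> triv X j) (trans X i j))"

definition linearization :: "('a, 'i, 'm::finite) toric_data \<Rightarrow> bool" where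
  "linearization X \<longleftrightarrow>
     (\<forall>i j. \<forall>p\<in>triv X i \<inter> triv X j. lin X 1 i j p = trans X j i p) \<and>
     (\<forall>s\<in>ctorus. \<forall>t\<in>ctorus. \<forall>i j l. \<forall>p\<in>triv X i.
        act X t p \<in> triv X j \<longrightarrow> act X (s * t) p \<in> triv X l \<longrightarrow>
        lin X (s * t) i l p = lin X t i j p * lin X s j l (act X t p)) \<and>
     (\<forall>(U, c)\<in>atlas X. \<forall>i j.
        holo2 {(t, w). t \<in> ctorus \<and> w \<in> c ` (U \<inter> triv X i) \<and> act X t (inv_into U c w) \<in> triv X j}
              (\<lambda>(t, w). lin X t i j (inv_into U c w)))"

text \<open>Holomorphic sections over an open set \<open>W\<close> of the \<open>k\<close>-th power of \<open>L\<close>.\<close>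

definition sections ::
    "('a, 'i, 'm::finite) toric_data \<Rightarrow> nat \<Rightarrow> 'a set \<Rightarrow> ('i \<Rightarrow> 'a \<Rightarrow> complex) set" where
  "sections X k W = {s.
     (\<forall>i. mholo X (W \<inter> triv X i) (s i)) \<and>
     (\<forall>i j. \<forall>p\<in>W \<inter> triv X i \<inter> triv X j. s i p = trans X i j p ^ k * s j p) \<and>
     (\<forall>i p. p \<notin> W \<inter> triv X i \<longrightarrow> s i p = 0)}"

definition H0 :: "('a, 'i, 'm::finite) toric_data \<Rightarrow> nat \<Rightarrow> ('i \<Rightarrow> 'a \<Rightarrow> complex) set" where
  "H0 X k = sections X k UNIV"

text \<open>The map sending \<open>p\<close> to the class of evaluation at \<open>p\<close> in the projectivized dual of
  \<open>H0 X k\<close> is well defined, injective and immersive; on a compact manifold it is then an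
  embedding.\<close>

definition very_ample :: "('a, 'i, 'm::finite) toric_data \<Rightarrow> nat \<Rightarrow> bool" where
  "very_ample X k \<longleftrightarrow>
     (\<forall>i. \<forall>p\<in>triv X i. \<exists>s\<in>H0 X k. s i p \<noteq> 0) \<and>
     (\<forall>i j. \<forall>p\<in>triv X i. \<forall>q\<in>triv X j. (\<exists>a. \<forall>s\<in>H0 X k. s i p = a * s j q) \<longrightarrow> p = q) \<and>
     (\<forall>(U, c)\<in>atlas X. \<forall>i. \<forall>p\<in>U \<inter> triv X i. \<forall>v.
        (\<exists>a. \<forall>s\<in>H0 X k.
           frechet_derivative (\<lambda>w. s i (inv_into U c w)) (at (c p)) v = a * s i p) \<longrightarrow> v = 0)"

definition ample :: "('a, 'i, 'm::finite) toric_data \<Rightarrow> bool" where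
  "ample X \<longleftrightarrow> (\<exists>k\<ge>1. very_ample X k)"

definition invariant_frame :: "('a, 'i, 'm::finite) toric_data \<Rightarrow> bool" where
  "invariant_frame X \<longleftrightarrow>
     frame X \<in> sections X 1 (orbit X) \<and>
     (\<forall>i. \<forall>p\<in>orbit X \<inter> triv X i. frame X i p \<noteq> 0) \<and>
     (\<forall>t\<in>ctorus. \<forall>i j. \<forall>p\<in>orbit X \<inter> triv X i. act X t p \<in> triv X j \<longrightarrow>
        frame X j (act X t p) = lin X t i j p * frame X i p)"


section \<open>The polytope and the monomial sections\<close>

definition real_vec :: "int^'m::finite \<Rightarrow> real^'m" where
  "real_vec \<alpha> = (\<chi> j. real_of_int (\<alpha> $ j))"

text \<open>Every vertex is a lattice point, and the edges through it point along the members of a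
  basis of the lattice.\<close>

definition delzant :: "(real^'m::finite) set \<Rightarrow> bool" where
  "delzant P \<longleftrightarrow> polytope P \<and> P \<noteq> {} \<and>
     (\<forall>v. v extreme_point_of P \<longrightarrow> v \<in> range real_vec \<and>
        (\<exists>(u :: 'm \<Rightarrow> int^'m) (l :: 'm \<Rightarrow> real).
           (\<forall>j. l j > 0) \<and> \<bar>det (\<chi> j. u j)\<bar> = 1 \<and>
           {F. F edge_of P \<and> v \<in> F} =
             range (\<lambda>j. closed_segment v (v + l j *\<^sub>R real_vec (u j)))))"

definition lattice_points :: "('a, 'i, 'm::finite) toric_data \<Rightarrow> nat \<Rightarrow> (int^'m) set" where
  "lattice_points X k = {\<alpha>. real_vec \<alpha> \<in> (\<lambda>x. real k *\<^sub>R x) ` poly X}"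

definition monomial :: "complex^'m::finite \<Rightarrow> int^'m \<Rightarrow> complex" where
  "monomial z \<alpha> = (\<Prod>j\<in>UNIV. (z $ j) powi (\<alpha> $ j))"

definition extends_monomial :: "('a, 'i, 'm::finite) toric_data \<Rightarrow> nat \<Rightarrow> int^'m \<Rightarrow>
    ('i \<Rightarrow> 'a \<Rightarrow> complex) \<Rightarrow> bool" where
  "extends_monomial X k \<alpha> s \<longleftrightarrow> s \<in> H0 X k \<and>
     (\<forall>i. \<forall>p\<in>orbit X \<inter> triv X i. s i p = monomial (zcoord X p) \<alpha> * frame X i p ^ k)"

text \<open>An extension is unique because the orbit is dense.\<close>

definition toric_section ::
    "('a, 'i, 'm::finite) toric_data \<Rightarrow> nat \<Rightarrow> int^'m \<Rightarrow> 'i \<Rightarrow> 'a \<Rightarrow> complex" where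
  "toric_section X k \<alpha> = (THE s. extends_monomial X k \<alpha> s)"

definition associated_polytope :: "('a, 'i, 'm::finite) toric_data \<Rightarrow> bool" where
  "associated_polytope X \<longleftrightarrow> delzant (poly X) \<and>
     (\<forall>k\<ge>1.
        (\<forall>\<alpha>\<in>lattice_points X k. \<exists>s. extends_monomial X k \<alpha> s) \<and>
        (\<forall>s\<in>H0 X k. \<exists>!a. (\<forall>\<alpha>. \<alpha> \<notin> lattice_points X k \<longrightarrow> a \<alpha> = 0) \<and>
           s = (\<lambda>i p. \<Sum>\<alpha>\<in>lattice_points X k. a \<alpha> * toric_section X k \<alpha> i p)))"


section \<open>Hermitian metric, curvature form and Liouville measure\<close>

definition local_weight :: "('a, 'i, 'm::finite) toric_data \<Rightarrow> 'a set \<times> ('a \<Rightarrow> complex^'m) \<Rightarrow>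
    'i \<Rightarrow> complex^'m \<Rightarrow> real" where
  "local_weight X C i w = (case C of (U, c) \<Rightarrow> - ln (hmet X i (inv_into U c w)))"

text \<open>\<open>omega X C i p u v\<close> is the curvature form
  \<open>i * (\<Sum>j k. \<psi>\<^sub>j\<^sub>k dw\<^sub>j \<and> d(cnj w\<^sub>k))\<close> at \<open>p\<close>, evaluated on tangent vectors written in the chart \<open>C\<close>,
  where \<open>\<psi>\<^sub>j\<^sub>k\<close> is the Levi matrix of the local weight; it does not depend on the trivialization.\<close>

definition omega :: "('a, 'i, 'm::finite) toric_data \<Rightarrow> 'a set \<times> ('a \<Rightarrow> complex^'m) \<Rightarrow> 'i \<Rightarrow>
    'a \<Rightarrow> complex^'m \<Rightarrow> complex^'m \<Rightarrow> real" where
  "omega X C i p u v = Re (\<i> * (\<Sum>j\<in>UNIV. \<Sum>k\<in>UNIV.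
     levi (local_weight X C i) (snd C p) $ j $ k * (u $ j * cnj (v $ k) - v $ j * cnj (u $ k))))"

text \<open>The curvature form is positive if \<open>omega u (\<i> u) > 0\<close> for nonzero \<open>u\<close>.\<close>

definition positive_metric :: "('a, 'i, 'm::finite) toric_data \<Rightarrow> bool" where
  "positive_metric X \<longleftrightarrow>
     (\<forall>i. \<forall>p\<in>triv X i. hmet X i p > 0) \<and>
     (\<forall>i. msmooth X (triv X i) (hmet X i)) \<and>
     (\<forall>i j. \<forall>p\<in>triv X i \<inter> triv X j. hmet X j p = (norm (trans X i j p))\<^sup>2 * hmet X i p) \<and>
     (\<forall>C\<in>atlas X. \<forall>i. \<forall>p\<in>fst C \<inter> triv X i. \<forall>u. u \<noteq> 0 \<longrightarrow> omega X C i p u (\<i> *s u) > 0)"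

definition invariant_metric :: "('a, 'i, 'm::finite) toric_data \<Rightarrow> bool" where
  "invariant_metric X \<longleftrightarrow> (\<forall>t\<in>rtorus. \<forall>i j. \<forall>p\<in>triv X i. act X t p \<in> triv X j \<longrightarrow>
     (norm (lin X t i j p))\<^sup>2 * hmet X j (act X t p) = hmet X i p)"

text \<open>The vector generating the \<open>j\<close>-th circle, written in a chart \<open>c\<close>.\<close>

definition circle_vector :: "('a, 'i, 'm::finite) toric_data \<Rightarrow> ('a \<Rightarrow> complex^'m) \<Rightarrow> 'm \<Rightarrow> 'a \<Rightarrow>
    complex^'m" where
  "circle_vector X c j p =
     vector_derivative (\<lambda>\<theta>. c (act X (\<chi> l. if l = j then cis \<theta> else 1) p)) (at 0)"

definition hamiltonian_action :: "('a, 'i, 'm::finite) toric_data \<Rightarrow> bool" where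
  "hamiltonian_action X \<longleftrightarrow> (\<exists>\<mu> :: 'a \<Rightarrow> real^'m.
     (\<forall>j. msmooth X UNIV (\<lambda>p. \<mu> p $ j)) \<and>
     (\<forall>t\<in>rtorus. \<forall>p. \<mu> (act X t p) = \<mu> p) \<and>
     (\<forall>(U, c)\<in>atlas X. \<forall>i. \<forall>p\<in>U \<inter> triv X i. \<forall>j v.
        frechet_derivative (\<lambda>w. \<mu> (inv_into U c w) $ j) (at (c p)) v =
          - omega X (U, c) i p (circle_vector X c j p) v))"

text \<open>\<open>vol X\<close> is the measure \<open>\<omega>\<^sup>m / m!\<close>.  Since \<open>i dw\<^sub>j \<and> d(cnj w\<^sub>j)\<close> is twice Lebesgue measure, the
  density in a chart is \<open>2^m\<close> times the determinant of the coefficient matrix.  As the domains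
  \<open>U \<inter> triv X i\<close> cover a compact manifold, the measure is uniquely determined.\<close>

definition liouville_measure :: "('a::topological_space, 'i, 'm::finite) toric_data \<Rightarrow> bool" where
  "liouville_measure X \<longleftrightarrow> sets (vol X) = sets borel \<and>
     (\<forall>U c i A. holo_chart X (U, c) \<longrightarrow> A \<in> sets borel \<longrightarrow> A \<subseteq> U \<inter> triv X i \<longrightarrow>
        emeasure (vol X) A = (\<integral>\<^sup>+ w. indicator (c ` A) w *
           ennreal (2 ^ CARD('m) * Re (det (levi (local_weight X (U, c) i) w))) \<partial>lborel))"

definition polarized_toric_kaehler :: "('a::t2_space, 'i, 'm::finite) toric_data \<Rightarrow> bool" where
  "polarized_toric_kaehler X \<longleftrightarrow>
     complex_manifold X \<and> compact (UNIV :: 'a set) \<and>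
     holo_action X \<and> open_dense_orbit X \<and>
     line_bundle X \<and> linearization X \<and> ample X \<and> invariant_frame X \<and> associated_polytope X \<and>
     positive_metric X \<and> invariant_metric X \<and> hamiltonian_action X \<and> liouville_measure X"


section \<open>Norms, Kaehler potential, moment map and Bergman density\<close>

text \<open>The pointwise squared norm of a section of the \<open>k\<close>-th power; by the transition rules for
  sections and \<open>hmet\<close> it does not depend on the choice of \<open>i\<close>.\<close>

definition hnorm2 ::
    "('a, 'i, 'm::finite) toric_data \<Rightarrow> nat \<Rightarrow> ('i \<Rightarrow> 'a \<Rightarrow> complex) \<Rightarrow> 'a \<Rightarrow> real" where
  "hnorm2 X k s p = (let i = (SOME i. p \<in> triv X i) in (norm (s i p))\<^sup>2 * hmet X i p ^ k)"

definition L2norm2 ::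
    "('a, 'i, 'm::finite) toric_data \<Rightarrow> nat \<Rightarrow> ('i \<Rightarrow> 'a \<Rightarrow> complex) \<Rightarrow> real" where
  "L2norm2 X k s = (\<integral>p. hnorm2 X k s p \<partial>vol X)"

definition bergman :: "('a, 'i, 'm::finite) toric_data \<Rightarrow> nat \<Rightarrow> 'a \<Rightarrow> real" where
  "bergman X k p = (\<Sum>\<alpha>\<in>lattice_points X k.
     hnorm2 X k (toric_section X k \<alpha>) p / L2norm2 X k (toric_section X k \<alpha>))"

text \<open>The potential is a function of \<open>\<rho>\<close> only, so it may be evaluated at the point of the orbit
  over \<open>\<rho>\<close> with \<open>\<theta> = 0\<close>.\<close>

definition potential :: "('a, 'i, 'm::finite) toric_data \<Rightarrow> real^'m \<Rightarrow> real" where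
  "potential X \<rho> =
     - ln (hnorm2 X 1 (frame X) (act X (\<chi> j. complex_of_real (exp (\<rho> $ j / 2))) (base X)))"

definition rho :: "('a, 'i, 'm::finite) toric_data \<Rightarrow> 'a \<Rightarrow> real^'m" where
  "rho X p = (\<chi> j. ln ((norm (zcoord X p $ j))\<^sup>2))"

definition moment_map :: "('a, 'i, 'm::finite) toric_data \<Rightarrow> 'a \<Rightarrow> real^'m" where
  "moment_map X p = gradient (potential X) (rho X p)"

definition hess_potential :: "('a, 'i, 'm::finite) toric_data \<Rightarrow> 'a \<Rightarrow> real^'m^'m" where
  "hess_potential X p = hessian (potential X) (rho X p)"


section \<open>The measures\<close>

text \<open>The image of a weighted counting measure on the lattice points, that is, the sum of the point
  masses at \<open>sqrt k (\<alpha> / k - moment_map X z)\<close> with the given weights.\<close>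

definition dilated_measure :: "('a, 'i, 'm::finite) toric_data \<Rightarrow> nat \<Rightarrow> 'a \<Rightarrow> (real^'m) measure" where
  "dilated_measure X k z =
     distr
       (point_measure (lattice_points X k)
          (\<lambda>\<alpha>. ennreal (1 / bergman X k z *
             (hnorm2 X k (toric_section X k \<alpha>) z / L2norm2 X k (toric_section X k \<alpha>)))))
       borel
       (\<lambda>\<alpha>. sqrt (real k) *\<^sub>R ((1 / real k) *\<^sub>R real_vec \<alpha> - moment_map X z))"

definition gaussian :: "real^'m::finite \<Rightarrow> real^'m^'m \<Rightarrow> (real^'m) measure" where
  "gaussian a \<Sigma> = density lborel (\<lambda>x. ennreal
     ((2 * pi) powr (- real CARD('m) / 2) * det \<Sigma> powr (- 1 / 2) *
      exp (- (1 / 2) * ((matrix_inv \<Sigma> *v (x - a)) \<bullet> (x - a)))))"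

end

theory Submission
  imports Defs
    "HOL-Complex_Analysis.Cauchy_Integral_Formula"
    "HOL-Probability.Distributions"
begin

text \<open>
  On the open orbit the quotient of the squared norm of \<open>s\<^sub>\<alpha>\<close> by its value at \<open>z\<close> is
  \<open>exp (\<langle>\<alpha>, \<rho> - \<rho>\<^sub>0\<rangle> - k (\<phi> \<rho> - \<phi> \<rho>\<^sub>0))\<close>, where \<open>\<rho>\<^sub>0\<close> belongs to \<open>z\<close>.  For
  \<open>\<alpha> = k \<mu>(z) + sqrt k * y\<close> the exponent is \<open>sqrt k \<langle>y, s\<rangle> - k G s\<close> with \<open>s = \<rho> - \<rho>\<^sub>0\<close>, and
  \<open>G\<close> is nonnegative and strictly convex with Hessian \<open>H = Hess \<phi> \<rho>\<^sub>0\<close> at its zero \<open>s = 0\<close>.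
  The Liouville measure corresponds to \<open>(2 \<pi>)\<^sup>m det (Hess \<phi>) d\<rho>\<close>, so by Laplace's method the inverse
  of the weight of \<open>\<alpha>\<close>, multiplied by \<open>k\<^sup>m\<^sup>/\<^sup>2\<close>, tends to a constant times
  \<open>exp (\<langle>H\<^sup>-\<^sup>1 y, y\<rangle> / 2)\<close>; no expansion of the Bergman kernel is needed.  The weights are dominated by
  \<open>C exp (- c |y|\<^sup>2)\<close> on the whole dilated polytope, and \<open>\<mu>(z)\<close> is an interior point of the polytope,
  so the sums over the lattice \<open>k\<^sup>-\<^sup>1\<^sup>/\<^sup>2 (\<int>\<^sup>m - k \<mu>(z))\<close> converge to Gaussian integrals by dominated
  convergence.
\<close>

section \<open>Functions of class $C^n$\<close>

text \<open>Two kinds of information on the norms are needed. For bounded y the exact limit is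
  required; there the integral concentrates at s of order k^(-1/2). For domination a lower bound
  must hold at every lattice point of the dilated polytope, including those with |y| of order sqrt
  k, for which the maximum of the exponent may leave every fixed ball; a crude bound from a small
  ball around a fixed multiple of y is enough. The potential has bounded gradient, so its Hessian
  has no uniform lower bound. All quadratic estimates are therefore made on the unit ball around
  \<open>\<rho>0\<close>, and convexity turns them into linear growth of \<open>G\<close> outside.
  The rest of the manifold, the boundary divisor included, contributes at most the finite total
  volume times an exponentially small number. The same linear growth makes the Legendre transform of
  \<phi> finite near \<mu>(z); compared with an upper bound of \<phi> by the support function of P,
  which comes from ampleness, this puts \<mu>(z) in the interior of P.\<close>

text \<open>The condition \<open>Ck\<close> for functions with values in an arbitrary normed space, so that it
  applies to complex-valued functions and to coordinate changes as well.\<close>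

primrec Cn :: "nat \<Rightarrow> 'v::real_normed_vector set \<Rightarrow> ('v \<Rightarrow> 'w::real_normed_vector) \<Rightarrow> bool" where
  "Cn 0 S f \<longleftrightarrow> continuous_on S f"
| "Cn (Suc n) S f \<longleftrightarrow> (\<forall>x\<in>S. f differentiable (at x)) \<and>
     (\<forall>v. Cn n S (\<lambda>x. frechet_derivative f (at x) v))"

lemma Ck_eq_Cn: "Ck n S f = Cn n S f"
  by (induct n arbitrary: f) auto

lemma Cn_imp_continuous_on: "Cn n S f \<Longrightarrow> continuous_on S f"
  by (cases n) (auto simp: differentiable_imp_continuous_within continuous_at_imp_continuous_on)

lemma Cn_Suc_D: "Cn (Suc n) S f \<Longrightarrow> Cn n S f"
proof (induct n arbitrary: f)
  case 0
  then show ?case using Cn_imp_continuous_on[OF 0] by simp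
next
  case (Suc n)
  then show ?case by (metis Cn.simps(2))
qed

lemma Cn_subset: "Cn n S f \<Longrightarrow> T \<subseteq> S \<Longrightarrow> Cn n T f"
  by (induct n arbitrary: f) (auto intro: continuous_on_subset)

text \<open>Openness of S makes equality on S pass to derivatives: \<open>frechet_derivative\<close>
  at a point reads a full neighbourhood.\<close>

lemma Cn_cong:
  assumes "open S" and "\<And>x. x \<in> S \<Longrightarrow> f x = g x" and "Cn n S f"
  shows "Cn n S g"
  using assms
proof (induct n arbitrary: f g)
  case 0
  then show ?case using continuous_on_cong[of S S f g] by simp
next
  case (Suc n)
  have d: "(g has_derivative frechet_derivative f (at x)) (at x)" if "x \<in> S" for x
  proof (rule has_derivative_transform_within_open[OF _ Suc.prems(1) that])
    show "(f has_derivative frechet_derivative f (at x)) (at x)"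
      using Suc.prems(3) that frechet_derivative_works by auto
  qed (use Suc.prems(2) in auto)
  have e: "frechet_derivative g (at x) = frechet_derivative f (at x)" if "x \<in> S" for x
    using d[OF that] by (rule frechet_derivative_at[symmetric])
  have "Cn n S (\<lambda>x. frechet_derivative g (at x) v)" for v
    by (rule Suc.hyps[of "\<lambda>x. frechet_derivative f (at x) v"])
      (use Suc.prems e in auto)
  then show ?case using d by (auto simp: differentiable_def)
qed

text \<open>Lets the closure proofs name the derivative by a calculus rule instead of the opaque
  choice \<open>frechet_derivative\<close>; uniqueness of derivatives identifies the two.\<close>

lemma Cn_SucI:
  assumes "open S" and d: "\<And>x. x \<in> S \<Longrightarrow> (f has_derivative D x) (at x)"
    and "\<And>v. Cn n S (\<lambda>x. D x v)"
  shows "Cn (Suc n) S f"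
proof -
  have e: "frechet_derivative f (at x) = D x" if "x \<in> S" for x
    using d[OF that] by (rule frechet_derivative_at[symmetric])
  have "Cn n S (\<lambda>x. frechet_derivative f (at x) v)" for v
    by (rule Cn_cong[OF assms(1) _ assms(3)[of v]]) (simp add: e)
  then show ?thesis using d by (auto simp: differentiable_def)
qed

lemma Cn_Suc_E:
  assumes "Cn (Suc n) S f"
  shows "x \<in> S \<Longrightarrow> (f has_derivative frechet_derivative f (at x)) (at x)"
    and "Cn n S (\<lambda>x. frechet_derivative f (at x) v)"
  using assms by (auto simp: frechet_derivative_works[symmetric])

lemma Cn_const: "open S \<Longrightarrow> Cn n S (\<lambda>x. c)"
proof (induct n arbitrary: c)
  case (Suc n)
  show ?case
    by (rule Cn_SucI[where D = "\<lambda>x v. 0"]) (use Suc in auto)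
qed simp

lemma Cn_bounded_linear:
  assumes "open S" "bounded_linear l" shows "Cn n S l"
proof (cases n)
  case 0
  then show ?thesis using assms linear_continuous_on by auto
next
  case (Suc n)
  show ?thesis unfolding Suc
    by (rule Cn_SucI[where D = "\<lambda>x. l"]) (use assms in \<open>auto intro: bounded_linear_imp_has_derivative Cn_const\<close>)
qed

lemma Cn_bounded_linear_compose:
  assumes "open S" "bounded_linear l" "Cn n S f" shows "Cn n S (\<lambda>x. l (f x))"
  using assms(3)
proof (induct n arbitrary: f)
  case 0
  then show ?case using assms(2) by (auto intro: bounded_linear.continuous_on)
next
  case (Suc n)
  show ?case
    by (rule Cn_SucI[OF assms(1) bounded_linear.has_derivative[OF assms(2) Cn_Suc_E(1)[OF Suc.prems]]
          Suc.hyps[OF Cn_Suc_E(2)[OF Suc.prems]]])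
qed

lemma Cn_add:
  assumes "open S" "Cn n S f" "Cn n S g" shows "Cn n S (\<lambda>x. f x + g x)"
  using assms(2,3)
proof (induct n arbitrary: f g)
  case 0
  then show ?case by (auto intro: continuous_intros)
next
  case (Suc n)
  show ?case
    by (rule Cn_SucI[OF assms(1) has_derivative_add[OF Cn_Suc_E(1)[OF Suc.prems(1)] Cn_Suc_E(1)[OF Suc.prems(2)]]
          Suc.hyps[OF Cn_Suc_E(2)[OF Suc.prems(1)] Cn_Suc_E(2)[OF Suc.prems(2)]]])
qed

lemma Cn_sum:
  assumes "open S" "\<And>i. i \<in> I \<Longrightarrow> Cn n S (f i)" shows "Cn n S (\<lambda>x. \<Sum>i\<in>I. f i x)"
  using assms(2)
  by (induct I rule: infinite_finite_induct) (auto intro: Cn_const Cn_add assms(1))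

lemma Cn_bilinear:
  assumes "open S" "bounded_bilinear b" "Cn n S f" "Cn n S g"
  shows "Cn n S (\<lambda>x. b (f x) (g x))"
  using assms(3,4)
proof (induct n arbitrary: f g)
  case 0
  then show ?case using assms(2) by (auto intro: bounded_bilinear.continuous_on)
next
  case (Suc n)
  note f = Cn_Suc_E[OF Suc.prems(1)] and g = Cn_Suc_E[OF Suc.prems(2)]
  show ?case
  proof (rule Cn_SucI[OF assms(1)])
    show "((\<lambda>x. b (f x) (g x)) has_derivative
      (\<lambda>v. b (f x) (frechet_derivative g (at x) v) + b (frechet_derivative f (at x) v) (g x))) (at x)"
      if "x \<in> S" for x
      using bounded_bilinear.FDERIV[OF assms(2) f(1)[OF that] g(1)[OF that]] .
    show "Cn n S (\<lambda>x. b (f x) (frechet_derivative g (at x) v) + b (frechet_derivative f (at x) v) (g x))" for v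
      by (intro Cn_add assms(1) Suc.hyps f(2) g(2) Cn_Suc_D[OF Suc.prems(1)] Cn_Suc_D[OF Suc.prems(2)])
  qed
qed

lemmas Cn_mult = Cn_bilinear[OF _ bounded_bilinear_mult]

lemma Cn_minus: "open S \<Longrightarrow> Cn n S f \<Longrightarrow> Cn n S (\<lambda>x. - f x)"
  by (rule Cn_bounded_linear_compose[OF _ bounded_linear_minus[OF bounded_linear_ident]])

text \<open>In the chain rule the direction fed to the derivative of g moves with x, while
  \<open>Cn\<close> controls derivatives in fixed directions only. Expanding that direction in the
  basis of the middle space leaves products covered by the induction hypothesis; hence the Euclidean
  middle space.\<close>

lemma Cn_compose:
  fixes f :: "'v::real_normed_vector \<Rightarrow> 'w::euclidean_space" and g :: "'w \<Rightarrow> 'u::real_normed_vector"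
  assumes "open S" "open T" "f ` S \<subseteq> T" "Cn n S f" "Cn n T g"
  shows "Cn n S (\<lambda>x. g (f x))"
  using assms(4,5)
proof (induct n arbitrary: g)
  case 0
  then show ?case using continuous_on_compose2[of T g S f] assms(3) by simp
next
  case (Suc n)
  note f = Cn_Suc_E[OF Suc.prems(1)] and g = Cn_Suc_E[OF Suc.prems(2)]
  let ?D = "\<lambda>x v. \<Sum>b\<in>Basis. (frechet_derivative f (at x) v \<bullet> b) *\<^sub>R frechet_derivative g (at (f x)) b"
  show ?case
  proof (rule Cn_SucI[OF assms(1)])
    fix x assume x: "x \<in> S"
    then have fx: "f x \<in> T" using assms(3) by auto
    have lin: "linear (frechet_derivative g (at (f x)))"
      using g(1)[OF fx] has_derivative_linear by blast
    have "((\<lambda>x. g (f x)) has_derivative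
        (\<lambda>v. frechet_derivative g (at (f x)) (frechet_derivative f (at x) v))) (at x)"
      by (rule has_derivative_compose[OF f(1)[OF x] g(1)[OF fx]])
    moreover have rep: "frechet_derivative g (at (f x)) y =
        (\<Sum>b\<in>Basis. (y \<bullet> b) *\<^sub>R frechet_derivative g (at (f x)) b)" for y
    proof -
      have "frechet_derivative g (at (f x)) y =
          frechet_derivative g (at (f x)) (\<Sum>b\<in>Basis. (y \<bullet> b) *\<^sub>R b)"
        by (simp only: euclidean_representation)
      also have "\<dots> = (\<Sum>b\<in>Basis. (y \<bullet> b) *\<^sub>R frechet_derivative g (at (f x)) b)"
        by (simp only: linear_sum[OF lin] linear_cmul[OF lin])
      finally show ?thesis .
    qed
    ultimately show "((\<lambda>x. g (f x)) has_derivative ?D x) (at x)"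
      by (subst (asm) rep)
  next
    fix v
    have 1: "Cn n S (\<lambda>x. frechet_derivative f (at x) v \<bullet> b)" for b
      by (rule Cn_bounded_linear_compose[OF assms(1) bounded_linear_inner_left f(2)])
    have 2: "Cn n S (\<lambda>x. frechet_derivative g (at (f x)) b)" for b
      by (rule Suc.hyps[OF Cn_Suc_D[OF Suc.prems(1)] g(2)])
    show "Cn n S (\<lambda>x. ?D x v)"
      by (rule Cn_sum[OF assms(1) Cn_bilinear[OF assms(1) bounded_bilinear_scaleR 1 2]])
  qed
qed

lemma Cn_inverse:
  fixes f :: "'v::real_normed_vector \<Rightarrow> 'w::real_normed_field"
  assumes "open S" "Cn n S f" "\<And>x. x \<in> S \<Longrightarrow> f x \<noteq> 0" shows "Cn n S (\<lambda>x. inverse (f x))"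
  using assms(2)
proof (induct n)
  case 0
  then show ?case using assms(3) by (auto intro!: continuous_intros)
next
  case (Suc n)
  note f = Cn_Suc_E[OF Suc.prems]
  show ?case
  proof (rule Cn_SucI[OF assms(1)])
    show "((\<lambda>x. inverse (f x)) has_derivative
        (\<lambda>v. - (inverse (f x) * frechet_derivative f (at x) v * inverse (f x)))) (at x)" if "x \<in> S" for x
      using f(1)[OF that] assms(3)[OF that] by (auto intro!: derivative_eq_intros)
    show "Cn n S (\<lambda>x. - (inverse (f x) * frechet_derivative f (at x) v * inverse (f x)))" for v
      by (intro Cn_minus Cn_mult assms(1) f(2) Suc.hyps Cn_Suc_D[OF Suc.prems])
  qed
qed

lemma Cn_ln:
  fixes f :: "'v::real_normed_vector \<Rightarrow> real"
  assumes "open S" "Cn n S f" "\<And>x. x \<in> S \<Longrightarrow> f x > 0" shows "Cn n S (\<lambda>x. ln (f x))"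
proof (cases n)
  case 0
  then show ?thesis using assms(2,3) by (auto intro!: continuous_intros simp: less_imp_neq[symmetric])
next
  case (Suc m)
  note f = Cn_Suc_E[OF assms(2)[unfolded Suc]]
  show ?thesis unfolding Suc
  proof (rule Cn_SucI[OF assms(1)])
    show "((\<lambda>x. ln (f x)) has_derivative (\<lambda>v. frechet_derivative f (at x) v * inverse (f x))) (at x)"
      if "x \<in> S" for x
      using f(1)[OF that] assms(3)[OF that] by (auto intro!: derivative_eq_intros simp: field_simps)
    show "Cn m S (\<lambda>x. frechet_derivative f (at x) v * inverse (f x))" for v
      by (intro Cn_mult Cn_inverse assms(1) f(2) Cn_Suc_D[OF assms(2)[unfolded Suc]])
        (use assms(3) in force)
  qed
qed

lemma Cn_local:
  assumes "\<And>x. x \<in> S \<Longrightarrow> \<exists>U. open U \<and> x \<in> U \<and> Cn n (S \<inter> U) f"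
  shows "Cn n S f"
  using assms
proof (induct n arbitrary: f)
  case 0
  have "continuous (at x within S) f" if x: "x \<in> S" for x
  proof -
    obtain U where U: "open U" "x \<in> U" "continuous_on (S \<inter> U) f" using 0 x by auto
    have "at x within S = at x within (S \<inter> U)"
      by (rule at_within_nhd[OF U(2,1)]) auto
    with U(2,3) x show ?thesis by (auto simp: continuous_on_eq_continuous_within)
  qed
  then show ?case by (simp add: continuous_on_eq_continuous_within)
next
  case (Suc n)
  have 1: "f differentiable (at x)" if x: "x \<in> S" for x
    using Suc.prems[OF x] x by auto
  have 2: "Cn n S (\<lambda>x. frechet_derivative f (at x) v)" for v
  proof (rule Suc.hyps)
    fix x assume "x \<in> S"
    from Suc.prems[OF this] show "\<exists>U. open U \<and> x \<in> U \<and> Cn n (S \<inter> U) (\<lambda>x. frechet_derivative f (at x) v)"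
      by auto
  qed
  from 1 2 show ?case by simp
qed

section \<open>Symmetry of second derivatives\<close>

lemma second_difference_mean_value:
  fixes f :: "'v::real_normed_vector \<Rightarrow> real"
  assumes f: "Cn 2 S f" and h: "h > 0"
    and S: "\<And>s t. \<lbrakk>0 \<le> s; s \<le> h; 0 \<le> t; t \<le> h\<rbrakk> \<Longrightarrow> x + s *\<^sub>R u + t *\<^sub>R v \<in> S"
  shows "\<exists>s t. 0 \<le> s \<and> s \<le> h \<and> 0 \<le> t \<and> t \<le> h \<and>
    f (x + h *\<^sub>R u + h *\<^sub>R v) - f (x + h *\<^sub>R u) - f (x + h *\<^sub>R v) + f x =
    h\<^sup>2 * frechet_derivative (\<lambda>y. frechet_derivative f (at y) u) (at (x + s *\<^sub>R u + t *\<^sub>R v)) v"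
proof -
  note f1 = Cn_Suc_E[OF f[unfolded numeral_2_eq_2]]
  note f2 = Cn_Suc_E[OF f1(2)]
  let ?g = "\<lambda>y. frechet_derivative f (at y) u"
  have d1: "((\<lambda>s. f (x + s *\<^sub>R u + t *\<^sub>R v)) has_real_derivative ?g (x + s *\<^sub>R u + t *\<^sub>R v)) (at s)"
    if "0 \<le> s" "s \<le> h" "0 \<le> t" "t \<le> h" for s t
  proof -
    have "((\<lambda>s. f (x + s *\<^sub>R u + t *\<^sub>R v)) has_derivative
        (\<lambda>r. frechet_derivative f (at (x + s *\<^sub>R u + t *\<^sub>R v)) (r *\<^sub>R u))) (at s)"
      by (rule has_derivative_compose[where f="\<lambda>s. x + s *\<^sub>R u + t *\<^sub>R v" and g=f, OF _ f1(1)[OF S[OF that]]])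
        (auto intro!: derivative_eq_intros)
    moreover have "(\<lambda>r. frechet_derivative f (at (x + s *\<^sub>R u + t *\<^sub>R v)) (r *\<^sub>R u)) =
        (*) (?g (x + s *\<^sub>R u + t *\<^sub>R v))"
      by (rule ext) (simp only: linear_cmul[OF has_derivative_linear[OF f1(1)[OF S[OF that]]]]
          real_scaleR_def mult.commute)
    ultimately show ?thesis unfolding has_field_derivative_def by (simp only:)
  qed
  have d2: "((\<lambda>t. ?g (x + s *\<^sub>R u + t *\<^sub>R v)) has_real_derivative
      frechet_derivative ?g (at (x + s *\<^sub>R u + t *\<^sub>R v)) v) (at t)"
    if "0 \<le> s" "s \<le> h" "0 \<le> t" "t \<le> h" for s t
  proof -
    have "((\<lambda>t. ?g (x + s *\<^sub>R u + t *\<^sub>R v)) has_derivative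
        (\<lambda>r. frechet_derivative ?g (at (x + s *\<^sub>R u + t *\<^sub>R v)) (r *\<^sub>R v))) (at t)"
      by (rule has_derivative_compose[where f="\<lambda>t. x + s *\<^sub>R u + t *\<^sub>R v" and g="?g", OF _ f2(1)[OF S[OF that]]])
        (auto intro!: derivative_eq_intros)
    moreover have "(\<lambda>r. frechet_derivative ?g (at (x + s *\<^sub>R u + t *\<^sub>R v)) (r *\<^sub>R v)) =
        (*) (frechet_derivative ?g (at (x + s *\<^sub>R u + t *\<^sub>R v)) v)"
      by (rule ext) (simp only: linear_cmul[OF has_derivative_linear[OF f2(1)[OF S[OF that]]]]
          real_scaleR_def mult.commute)
    ultimately show ?thesis unfolding has_field_derivative_def by (simp only:)
  qed
  have "\<exists>s. 0 < s \<and> s < h \<and>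
    (f (x + h *\<^sub>R u + h *\<^sub>R v) - f (x + h *\<^sub>R u + 0 *\<^sub>R v)) - (f (x + 0 *\<^sub>R u + h *\<^sub>R v) - f (x + 0 *\<^sub>R u + 0 *\<^sub>R v)) =
     (h - 0) * (?g (x + s *\<^sub>R u + h *\<^sub>R v) - ?g (x + s *\<^sub>R u + 0 *\<^sub>R v))"
    by (rule MVT2[where f = "\<lambda>s. f (x + s *\<^sub>R u + h *\<^sub>R v) - f (x + s *\<^sub>R u + 0 *\<^sub>R v)"])
      (use h in \<open>auto intro!: DERIV_diff d1 d1[of _ 0, simplified]\<close>)
  then obtain s where s: "0 < s" "s < h"
    and 1: "f (x + h *\<^sub>R u + h *\<^sub>R v) - f (x + h *\<^sub>R u) - f (x + h *\<^sub>R v) + f x =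
     h * (?g (x + s *\<^sub>R u + h *\<^sub>R v) - ?g (x + s *\<^sub>R u + 0 *\<^sub>R v))"
    by auto
  have "\<exists>t. 0 < t \<and> t < h \<and>
    ?g (x + s *\<^sub>R u + h *\<^sub>R v) - ?g (x + s *\<^sub>R u + 0 *\<^sub>R v) =
     (h - 0) * frechet_derivative ?g (at (x + s *\<^sub>R u + t *\<^sub>R v)) v"
    by (rule MVT2) (use h s in \<open>auto intro!: d2\<close>)
  then obtain t where t: "0 < t" "t < h"
    and 2: "?g (x + s *\<^sub>R u + h *\<^sub>R v) - ?g (x + s *\<^sub>R u + 0 *\<^sub>R v) =
     h * frechet_derivative ?g (at (x + s *\<^sub>R u + t *\<^sub>R v)) v" by auto
  show ?thesis using s t 1 2 by (intro exI[of _ s] exI[of _ t]) (auto simp: power2_eq_square)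
qed

text \<open>The second difference of f over the parallelogram with sides h u and h v does not depend
  on the order of u and v, and it equals h^2 times either mixed derivative at some point of the
  parallelogram. If these differed at x by 2 e, continuity would contradict this for small
  h.\<close>

lemma second_derivative_commute:
  fixes f :: "'v::real_normed_vector \<Rightarrow> real"
  assumes S: "open S" and x: "x \<in> S" and f: "Cn 2 S f"
  shows "frechet_derivative (\<lambda>y. frechet_derivative f (at y) u) (at x) v =
    frechet_derivative (\<lambda>y. frechet_derivative f (at y) v) (at x) u"
proof (rule ccontr)
  let ?A = "\<lambda>y. frechet_derivative (\<lambda>y. frechet_derivative f (at y) u) (at y) v"
  let ?B = "\<lambda>y. frechet_derivative (\<lambda>y. frechet_derivative f (at y) v) (at y) u"
  assume ne: "?A x \<noteq> ?B x"
  define e where "e = \<bar>?A x - ?B x\<bar> / 2"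
  have e: "e > 0" using ne by (simp add: e_def)
  have "continuous_on S ?A" "continuous_on S ?B"
    using f by (auto simp: numeral_2_eq_2)
  then have "isCont ?A x" "isCont ?B x" using S x by (auto simp: continuous_on_eq_continuous_at)
  then obtain d1 d2 where d1: "d1 > 0" "\<And>y. dist y x < d1 \<Longrightarrow> \<bar>?A y - ?A x\<bar> < e"
    and d2: "d2 > 0" "\<And>y. dist y x < d2 \<Longrightarrow> \<bar>?B y - ?B x\<bar> < e"
    using e unfolding continuous_at_eps_delta dist_real_def by metis
  obtain d3 where d3: "d3 > 0" "ball x d3 \<subseteq> S" using S x open_contains_ball by blast
  define d where "d = min d1 (min d2 d3)"
  have d: "d > 0" using d1 d2 d3 by (simp add: d_def)
  define N where "N = norm u + norm v"
  \<comment> \<open>This h keeps every point of the parallelogram within d of x; the +1 covers u = v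
    = 0.\<close>
  define h where "h = d / (2 * (N + 1))"
  have N: "N \<ge> 0" by (simp add: N_def)
  then have h: "h > 0" using d by (simp add: h_def)
  have "h * N < h * (2 * (N + 1))" using N h by (intro mult_strict_left_mono) auto
  also have "\<dots> = d" using N by (simp add: h_def)
  finally have hd: "h * (norm u + norm v) < d" by (simp only: N_def)
  have near: "dist (x + s *\<^sub>R u' + t *\<^sub>R v') x < d"
    if "0 \<le> s" "s \<le> h" "0 \<le> t" "t \<le> h" "norm u' + norm v' = norm u + norm v" for s t u' v'
  proof -
    have "norm (s *\<^sub>R u' + t *\<^sub>R v') \<le> s * norm u' + t * norm v'"
      using norm_triangle_ineq[of "s *\<^sub>R u'" "t *\<^sub>R v'"] that by simp
    also have "\<dots> \<le> h * norm u' + h * norm v'"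
      using that by (intro add_mono mult_right_mono) auto
    also have "\<dots> = h * (norm u + norm v)" using that(5) by (simp add: distrib_left[symmetric])
    finally show ?thesis using hd by (simp add: dist_norm add.assoc)
  qed
  have inS: "y \<in> S" if "dist y x < d" for y
    using that d3 by (auto simp: d_def dist_commute)
  obtain s t where st: "0 \<le> s" "s \<le> h" "0 \<le> t" "t \<le> h"
    and 1: "f (x + h *\<^sub>R u + h *\<^sub>R v) - f (x + h *\<^sub>R u) - f (x + h *\<^sub>R v) + f x =
      h\<^sup>2 * ?A (x + s *\<^sub>R u + t *\<^sub>R v)"
    using second_difference_mean_value[OF f h, of x u v, OF inS[OF near]] by blast
  obtain s' t' where st': "0 \<le> s'" "s' \<le> h" "0 \<le> t'" "t' \<le> h"
    and 2: "f (x + h *\<^sub>R v + h *\<^sub>R u) - f (x + h *\<^sub>R v) - f (x + h *\<^sub>R u) + f x =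
      h\<^sup>2 * ?B (x + s' *\<^sub>R v + t' *\<^sub>R u)"
    using second_difference_mean_value[OF f h, of x v u, OF inS[OF near]] by (auto simp: add.commute)
  have "f (x + h *\<^sub>R v + h *\<^sub>R u) = f (x + h *\<^sub>R u + h *\<^sub>R v)" by (simp add: algebra_simps)
  with 1 2 have "h\<^sup>2 * ?A (x + s *\<^sub>R u + t *\<^sub>R v) = h\<^sup>2 * ?B (x + s' *\<^sub>R v + t' *\<^sub>R u)" by linarith
  then have eq: "?A (x + s *\<^sub>R u + t *\<^sub>R v) = ?B (x + s' *\<^sub>R v + t' *\<^sub>R u)" using h by simp
  have "\<bar>?A (x + s *\<^sub>R u + t *\<^sub>R v) - ?A x\<bar> < e"
    using near[of s t u v] st by (intro d1(2)) (simp add: d_def)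
  moreover have "\<bar>?B (x + s' *\<^sub>R v + t' *\<^sub>R u) - ?B x\<bar> < e"
    using near[of s' t' v u] st' by (intro d2(2)) (simp add: d_def)
  ultimately have "\<bar>?A x - ?B x\<bar> < 2 * e" using eq by linarith
  then show False by (simp add: e_def)
qed

section \<open>Holomorphic functions of several variables are smooth\<close>

lemma bounded_linear_vector_scale_left: "bounded_linear (\<lambda>c. c *s (v::complex^'n::finite))"
  by (rule linear_conv_bounded_linear[THEN iffD1], rule linearI) (auto simp: vec_eq_iff algebra_simps)

lemma holo_has_derivative:
  assumes "holo S f" "w \<in> S"
  shows "(f has_derivative frechet_derivative f (at w)) (at w)"
    and "frechet_derivative f (at w) (c *s v) = c * frechet_derivative f (at w) v"
proof -
  obtain D where D: "(f has_derivative D) (at w)" "\<forall>c v. D (c *s v) = c * D v"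
    using assms unfolding holo_def by blast
  have "frechet_derivative f (at w) = D" using frechet_derivative_at[OF D(1)] by simp
  then show "(f has_derivative frechet_derivative f (at w)) (at w)"
    and "frechet_derivative f (at w) (c *s v) = c * frechet_derivative f (at w) v"
    using D by auto
qed

lemma holo_imp_continuous_on: "holo S f \<Longrightarrow> continuous_on S f"
  by (meson continuous_at_imp_continuous_on has_derivative_continuous holo_has_derivative(1))

text \<open>The parametrization of \<open>circlepath 0 r\<close> over the unit interval. In Cauchy's
  formula for the first derivative its velocity, 2 pi i times the point, cancels the prefactor and
  one of the two powers in the denominator, so that a plain average remains.\<close>

definition circle_point :: "real \<Rightarrow> real \<Rightarrow> complex" where
  "circle_point r t = of_real r * exp (2 * of_real pi * \<i> * of_real t)"

lemma norm_circle_point: "r \<ge> 0 \<Longrightarrow> norm (circle_point r t) = r"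
  by (simp add: circle_point_def norm_mult)

lemma continuous_on_circle_point: "continuous_on T (circle_point r)"
  unfolding circle_point_def by (intro continuous_intros)

text \<open>Cauchy's formula on a circle in the direction \<open>v\<close> writes the directional derivative as an
  integral of \<open>f\<close> itself, which can be differentiated under the integral sign.\<close>

lemma holo_directional_integral:
  fixes f :: "complex^'n::finite \<Rightarrow> complex"
  assumes f: "holo S f" and r: "r > 0" and S: "\<And>u. norm u \<le> r \<Longrightarrow> w + u *s v \<in> S"
  shows "frechet_derivative f (at w) v = integral {0..1} (\<lambda>t. f (w + circle_point r t *s v) / circle_point r t)"
proof -
  let ?g = "\<lambda>u. f (w + u *s v)"
  have d: "(?g has_field_derivative frechet_derivative f (at (w + u *s v)) v) (at u)" if "norm u \<le> r" for u
  proof -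
    have 1: "((\<lambda>u. w + u *s v) has_derivative (\<lambda>u. u *s v)) (at u)"
      by (rule has_derivative_eq_rhs[OF has_derivative_add[OF has_derivative_const
          bounded_linear_imp_has_derivative[OF bounded_linear_vector_scale_left]]]) auto
    note h = holo_has_derivative[OF f S[OF that]]
    have "(?g has_derivative (\<lambda>c. frechet_derivative f (at (w + u *s v)) (c *s v))) (at u)"
      by (rule has_derivative_compose[where g = f, OF 1 h(1)])
    then show ?thesis unfolding has_field_derivative_def h(2) by (simp add: mult_commute_abs)
  qed
  have hol: "?g holomorphic_on ball 0 r"
    using d by (force simp: holomorphic_on_open)
  have cont: "continuous_on (cball 0 r) ?g"
    using d by (auto intro!: continuous_at_imp_continuous_on DERIV_isCont)
  have 0: "w + 0 *s v = w" by simp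
  have "frechet_derivative f (at w) v =
      1 / (2 * of_real pi * \<i>) * contour_integral (circlepath 0 r) (\<lambda>u. ?g u / (u - 0)^2)"
    using DERIV_unique[OF d[of 0] Cauchy_derivative_integral_circlepath(2)[OF cont hol, of 0]] r
    by (simp only: 0 norm_zero) simp
  also have "contour_integral (circlepath 0 r) (\<lambda>u. ?g u / (u - 0)^2) =
      integral {0..1} (\<lambda>t. (2 * of_real pi * \<i>) * (f (w + circle_point r t *s v) / circle_point r t))"
    unfolding contour_integral_integral
  proof (rule integral_cong)
    fix t :: real
    have "circle_point r t \<noteq> 0" using r by (simp add: circle_point_def)
    moreover have "circlepath 0 r t = circle_point r t" by (simp add: circlepath circle_point_def)
    moreover have "vector_derivative (circlepath 0 r) (at t) = 2 * of_real pi * \<i> * circle_point r t"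
      by (simp add: vector_derivative_circlepath circle_point_def)
    ultimately show "?g (circlepath 0 r t) / (circlepath 0 r t - 0)\<^sup>2 * vector_derivative (circlepath 0 r) (at t) =
      (2 * of_real pi * \<i>) * (f (w + circle_point r t *s v) / circle_point r t)"
      by (simp add: power2_eq_square)
  qed
  finally show ?thesis by (simp only: integral_mult_right) simp
qed

text \<open>One radius serves all centres near w0. This uniformity allows the integral formula to be
  differentiated in the centre.\<close>

lemma disc_in_open:
  fixes S :: "(complex^'n::finite) set"
  assumes "open S" "w0 \<in> S"
  shows "\<exists>r>0. \<exists>d>0. \<forall>w\<in>ball w0 d. \<forall>u. norm u \<le> r \<longrightarrow> w + u *s v \<in> S"
proof -
  obtain e where e: "e > 0" "ball w0 e \<subseteq> S" using assms open_contains_ball by blast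
  obtain K where K: "K > 0" "\<And>c. norm (c *s v) \<le> norm c * K"
    using bounded_linear.pos_bounded[OF bounded_linear_vector_scale_left[of v]] by blast
  have "w + u *s v \<in> S" if w: "dist w0 w < e/2" and u: "norm u \<le> e / (2*K)" for w u
  proof -
    have "norm (u *s v) \<le> e/2"
      using K(2)[of u] mult_right_mono[OF u, of K] K(1) by (simp add: field_simps)
    then have "dist w0 (w + u *s v) < e"
      using w by (simp add: dist_norm) norm
    then show ?thesis using e by auto
  qed
  then show ?thesis using e K by (intro exI[of _ "e/(2*K)"] conjI exI[of _ "e/2"]) auto
qed

text \<open>Comes before differentiability because the Leibniz rule asks for a jointly continuous
  derivative of the integrand. Here the integral formula uses only the continuity of f
  itself.\<close>

lemma holo_directional_continuous:
  fixes f :: "complex^'n::finite \<Rightarrow> complex"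
  assumes S: "open S" and f: "holo S f"
  shows "continuous_on S (\<lambda>w. frechet_derivative f (at w) v)"
proof -
  have "continuous (at w0) (\<lambda>w. frechet_derivative f (at w) v)" if w0: "w0 \<in> S" for w0
  proof -
    obtain r d where r: "r > 0" and d: "d > 0"
      and rd: "\<And>w u. w \<in> ball w0 d \<Longrightarrow> norm u \<le> r \<Longrightarrow> w + u *s v \<in> S"
      using disc_in_open[OF S w0, of v] by blast
    have nz: "circle_point r t \<noteq> 0" for t using r by (simp add: circle_point_def)
    have c: "continuous_on (ball w0 d \<times> cbox 0 1) (\<lambda>(w,t). f (w + circle_point r t *s v) / circle_point r t)"
      unfolding case_prod_beta
      by (intro continuous_intros continuous_on_compose2[OF holo_imp_continuous_on[OF f]]
          continuous_on_compose2[OF continuous_on_circle_point]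
          bounded_linear.continuous_on[OF bounded_linear_vector_scale_left])
        (use r rd nz in \<open>auto simp: norm_circle_point\<close>)
    have "continuous_on (ball w0 d) (\<lambda>w. integral (cbox 0 1) (\<lambda>t. f (w + circle_point r t *s v) / circle_point r t))"
      by (rule integral_continuous_on_param[OF c])
    then have "continuous_on (ball w0 d) (\<lambda>w. frechet_derivative f (at w) v)"
      by (rule continuous_on_eq)
        (use holo_directional_integral[OF f r rd] in \<open>auto\<close>)
    then show ?thesis using d by (simp add: continuous_on_eq_continuous_at)
  qed
  then show ?thesis by (simp add: continuous_at_imp_continuous_on)
qed

text \<open>Differentiation under the integral sign in Cauchy's formula. The derivatives of the
  integrand are packed as bounded linear maps \<open>B\<close>, whose integral is the derivative
  sought.\<close>

lemma holo_directional:
  fixes f :: "complex^'n::finite \<Rightarrow> complex"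
  assumes S: "open S" and f: "holo S f"
  shows "holo S (\<lambda>w. frechet_derivative f (at w) v)"
  unfolding holo_def
proof
  fix w0 assume w0: "w0 \<in> S"
  obtain r d where r: "r > 0" and d: "d > 0"
    and rd: "\<And>w u. w \<in> ball w0 d \<Longrightarrow> norm u \<le> r \<Longrightarrow> w + u *s v \<in> S"
    using disc_in_open[OF S w0, of v] by blast
  have nz: "circle_point r t \<noteq> 0" for t using r by (simp add: circle_point_def)
  have inS: "w + circle_point r t *s v \<in> S" if "w \<in> ball w0 d" for w t
    using rd[OF that] r by (simp add: norm_circle_point)
  define B where "B w t = Blinfun (\<lambda>h. frechet_derivative f (at (w + circle_point r t *s v)) h / circle_point r t)" for w t
  have B: "blinfun_apply (B w t) = (\<lambda>h. frechet_derivative f (at (w + circle_point r t *s v)) h / circle_point r t)"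
    if "w \<in> ball w0 d" for w t
    unfolding B_def
    by (intro bounded_linear_Blinfun_apply bounded_linear_compose[OF bounded_linear_divide]
        has_derivative_bounded_linear[OF holo_has_derivative(1)[OF f inS[OF that]]])
  let ?F = "\<lambda>w t. f (w + circle_point r t *s v) / circle_point r t"
  have shift: "continuous_on (ball w0 d \<times> cbox 0 1) (\<lambda>x. fst x + circle_point r (snd x) *s v)"
    by (intro continuous_intros continuous_on_compose2[OF continuous_on_circle_point]
        bounded_linear.continuous_on[OF bounded_linear_vector_scale_left]) auto
  have cB: "continuous_on (ball w0 d \<times> cbox 0 1) (\<lambda>(w,t). B w t)"
  proof (rule continuous_on_blinfun_componentwise)
    fix i :: "complex^'n" assume "i \<in> Basis"
    have "continuous_on (ball w0 d \<times> cbox 0 1)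
       (\<lambda>x. frechet_derivative f (at (fst x + circle_point r (snd x) *s v)) i / circle_point r (snd x))"
      by (intro continuous_intros continuous_on_compose2[OF holo_directional_continuous[OF S f] shift]
          continuous_on_compose2[OF continuous_on_circle_point]) (use nz inS in auto)
    then show "continuous_on (ball w0 d \<times> cbox 0 1) (\<lambda>x. blinfun_apply (case x of (w, t) \<Rightarrow> B w t) i)"
      by (rule continuous_on_eq) (auto simp: B)
  qed
  have cF: "continuous_on (ball w0 d \<times> cbox 0 1) (\<lambda>x. ?F (fst x) (snd x))"
    by (intro continuous_intros continuous_on_compose2[OF holo_imp_continuous_on[OF f] shift]
        continuous_on_compose2[OF continuous_on_circle_point]) (use nz inS in auto)
  have "((\<lambda>w. integral (cbox 0 1) (?F w)) has_derivative integral (cbox 0 1) (B w0)) (at w0 within ball w0 d)"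
  proof (rule leibniz_rule[OF _ _ cB])
    fix w t assume w: "w \<in> ball w0 d"
    have "((\<lambda>w. w + circle_point r t *s v) has_derivative (\<lambda>h. h)) (at w)"
      by (auto intro!: derivative_eq_intros)
    from has_derivative_compose[where g = f, OF this holo_has_derivative(1)[OF f inS[OF w]]]
    have "((\<lambda>w. ?F w t) has_derivative blinfun_apply (B w t)) (at w)"
      unfolding B[OF w] by (rule bounded_linear.has_derivative[OF bounded_linear_divide])
    then show "((\<lambda>w. ?F w t) has_derivative blinfun_apply (B w t)) (at w within ball w0 d)"
      by (rule has_derivative_at_withinI)
  next
    fix w assume w: "w \<in> ball w0 d"
    have "continuous_on (cbox 0 1) (\<lambda>t. ?F (fst (w,t)) (snd (w,t)))"
      by (rule continuous_on_compose2[OF cF, where f = "\<lambda>t. (w,t)"])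
        (use w in \<open>auto intro!: continuous_intros\<close>)
    then show "?F w integrable_on cbox 0 1" by (intro integrable_continuous) simp
  qed (use d in auto)
  then have "((\<lambda>w. integral (cbox 0 1) (?F w)) has_derivative integral (cbox 0 1) (B w0)) (at w0)"
    using d by (subst (asm) at_within_open) auto
  then have D: "((\<lambda>w. frechet_derivative f (at w) v) has_derivative integral (cbox 0 1) (B w0)) (at w0)"
    by (rule has_derivative_transform_within_open[where s = "ball w0 d"])
      (use d holo_directional_integral[OF f r rd] in auto)
  have Bint: "B w0 integrable_on cbox 0 1"
  proof (rule integrable_continuous)
    have "continuous_on (cbox 0 1) (\<lambda>t. case (w0, t) of (w, t) \<Rightarrow> B w t)"
      by (rule continuous_on_compose2[OF cB, of "cbox 0 1" "\<lambda>t. (w0,t)"], intro continuous_intros)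
        (use d in auto)
    then show "continuous_on (cbox 0 1) (B w0)" by simp
  qed
  have "blinfun_apply (integral (cbox 0 1) (B w0)) (c *s h) =
      c * blinfun_apply (integral (cbox 0 1) (B w0)) h" for c h
  proof -
    \<comment> \<open>\<open>?L\<close> measures the failure of complex homogeneity. It is bounded
      linear in the map and vanishes on every \<open>B w0 t\<close>, so it vanishes on the
      integral.\<close>
    let ?L = "\<lambda>A::(complex^'n) \<Rightarrow>\<^sub>L complex. blinfun_apply A (c *s h) - c * blinfun_apply A h"
    have L: "bounded_linear ?L"
      by (intro bounded_linear_sub bounded_linear_const_mult blinfun.bounded_linear_left)
    have "?L (integral (cbox 0 1) (B w0)) = integral (cbox 0 1) (?L \<circ> B w0)"
      by (rule integral_linear[OF Bint L, symmetric])
    also have "?L \<circ> B w0 = (\<lambda>t. 0)"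
      using B[of w0] d holo_has_derivative(2)[OF f inS[of w0]] by (auto simp: o_def)
    finally show ?thesis by simp
  qed
  with D show "\<exists>D. ((\<lambda>w. frechet_derivative f (at w) v) has_derivative D) (at w0) \<and>
      (\<forall>c v. D (c *s v) = c * D v)" by blast
qed

lemma holo_imp_Cn: "open S \<Longrightarrow> holo S f \<Longrightarrow> Cn n S f"
proof (induct n arbitrary: f)
  case 0
  then show ?case by (simp add: holo_imp_continuous_on)
next
  case (Suc n)
  then show ?case
    using holo_directional by (auto simp: differentiable_def intro: holo_has_derivative(1))
qed

section \<open>Wirtinger derivatives and the Levi form\<close>

lemma real_linear_complex_decomposition:
  fixes D :: "complex^'n::finite \<Rightarrow> complex"
  assumes "linear D"
  shows "D v = (\<Sum>a\<in>UNIV. (D (axis a 1) - \<i> * D (axis a \<i>)) / 2 * v $ a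
    + (D (axis a 1) + \<i> * D (axis a \<i>)) / 2 * cnj (v $ a))"
proof -
  have "v = (\<Sum>a\<in>UNIV. Re (v $ a) *\<^sub>R axis a 1 + Im (v $ a) *\<^sub>R axis a \<i>)"
    by (simp add: vec_eq_iff axis_def if_distrib[of "\<lambda>x. _ *\<^sub>R x"] sum.distrib complex_eq_iff
        cong: if_cong)
  then have "D v = (\<Sum>a\<in>UNIV. Re (v $ a) *\<^sub>R D (axis a 1) + Im (v $ a) *\<^sub>R D (axis a \<i>))"
    by (metis (no_types, lifting) linear_sum[OF assms] linear_add[OF assms] linear_cmul[OF assms] sum.cong)
  also have "\<dots> = (\<Sum>a\<in>UNIV. (D (axis a 1) - \<i> * D (axis a \<i>)) / 2 * v $ a
    + (D (axis a 1) + \<i> * D (axis a \<i>)) / 2 * cnj (v $ a))"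
    by (rule sum.cong) (auto simp: complex_eq_iff field_simps)
  finally show ?thesis .
qed

lemma has_derivative_wirt:
  assumes "(h has_derivative D) (at w)"
  shows "wirt j h w = (D (axis j 1) - \<i> * D (axis j \<i>)) / 2"
    and "wirt_bar j h w = (D (axis j 1) + \<i> * D (axis j \<i>)) / 2"
    and "D v = (\<Sum>a\<in>UNIV. wirt a h w * v $ a + wirt_bar a h w * cnj (v $ a))"
proof -
  have e: "frechet_derivative h (at w) = D"
    using assms by (rule frechet_derivative_at[symmetric])
  show 1: "wirt j h w = (D (axis j 1) - \<i> * D (axis j \<i>)) / 2"
    and 2: "wirt_bar j h w = (D (axis j 1) + \<i> * D (axis j \<i>)) / 2" for j
    by (simp_all only: wirt_def wirt_bar_def e)
  show "D v = (\<Sum>a\<in>UNIV. wirt a h w * v $ a + wirt_bar a h w * cnj (v $ a))"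
    unfolding 1 2 by (rule real_linear_complex_decomposition[OF has_derivative_linear[OF assms]])
qed

lemma axis_i: "axis j \<i> = \<i> *s axis j (1::complex)"
  by (simp add: vec_eq_iff axis_def)

lemma holo_wirt:
  assumes "holo S f" "w \<in> S"
  shows "wirt j f w = frechet_derivative f (at w) (axis j 1)" and "wirt_bar j f w = 0"
  unfolding wirt_def wirt_bar_def axis_i holo_has_derivative(2)[OF assms] by (simp_all add: algebra_simps)

lemma holo_wirt_holo:
  assumes "open S" "holo S f" shows "holo S (wirt j f)"
proof -
  have "holo S (\<lambda>w. frechet_derivative f (at w) (axis j 1))"
    by (rule holo_directional[OF assms])
  then have d: "\<forall>w\<in>S. \<exists>D. ((\<lambda>w. frechet_derivative f (at w) (axis j 1)) has_derivative D) (at w) \<and> (\<forall>c v. D (c *s v) = c * D v)"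
    by (simp add: holo_def)
  show ?thesis unfolding holo_def
  proof
    fix w assume w: "w \<in> S"
    obtain D where D: "((\<lambda>w. frechet_derivative f (at w) (axis j 1)) has_derivative D) (at w)" "\<forall>c v. D (c *s v) = c * D v"
      using d w by blast
    have "(wirt j f has_derivative D) (at w)"
      by (rule has_derivative_transform_within_open[OF D(1) assms(1) w])
        (simp add: holo_wirt(1)[OF assms(2)])
    with D(2) show "\<exists>D. (wirt j f has_derivative D) (at w) \<and> (\<forall>c v. D (c *s v) = c * D v)" by blast
  qed
qed

section \<open>Holomorphic maps and the chain rule for the Levi matrix\<close>

definition holo_map :: "(complex^'n::finite) set \<Rightarrow> (complex^'n \<Rightarrow> complex^'m::finite) \<Rightarrow> bool" where
  "holo_map S g \<longleftrightarrow> (\<forall>j. holo S (\<lambda>w. g w $ j))"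

lemma bounded_linear_axis: "bounded_linear (\<lambda>z::'a::euclidean_space. axis a z :: 'a^'m::finite)"
  by (rule linear_conv_bounded_linear[THEN iffD1], rule linearI) (auto simp: vec_eq_iff axis_def)

lemma sum_axis_components: "(\<Sum>a\<in>UNIV. axis a (x $ a)) = (x :: 'a::comm_monoid_add^'m::finite)"
  by (simp add: vec_eq_iff axis_def)

lemma holo_map_has_derivative:
  fixes g :: "complex^'n::finite \<Rightarrow> complex^'m::finite"
  assumes "holo_map S g" "w \<in> S"
  shows "(g has_derivative (\<lambda>v. \<chi> a. \<Sum>j\<in>UNIV. wirt j (\<lambda>w. g w $ a) w * v $ j)) (at w)"
proof -
  have 1: "((\<lambda>w. g w $ a) has_derivative (\<lambda>v. \<Sum>j\<in>UNIV. wirt j (\<lambda>w. g w $ a) w * v $ j)) (at w)" for a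
  proof (rule has_derivative_eq_rhs)
    have h: "holo S (\<lambda>w. g w $ a)" using assms by (simp add: holo_map_def)
    show 2: "((\<lambda>w. g w $ a) has_derivative frechet_derivative (\<lambda>w. g w $ a) (at w)) (at w)"
      by (rule holo_has_derivative(1)[OF h assms(2)])
    show "frechet_derivative (\<lambda>w. g w $ a) (at w) = (\<lambda>v. \<Sum>j\<in>UNIV. wirt j (\<lambda>w. g w $ a) w * v $ j)"
      by (rule ext, subst has_derivative_wirt(3)[OF 2]) (simp add: holo_wirt(2)[OF h assms(2)])
  qed
  have "((\<lambda>w. \<Sum>a\<in>UNIV. axis a (g w $ a)) has_derivative
      (\<lambda>v. \<Sum>a\<in>UNIV. axis a (\<Sum>j\<in>UNIV. wirt j (\<lambda>w. g w $ a) w * v $ j))) (at w)"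
    by (intro has_derivative_sum bounded_linear.has_derivative[OF bounded_linear_axis] 1)
  moreover have "(\<Sum>a\<in>UNIV. axis a (x a)) = (\<chi> a. x a)" for x :: "'m \<Rightarrow> complex"
    by (simp add: vec_eq_iff axis_def)
  ultimately show ?thesis by (simp only: sum_axis_components)
qed

lemma holo_map_Cn:
  fixes g :: "complex^'n::finite \<Rightarrow> complex^'m::finite"
  assumes S: "open S" and g: "holo_map S g"
  shows "Cn n S g"
proof -
  have "holo S (\<lambda>w. g w $ a)" for a using g by (simp add: holo_map_def)
  then have "Cn n S (\<lambda>w. \<Sum>a\<in>UNIV. axis a (g w $ a))"
    by (intro Cn_sum[OF S] Cn_bounded_linear_compose[OF S bounded_linear_axis] holo_imp_Cn[OF S])
  then show ?thesis by (simp only: sum_axis_components)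
qed

lemma wirt_compose_holo:
  assumes g: "holo_map S g" and w: "w \<in> S" and h: "h differentiable (at (g w))"
  shows "wirt j (\<lambda>w. h (g w)) w = (\<Sum>a\<in>UNIV. wirt a h (g w) * wirt j (\<lambda>w. g w $ a) w)"
    and "wirt_bar j (\<lambda>w. h (g w)) w = (\<Sum>a\<in>UNIV. wirt_bar a h (g w) * cnj (wirt j (\<lambda>w. g w $ a) w))"
proof -
  obtain D where D: "(h has_derivative D) (at (g w))" using h by (auto simp: differentiable_def)
  let ?G = "\<lambda>v. \<chi> a. \<Sum>j\<in>UNIV. wirt j (\<lambda>w. g w $ a) w * v $ j"
  have c: "((\<lambda>w. h (g w)) has_derivative (\<lambda>v. D (?G v))) (at w)"
    by (rule has_derivative_compose[where g = h, OF holo_map_has_derivative[OF g w] D])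
  have G: "?G (axis j x) $ a = wirt j (\<lambda>w. g w $ a) w * x" for j x a
    by (simp add: axis_def if_distrib cong: if_cong)
  have DG: "D (?G (axis j x)) = (\<Sum>a\<in>UNIV. wirt a h (g w) * (wirt j (\<lambda>w. g w $ a) w * x)
      + wirt_bar a h (g w) * cnj (wirt j (\<lambda>w. g w $ a) w * x))" for j x
    unfolding has_derivative_wirt(3)[OF D] G ..
  show "wirt j (\<lambda>w. h (g w)) w = (\<Sum>a\<in>UNIV. wirt a h (g w) * wirt j (\<lambda>w. g w $ a) w)"
    unfolding has_derivative_wirt(1)[OF c] DG
    by (simp add: sum_distrib_left sum_subtractf[symmetric] sum_divide_distrib algebra_simps)
  show "wirt_bar j (\<lambda>w. h (g w)) w = (\<Sum>a\<in>UNIV. wirt_bar a h (g w) * cnj (wirt j (\<lambda>w. g w $ a) w))"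
    unfolding has_derivative_wirt(2)[OF c] DG
    by (simp add: sum_distrib_left sum.distrib[symmetric] sum_divide_distrib algebra_simps)
qed

lemma wirt_cong:
  assumes "open S" "w \<in> S" "\<And>w. w \<in> S \<Longrightarrow> f w = g w" "f differentiable (at w)"
  shows "wirt j f w = wirt j g w" "wirt_bar j f w = wirt_bar j g w"
proof -
  obtain D where D: "(f has_derivative D) (at w)" using assms(4) by (auto simp: differentiable_def)
  have g: "(g has_derivative D) (at w)"
    by (rule has_derivative_transform_within_open[OF D assms(1,2,3)])
  show "wirt j f w = wirt j g w" "wirt_bar j f w = wirt_bar j g w"
    unfolding has_derivative_wirt(1,2)[OF D] has_derivative_wirt(1,2)[OF g] by (rule refl)+
qed

lemma wirt_mult:
  assumes "f differentiable (at w)" "g differentiable (at w)"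
  shows "wirt j (\<lambda>w. f w * g w) w = f w * wirt j g w + wirt j f w * g w"
proof -
  obtain D E where D: "(f has_derivative D) (at w)" and E: "(g has_derivative E) (at w)"
    using assms by (auto simp: differentiable_def)
  show ?thesis
    unfolding has_derivative_wirt(1)[OF D] has_derivative_wirt(1)[OF E]
      has_derivative_wirt(1)[OF has_derivative_mult[OF D E]]
    by (simp add: field_simps)
qed

lemma wirt_sum:
  assumes "finite A" "\<And>a. a \<in> A \<Longrightarrow> f a differentiable (at w)"
  shows "wirt j (\<lambda>w. \<Sum>a\<in>A. f a w) w = (\<Sum>a\<in>A. wirt j (f a) w)"
proof -
  have D: "(f a has_derivative frechet_derivative (f a) (at w)) (at w)" if "a \<in> A" for a
    using assms(2)[OF that] frechet_derivative_works by auto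
  have "wirt j (\<lambda>w. \<Sum>a\<in>A. f a w) w = ((\<Sum>a\<in>A. frechet_derivative (f a) (at w) (axis j 1))
      - \<i> * (\<Sum>a\<in>A. frechet_derivative (f a) (at w) (axis j \<i>))) / 2"
    by (rule has_derivative_wirt(1)[OF has_derivative_sum[OF D]])
  also have "\<dots> = (\<Sum>a\<in>A. wirt j (f a) w)"
    by (simp only: wirt_def sum_distrib_left sum_subtractf[symmetric] sum_divide_distrib)
  finally show ?thesis .
qed

lemma wirt_cnj:
  assumes "f differentiable (at w)"
  shows "wirt j (\<lambda>w. cnj (f w)) w = cnj (wirt_bar j f w)"
proof -
  obtain D where D: "(f has_derivative D) (at w)" using assms by (auto simp: differentiable_def)
  show ?thesis
    unfolding has_derivative_wirt(2)[OF D] has_derivative_wirt(1)[OF has_derivative_cnj[OF D]]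
    by simp
qed

lemma Cn_wirt:
  fixes f :: "complex^'n::finite \<Rightarrow> complex"
  assumes "open S" "Cn (Suc n) S f"
  shows "Cn n S (wirt_bar j f)" "Cn n S (wirt j f)"
proof -
  have 1: "Cn n S (\<lambda>w. frechet_derivative f (at w) v)" for v
    by (rule Cn_Suc_E(2)[OF assms(2)])
  have 2: "Cn n S (\<lambda>w. c * frechet_derivative f (at w) v)" for v c
    by (rule Cn_mult[OF assms(1) Cn_const[OF assms(1)] 1])
  have "Cn n S (\<lambda>w. 1/2 * frechet_derivative f (at w) (axis j 1) + (\<i>/2) * frechet_derivative f (at w) (axis j \<i>))"
    by (intro Cn_add assms(1) 2)
  then show "Cn n S (wirt_bar j f)" by (simp add: wirt_bar_def[abs_def] field_simps)
  have "Cn n S (\<lambda>w. 1/2 * frechet_derivative f (at w) (axis j 1) + (-\<i>/2) * frechet_derivative f (at w) (axis j \<i>))"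
    by (intro Cn_add assms(1) 2)
  then show "Cn n S (wirt j f)" by (simp add: wirt_def[abs_def] field_simps)
qed

lemma Cn_of_real:
  fixes f :: "'v::real_normed_vector \<Rightarrow> real"
  assumes "open S" "Cn n S f" shows "Cn n S (\<lambda>x. complex_of_real (f x))"
  by (rule Cn_bounded_linear_compose[OF assms(1) bounded_linear_of_real assms(2)])

lemma Cn_Suc_differentiable:
  assumes "Cn (Suc n) S f" "x \<in> S" shows "f differentiable (at x)"
  using assms by simp

lemma levi_continuous:
  fixes f :: "complex^'n::finite \<Rightarrow> real"
  assumes S: "open S" and f: "Cn 2 S f"
  shows "continuous_on S (\<lambda>w. levi f w $ j $ k)"
proof -
  have "Cn (Suc (Suc 0)) S (\<lambda>w. complex_of_real (f w))"
    using Cn_of_real[OF S f] by (simp only: numeral_2_eq_2)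
  then have "Cn 0 S (wirt j (wirt_bar k (\<lambda>w. complex_of_real (f w))))"
    by (intro Cn_wirt S)
  then show ?thesis by (simp add: levi_def)
qed

text \<open>The Jacobian of g is holomorphic, so in the second differentiation the Wirtinger
  derivative of its conjugate vanishes and no second derivatives of g appear: the Levi matrix
  transforms as a Hermitian form.\<close>

lemma levi_compose_holo:
  fixes g :: "complex^'n::finite \<Rightarrow> complex^'n" and f :: "complex^'n \<Rightarrow> real"
  assumes S: "open S" and T: "open T" and g: "holo_map S g" and gS: "g ` S \<subseteq> T"
    and f: "Cn 2 T f" and w: "w \<in> S"
  shows "levi (\<lambda>w. f (g w)) w $ j $ k = (\<Sum>a\<in>UNIV. \<Sum>b\<in>UNIV.
    levi f (g w) $ a $ b * wirt j (\<lambda>w. g w $ a) w * cnj (wirt k (\<lambda>w. g w $ b) w))"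
proof -
  let ?h = "\<lambda>w. complex_of_real (f w)"
  let ?G = "\<lambda>j a. wirt j (\<lambda>w. g w $ a)"
  have h: "Cn (Suc (Suc 0)) T ?h"
    using Cn_of_real[OF T f] by (simp only: numeral_2_eq_2)
  have hb: "Cn (Suc 0) T (wirt_bar b ?h)" for b by (rule Cn_wirt(1)[OF T h])
  have G: "holo S (?G j a)" for j a
    using g by (intro holo_wirt_holo S) (simp add: holo_map_def)
  have dG: "?G j a differentiable (at w)" if "w \<in> S" for j a w
    using holo_has_derivative(1)[OF G that] by (auto simp: differentiable_def)
  have dG': "(\<lambda>w. cnj (?G j a w)) differentiable (at w)" if "w \<in> S" for j a w
    using has_derivative_cnj[OF holo_has_derivative(1)[OF G that]] by (auto simp: differentiable_def)
  have dg: "g differentiable (at w)" if "w \<in> S" for w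
    using holo_map_has_derivative[OF g that] by (auto simp: differentiable_def)
  have dhb: "(\<lambda>w. wirt_bar b ?h (g w)) differentiable (at w)" if "w \<in> S" for b w
    using differentiable_compose[of "wirt_bar b ?h" g w UNIV] Cn_Suc_differentiable[OF hb, of "g w" b] dg[OF that] gS that
    by (auto simp: image_subset_iff intro: differentiable_at_withinI)
  let ?R = "\<lambda>w. \<Sum>b\<in>UNIV. wirt_bar b ?h (g w) * cnj (?G k b w)"
  have 1: "wirt_bar k (\<lambda>w. ?h (g w)) w = ?R w" if "w \<in> S" for w
    using that gS by (intro wirt_compose_holo(2)[OF g that] Cn_Suc_differentiable[OF h]) auto
  have dp: "(\<lambda>w. wirt_bar b ?h (g w) * cnj (?G k b w)) differentiable (at w)" for b
    by (intro differentiable_mult dhb dG' w)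
  have dR: "?R differentiable (at w)"
    by (intro differentiable_sum) (auto intro: dp)
  have "levi (\<lambda>w. f (g w)) w $ j $ k = wirt j (wirt_bar k (\<lambda>w. ?h (g w))) w"
    by (simp add: levi_def)
  also have "\<dots> = wirt j ?R w"
    by (rule wirt_cong(1)[OF S w _ dR, symmetric]) (simp add: 1)
  also have "\<dots> = (\<Sum>b\<in>UNIV. wirt j (\<lambda>w. wirt_bar b ?h (g w) * cnj (?G k b w)) w)"
    by (rule wirt_sum) (auto intro: dp)
  also have "\<dots> = (\<Sum>b\<in>UNIV. wirt j (\<lambda>w. wirt_bar b ?h (g w)) w * cnj (?G k b w))"
    by (simp add: wirt_mult[OF dhb[OF w] dG'[OF w]] wirt_cnj[OF dG[OF w]] holo_wirt(2)[OF G w])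
  also have "\<dots> = (\<Sum>b\<in>UNIV. (\<Sum>a\<in>UNIV. wirt a (wirt_bar b ?h) (g w) * ?G j a w) * cnj (?G k b w))"
    using w gS by (intro sum.cong refl arg_cong2[where f = "(*)"] wirt_compose_holo(1)[OF g w] Cn_Suc_differentiable[OF hb]) auto
  also have "\<dots> = (\<Sum>b\<in>UNIV. \<Sum>a\<in>UNIV. levi f (g w) $ a $ b * ?G j a w * cnj (?G k b w))"
    by (simp add: levi_def sum_distrib_right)
  finally show ?thesis by (subst sum.swap)
qed

lemma levi_add:
  fixes f g :: "complex^'n::finite \<Rightarrow> real"
  assumes S: "open S" and f: "Cn 2 S f" and g: "Cn 2 S g" and w: "w \<in> S"
  shows "levi (\<lambda>w. f w + g w) w $ j $ k = levi f w $ j $ k + levi g w $ j $ k"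
proof -
  let ?f = "\<lambda>w. complex_of_real (f w)" and ?g = "\<lambda>w. complex_of_real (g w)"
  have h: "Cn (Suc (Suc 0)) S ?f" "Cn (Suc (Suc 0)) S ?g"
    using Cn_of_real[OF S f] Cn_of_real[OF S g] by (simp_all only: numeral_2_eq_2)
  have d: "(?f has_derivative frechet_derivative ?f (at w)) (at w)"
    "(?g has_derivative frechet_derivative ?g (at w)) (at w)" if "w \<in> S" for w
    using Cn_Suc_E(1)[OF h(1) that] Cn_Suc_E(1)[OF h(2) that] by auto
  have 1: "wirt_bar k (\<lambda>w. complex_of_real (f w + g w)) w = wirt_bar k ?f w + wirt_bar k ?g w" if "w \<in> S" for w
    unfolding of_real_add has_derivative_wirt(2)[OF has_derivative_add[OF d[OF that]]]
    by (simp add: wirt_bar_def field_simps)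
  have d': "wirt_bar k ?f differentiable (at w)" "wirt_bar k ?g differentiable (at w)"
    using Cn_Suc_differentiable[OF Cn_wirt(1)[OF S h(1)] w] Cn_Suc_differentiable[OF Cn_wirt(1)[OF S h(2)] w]
    by auto
  then obtain D E where DE: "(wirt_bar k ?f has_derivative D) (at w)" "(wirt_bar k ?g has_derivative E) (at w)"
    by (auto simp: differentiable_def)
  have "wirt j (wirt_bar k (\<lambda>w. complex_of_real (f w + g w))) w = wirt j (\<lambda>w. wirt_bar k ?f w + wirt_bar k ?g w) w"
    by (rule wirt_cong(1)[OF S w _ differentiable_add[OF d'], symmetric]) (simp only: 1)
  also have "\<dots> = wirt j (wirt_bar k ?f) w + wirt j (wirt_bar k ?g) w"
    unfolding has_derivative_wirt(1)[OF has_derivative_add[OF DE]] has_derivative_wirt(1)[OF DE(1)] has_derivative_wirt(1)[OF DE(2)]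
    by (simp add: field_simps)
  finally show ?thesis by (simp add: levi_def)
qed

lemma levi_cong:
  fixes f g :: "complex^'n::finite \<Rightarrow> real"
  assumes S: "open S" and f: "Cn 2 S f" and w: "w \<in> S" and eq: "\<And>w. w \<in> S \<Longrightarrow> f w = g w"
  shows "levi f w = levi g w"
proof -
  let ?f = "\<lambda>w. complex_of_real (f w)" and ?g = "\<lambda>w. complex_of_real (g w)"
  have h: "Cn (Suc (Suc 0)) S ?f"
    using Cn_of_real[OF S f] by (simp_all only: numeral_2_eq_2)
  have 1: "wirt_bar k ?f w = wirt_bar k ?g w" if "w \<in> S" for w k
    by (rule wirt_cong(2)[OF S that _ Cn_Suc_differentiable[OF h that]]) (simp only: eq)
  have "wirt j (wirt_bar k ?f) w = wirt j (wirt_bar k ?g) w" for j k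
    by (rule wirt_cong(1)[OF S w _ Cn_Suc_differentiable[OF Cn_wirt(1)[OF S h] w]]) (simp only: 1)
  then show ?thesis by (simp only: levi_def)
qed

lemma norm2_eq_Re_mult_cnj:
  "norm z ^ 2 = Re (z * cnj z)"
  by (simp add: complex_norm_square[symmetric] flip: of_real_power)

lemma Cn_norm2:
  fixes F :: "complex^'n::finite \<Rightarrow> complex"
  assumes "open S" "Cn n S F" shows "Cn n S (\<lambda>w. (norm (F w))\<^sup>2)"
  unfolding norm2_eq_Re_mult_cnj
  by (intro Cn_bounded_linear_compose[OF assms(1) bounded_linear_Re] Cn_mult assms
      Cn_bounded_linear_compose[OF assms(1) bounded_linear_cnj])

text \<open>The logarithm of |F|^2 is pluriharmonic: its derivative is F'/F plus the conjugate, so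
  the antiholomorphic Wirtinger derivative is the conjugate of the holomorphic function
  \<open>?q\<close> and is annihilated by the holomorphic one. Thus a change of holomorphic frame
  does not affect the curvature.\<close>

lemma levi_ln_norm2_holo:
  fixes F :: "complex^'n::finite \<Rightarrow> complex"
  assumes S: "open S" and F: "holo S F" and nz: "\<And>w. w \<in> S \<Longrightarrow> F w \<noteq> 0" and w: "w \<in> S"
  shows "levi (\<lambda>w. ln ((norm (F w))\<^sup>2)) w $ j $ k = 0"
proof -
  let ?L = "\<lambda>w. complex_of_real (ln ((norm (F w))\<^sup>2))"
  let ?D = "\<lambda>w. frechet_derivative F (at w)"
  let ?q = "\<lambda>w. wirt k F w * inverse (F w)"
  have dL: "(?L has_derivative (\<lambda>v. ?D w v * inverse (F w) + cnj (?D w v * inverse (F w)))) (at w)" if w: "w \<in> S" for w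
  proof -
    note d = holo_has_derivative(1)[OF F w]
    have p: "(norm (F w))\<^sup>2 > 0" using nz[OF w] by simp
    have r: "Re (F w * cnj (?D w v) + ?D w v * cnj (F w)) / (norm (F w))\<^sup>2
        = Re (?D w v * inverse (F w) + cnj (?D w v * inverse (F w)))" for v
    proof -
      have "inverse (F w) = cnj (F w) / of_real ((norm (F w))\<^sup>2)"
        using nz[OF w] unfolding complex_norm_square by (simp add: field_simps)
      then have "?D w v * inverse (F w) = ?D w v * cnj (F w) / of_real ((norm (F w))\<^sup>2)" by simp
      then have "Re (?D w v * inverse (F w)) = Re (?D w v * cnj (F w)) / (norm (F w))\<^sup>2"
        by (simp only: Re_divide_of_real)
      moreover have "Re (X + cnj X) = 2 * Re X" for X by simp
      moreover have "Re (F w * cnj (?D w v) + ?D w v * cnj (F w)) = 2 * Re (?D w v * cnj (F w))"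
        by simp
      ultimately show ?thesis by (simp only: times_divide_eq_right)
    qed
    have "((\<lambda>w. (norm (F w))\<^sup>2) has_derivative (\<lambda>v. Re (F w * cnj (?D w v) + ?D w v * cnj (F w)))) (at w)"
      unfolding norm2_eq_Re_mult_cnj
      by (intro bounded_linear.has_derivative[OF bounded_linear_Re] has_derivative_mult d has_derivative_cnj)
    then have "((\<lambda>w. ln ((norm (F w))\<^sup>2)) has_derivative
        (\<lambda>v. Re (F w * cnj (?D w v) + ?D w v * cnj (F w)) * inverse ((norm (F w))\<^sup>2))) (at w)"
      by (rule has_derivative_ln[where g = "\<lambda>w. (norm (F w))\<^sup>2" and x = w, OF p])
    then have "(?L has_derivative (\<lambda>v. of_real (Re (F w * cnj (?D w v) + ?D w v * cnj (F w)) / (norm (F w))\<^sup>2))) (at w)"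
      unfolding divide_inverse by (rule bounded_linear.has_derivative[OF bounded_linear_of_real])
    then show ?thesis unfolding r
      by (rule has_derivative_eq_rhs) (auto simp: complex_eq_iff)
  qed
  have 1: "wirt_bar k ?L w = cnj (?q w)" if w: "w \<in> S" for w
    unfolding has_derivative_wirt(2)[OF dL[OF w]] axis_i holo_has_derivative(2)[OF F w] holo_wirt(1)[OF F w]
    by (simp add: field_simps)
  have q: "?q differentiable (at w)" "wirt_bar j ?q w = 0"
  proof -
    obtain E where E: "(wirt k F has_derivative E) (at w)" "\<And>c v. E (c *s v) = c * E v"
      using holo_wirt_holo[OF S F, of k] w by (auto simp: holo_def)
    have d: "(?q has_derivative (\<lambda>v. wirt k F w * (- (inverse (F w) * ?D w v * inverse (F w))) + E v * inverse (F w))) (at w)"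
      by (intro has_derivative_mult E(1) Deriv.has_derivative_inverse[where f = F and x = w, OF nz[OF w]] holo_has_derivative(1)[OF F w])
    then show "?q differentiable (at w)" by (auto simp: differentiable_def)
    show "wirt_bar j ?q w = 0"
      unfolding has_derivative_wirt(2)[OF d] axis_i holo_has_derivative(2)[OF F w] E(2)
      by (simp add: algebra_simps)
  qed
  have dq: "(\<lambda>w. cnj (?q w)) differentiable (at w)"
    using q(1) has_derivative_cnj by (fastforce simp: differentiable_def)
  have "wirt j (wirt_bar k ?L) w = wirt j (\<lambda>w. cnj (?q w)) w"
    by (rule wirt_cong(1)[OF S w _ dq, symmetric]) (simp only: 1)
  also have "\<dots> = 0" by (simp only: wirt_cnj[OF q(1)] q(2)) simp
  finally show ?thesis by (simp add: levi_def)
qed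

section \<open>Levi matrix and determinant in logarithmic coordinates\<close>

definition twice_Re :: "complex^'n::finite \<Rightarrow> real^'n" where
  "twice_Re \<zeta> = (\<chi> j. 2 * Re (\<zeta> $ j))"

lemma bounded_linear_twice_Re: "bounded_linear (twice_Re :: complex^'n::finite \<Rightarrow> real^'n)"
  by (rule linear_conv_bounded_linear[THEN iffD1], rule linearI) (auto simp: vec_eq_iff twice_Re_def)

lemma twice_Re_axis [simp]: "twice_Re (axis j 1) = 2 *\<^sub>R axis j 1" "twice_Re (axis j \<i>) = 0"
  by (auto simp: vec_eq_iff twice_Re_def axis_def)

text \<open>With z = exp \<zeta> the coordinate \<rho> is 2 Re \<zeta>. This factor 2 cancels the
  1/2 in the Wirtinger derivatives, and therefore the Levi matrix of a function of \<rho> is its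
  real Hessian without any constant.\<close>

lemma wirt_twice_Re:
  fixes h :: "real^'n::finite \<Rightarrow> real"
  assumes "(h has_derivative D) (at (twice_Re \<zeta>))"
  shows "wirt j (\<lambda>\<zeta>. complex_of_real (h (twice_Re \<zeta>))) \<zeta> = of_real (D (axis j 1))"
    and "wirt_bar j (\<lambda>\<zeta>. complex_of_real (h (twice_Re \<zeta>))) \<zeta> = of_real (D (axis j 1))"
proof -
  have d: "((\<lambda>\<zeta>. complex_of_real (h (twice_Re \<zeta>))) has_derivative (\<lambda>v. of_real (D (twice_Re v)))) (at \<zeta>)"
    by (intro bounded_linear.has_derivative[OF bounded_linear_of_real]
        has_derivative_compose[where g = h, OF bounded_linear_imp_has_derivative[OF bounded_linear_twice_Re] assms])
  have lin: "linear D" using assms by (rule has_derivative_linear)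
  show "wirt j (\<lambda>\<zeta>. complex_of_real (h (twice_Re \<zeta>))) \<zeta> = of_real (D (axis j 1))"
    "wirt_bar j (\<lambda>\<zeta>. complex_of_real (h (twice_Re \<zeta>))) \<zeta> = of_real (D (axis j 1))"
    unfolding has_derivative_wirt(1,2)[OF d] twice_Re_axis linear_cmul[OF lin] linear_0[OF lin]
    by auto
qed

lemma levi_twice_Re:
  fixes f :: "real^'n::finite \<Rightarrow> real"
  assumes "Cn 2 UNIV f"
  shows "levi (\<lambda>\<zeta>. f (twice_Re \<zeta>)) \<zeta> $ j $ k = of_real (hessian f (twice_Re \<zeta>) $ j $ k)"
proof -
  let ?d = "\<lambda>y. frechet_derivative f (at y) (axis k 1)"
  have f: "(f has_derivative frechet_derivative f (at x)) (at x)"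
    and f2: "(?d has_derivative frechet_derivative ?d (at x)) (at x)" for x
    using Cn_Suc_E(1)[OF assms[unfolded numeral_2_eq_2]]
      Cn_Suc_E(1)[OF Cn_Suc_E(2)[OF assms[unfolded numeral_2_eq_2]]] by auto
  have "wirt_bar k (\<lambda>\<zeta>. complex_of_real (f (twice_Re \<zeta>))) = (\<lambda>\<zeta>. complex_of_real (?d (twice_Re \<zeta>)))"
    by (rule ext, rule wirt_twice_Re(2)[OF f])
  then show ?thesis
    by (simp only: levi_def vec_lambda_beta hessian_def wirt_twice_Re(1)[OF f2])
qed

text \<open>The universal covering of the complex torus. In the coordinate \<zeta> rotations become
  imaginary translations, so invariant functions depend on Re \<zeta> alone.\<close>

definition cexp :: "complex^'n::finite \<Rightarrow> complex^'n" where
  "cexp \<zeta> = (\<chi> j. exp (\<zeta> $ j))"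

lemma cexp_derivative: "((\<lambda>\<zeta>. cexp \<zeta> $ a) has_derivative (\<lambda>v. cexp \<zeta> $ a * v $ a)) (at \<zeta>)"
  unfolding cexp_def vec_lambda_beta
  by (rule has_derivative_compose[where g = exp, OF _ DERIV_exp[unfolded has_field_derivative_def]])
    (rule bounded_linear_imp_has_derivative[OF bounded_linear_vec_nth])

lemma holo_map_cexp: "holo_map S cexp"
  unfolding holo_map_def holo_def
  by (intro allI ballI exI conjI, rule cexp_derivative) (simp add: algebra_simps)

lemma wirt_cexp: "wirt j (\<lambda>\<zeta>. cexp \<zeta> $ a) \<zeta> = (if j = a then cexp \<zeta> $ a else 0)"
  unfolding has_derivative_wirt(1)[OF cexp_derivative] by (auto simp: axis_def complex_eq_iff)

lemma cexp_nonzero [simp]: "cexp \<zeta> $ j \<noteq> 0"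
  by (simp add: cexp_def)

lemma cexp_surj: "(\<And>j. w $ j \<noteq> 0) \<Longrightarrow> \<exists>\<zeta>. cexp \<zeta> = w"
  by (rule exI[of _ "\<chi> j. Ln (w $ j)"]) (simp add: cexp_def vec_eq_iff)

text \<open>The hypothesis makes A the matrix H divided by w_j in row j and by the conjugate of w_k
  in column k. In the Leibniz formula each permutation meets every row and every column once, so all
  terms acquire the same factor.\<close>

lemma det_of_real_scaled:
  fixes H :: "real^'n::finite^'n" and w :: "complex^'n"
  assumes "\<And>j k. A $ j $ k * (w $ j * cnj (w $ k)) = of_real (H $ j $ k)" and nz: "\<And>j. w $ j \<noteq> 0"
  shows "det A = of_real (det H / (\<Prod>j\<in>UNIV. (norm (w $ j))\<^sup>2))"
proof -
  let ?c = "\<Prod>j\<in>UNIV. (norm (w $ j))\<^sup>2"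
  have c: "complex_of_real ?c \<noteq> 0" using nz by simp
  have "of_real (det H) = det A * of_real ?c"
    unfolding det_def of_real_sum sum_distrib_right
  proof (rule sum.cong[OF refl])
    fix p assume "p \<in> {p. p permutes (UNIV :: 'n set)}"
    then have p: "p permutes UNIV" by simp
    have "(\<Prod>i\<in>UNIV. cnj (w $ p i)) = (\<Prod>i\<in>UNIV. cnj (w $ i))"
      using prod.permute[OF p, of "\<lambda>i. cnj (w $ i)"] by (simp add: o_def)
    then have e: "complex_of_real ?c = (\<Prod>i\<in>UNIV. w $ i * cnj (w $ p i))"
      by (simp add: prod.distrib complex_norm_square flip: of_real_power)
    show "complex_of_real (of_int (sign p) * (\<Prod>i\<in>UNIV. H $ i $ p i)) =
        of_int (sign p) * (\<Prod>i\<in>UNIV. A $ i $ p i) * of_real ?c"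
      unfolding e by (simp add: assms(1)[symmetric] prod.distrib)
  qed
  then show ?thesis using c by (simp add: field_simps)
qed

section \<open>Lebesgue measure on products and logarithmic polar coordinates\<close>

lemma borel_measurable_vec_lambda:
  fixes f :: "'a \<Rightarrow> 'n::finite \<Rightarrow> 'b::euclidean_space"
  assumes "\<And>i. (\<lambda>x. f x i) \<in> borel_measurable M"
  shows "(\<lambda>x. \<chi> i. f x i) \<in> borel_measurable M"
proof -
  have "(\<lambda>x. \<Sum>i\<in>UNIV. axis i (f x i)) \<in> borel_measurable M"
    by (intro borel_measurable_sum measurable_compose[OF assms borel_measurable_continuous_onI]
        linear_continuous_on bounded_linear_axis)
  moreover have "(\<Sum>i\<in>UNIV. axis i (f x i)) = (\<chi> i. f x i)" for x
    by (simp add: vec_eq_iff axis_def)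
  ultimately show ?thesis by simp
qed

lemma borel_measurable_vec_nth [measurable]: "(\<lambda>x::'b::euclidean_space^'n::finite. x $ i) \<in> borel_measurable borel"
  by (intro borel_measurable_continuous_onI linear_continuous_on bounded_linear_vec_nth)

text \<open>Gives access to Tonelli's theorem one coordinate at a time. The coordinates may lie in
  any Euclidean space, because both the real and the complex torus coordinates are treated this
  way.\<close>

lemma lborel_vec:
  "(lborel :: ('b::euclidean_space^'n::finite) measure) =
    distr (\<Pi>\<^sub>M i\<in>UNIV. lborel) borel (\<lambda>f. \<chi> i. f i)"
proof (rule lborel_eqI)
  interpret product_sigma_finite "\<lambda>_::'n. lborel :: 'b measure" ..
  let ?P = "\<Pi>\<^sub>M i\<in>(UNIV::'n set). (lborel :: 'b measure)"
  have m: "(\<lambda>f. \<chi> i. f i) \<in> borel_measurable ?P"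
    by (intro borel_measurable_vec_lambda) measurable
  fix l u :: "'b^'n"
  assume le: "\<And>b. b \<in> Basis \<Longrightarrow> l \<bullet> b \<le> u \<bullet> b"
  have le': "l $ i \<bullet> b \<le> u $ i \<bullet> b" if "b \<in> Basis" for i b
    using le[of "axis i b"] that by (auto simp: inner_axis axis_in_Basis_iff)
  have v: "(\<lambda>f. \<chi> i. f i) -` box l u \<inter> space ?P = (\<Pi>\<^sub>E i\<in>UNIV. box (l $ i) (u $ i))"
    by (auto simp: mem_box Basis_vec_def inner_axis space_PiM PiE_def Pi_iff)
  have "emeasure (distr ?P borel (\<lambda>f. \<chi> i. f i)) (box l u) = (\<Prod>i\<in>UNIV. emeasure lborel (box (l $ i) (u $ i)))"
    by (subst emeasure_distr[OF m]) (auto simp: v emeasure_PiM)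
  also have "\<dots> = (\<Prod>i\<in>UNIV. ennreal (\<Prod>b\<in>Basis. (u $ i - l $ i) \<bullet> b))"
    using le' by (intro prod.cong refl emeasure_lborel_box) auto
  also have "\<dots> = ennreal (\<Prod>i\<in>UNIV. \<Prod>b\<in>Basis. (u $ i - l $ i) \<bullet> b)"
    using le' by (intro prod_ennreal prod_nonneg) (auto simp: inner_diff_left)
  also have "(\<Prod>i\<in>UNIV. \<Prod>b\<in>Basis. (u $ i - l $ i) \<bullet> b) = (\<Prod>(i,b)\<in>UNIV \<times> Basis. (u - l) \<bullet> axis i b)"
    by (simp add: prod.cartesian_product inner_axis)
  also have "\<dots> = (\<Prod>b\<in>(\<lambda>(i,b). axis i b) ` (UNIV \<times> Basis). (u - l) \<bullet> b)"
    by (subst prod.reindex) (auto simp: inj_on_def axis_eq_axis intro!: prod.cong)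
  also have "(\<lambda>(i,b). axis i b) ` (UNIV \<times> Basis) = (Basis :: ('b^'n) set)"
    by (auto simp: Basis_vec_def)
  finally show "emeasure (distr ?P borel (\<lambda>f. \<chi> i. f i)) (box l u) = ennreal (\<Prod>b\<in>Basis. (u - l) \<bullet> b)" .
qed simp

lemma nn_integral_lborel_vec_prod:
  fixes g :: "'n::finite \<Rightarrow> 'b::euclidean_space \<Rightarrow> ennreal"
  assumes [measurable]: "\<And>i. g i \<in> borel_measurable borel"
  shows "(\<integral>\<^sup>+x. (\<Prod>i\<in>UNIV. g i (x $ i)) \<partial>lborel) = (\<Prod>i\<in>UNIV. \<integral>\<^sup>+y. g i y \<partial>lborel)"
proof -
  interpret product_sigma_finite "\<lambda>_::'n. lborel :: 'b measure" ..
  let ?P = "\<Pi>\<^sub>M i\<in>(UNIV::'n set). (lborel :: 'b measure)"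
  have m: "(\<lambda>f. \<chi> i. f i) \<in> borel_measurable ?P"
    by (intro borel_measurable_vec_lambda) measurable
  have "(\<integral>\<^sup>+x. (\<Prod>i\<in>UNIV. g i (x $ i)) \<partial>lborel) = (\<integral>\<^sup>+f. (\<Prod>i\<in>UNIV. g i (f i)) \<partial>?P)"
    by (subst lborel_vec, subst nn_integral_distr[OF m]) (auto intro!: borel_measurable_prod)
  also have "\<dots> = (\<Prod>i\<in>UNIV. \<integral>\<^sup>+y. g i y \<partial>lborel)"
    by (rule product_nn_integral_prod) auto
  finally show ?thesis .
qed

lemma emeasure_complex_ball: "r \<ge> 0 \<Longrightarrow> emeasure lborel (ball (0::complex) r) = ennreal (pi * r\<^sup>2)"
  by (simp add: emeasure_ball unit_ball_vol_2)

text \<open>Area in the plane, pushed forward by |c|^2, is pi times length on the half-line, since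
  the disc |c|^2 < t has area pi t. With the density 1/(pi t) this becomes dt/t, which is length in
  the variable ln t.\<close>

lemma nn_integral_log_norm2:
  fixes l u :: real
  assumes lu: "l \<le> u"
  shows "(\<integral>\<^sup>+c. ennreal (1 / (pi * (norm (c::complex))\<^sup>2)) * indicator {l<..<u} (ln ((norm c)\<^sup>2)) \<partial>lborel) = ennreal (u - l)"
proof -
  \<comment> \<open>Both measures are cut off at |c|^2 = exp u: they are compared on half-lines
    unbounded above, on which they have to be finite.\<close>
  let ?R = "exp u"
  define N1 where "N1 = distr (density lborel (\<lambda>c::complex. indicator {0..<?R} ((norm c)\<^sup>2))) borel (\<lambda>c. (norm c)\<^sup>2)"
  define N2 where "N2 = density lborel (\<lambda>t. ennreal pi * indicator {0..<?R} t)"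
  have N: "N1 = N2"
  proof (rule measure_eqI_lessThan)
    show "sets N1 = sets borel" "sets N2 = sets borel" by (auto simp: N1_def N2_def)
    fix x :: real
    \<comment> \<open>x clamped to the interval from 0 to exp u, so that one formula covers negative
      x, x in range and x beyond the cut-off.\<close>
    define y where "y = max 0 (min x ?R)"
    have y: "0 \<le> y" "y \<le> ?R" by (auto simp: y_def)
    have A: "emeasure N1 {x<..} = emeasure lborel {c::complex. x < (norm c)\<^sup>2 \<and> (norm c)\<^sup>2 < ?R}"
    proof -
      have "emeasure N1 {x<..} = (\<integral>\<^sup>+c. indicator {0..<?R} ((norm (c::complex))\<^sup>2) * indicator ((\<lambda>c. (norm c)\<^sup>2) -` {x<..}) c \<partial>lborel)"
      proof -
        have m: "(\<lambda>c::complex. (norm c)\<^sup>2) \<in> borel_measurable borel" by measurable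
        have "(\<lambda>c::complex. (norm c)\<^sup>2) -` {x<..} \<in> sets borel"
          using measurable_sets[OF m, of "{x<..}"] by simp
        then show ?thesis unfolding N1_def by (subst emeasure_distr) (auto simp: emeasure_density)
      qed
      also have "\<dots> = (\<integral>\<^sup>+c. indicator {c. x < (norm (c::complex))\<^sup>2 \<and> (norm c)\<^sup>2 < ?R} c \<partial>lborel)"
        by (rule nn_integral_cong) (auto simp: indicator_def)
      finally show ?thesis by simp
    qed
    have B: "emeasure N2 {x<..} = ennreal (pi * (?R - y))"
    proof -
      have "emeasure N2 {x<..} = (\<integral>\<^sup>+t. ennreal pi * indicator ({0..<?R} \<inter> {x<..}) t \<partial>lborel)"
        unfolding N2_def by (subst emeasure_density) (auto simp: indicator_inter_arith mult.assoc)
      also have "\<dots> = ennreal pi * emeasure lborel ({0..<?R} \<inter> {x<..})"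
        by (subst nn_integral_cmult_indicator) auto
      also have "emeasure lborel ({0..<?R} \<inter> {x<..}) = ennreal (?R - y)"
      proof (cases "x < 0")
        case True
        then have "{0..<?R} \<inter> {x<..} = {0..<?R}" by auto
        with True show ?thesis using less_imp_le[OF less_trans[OF True exp_gt_zero]]
          by (simp add: y_def min_def)
      next
        case False
        then have "{0..<?R} \<inter> {x<..} = {x<..<?R}" by auto
        with False show ?thesis by (cases "x \<le> ?R") (auto simp: y_def min_def max_def)
      qed
      finally show ?thesis using y by (simp add: ennreal_mult)
    qed
    have "emeasure lborel {c::complex. x < (norm c)\<^sup>2 \<and> (norm c)\<^sup>2 < ?R} = ennreal (pi * (?R - y))"
    proof (cases "x < 0")
      case True
      have "{c::complex. x < (norm c)\<^sup>2 \<and> (norm c)\<^sup>2 < ?R} = ball 0 (sqrt ?R)"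
        using True real_less_rsqrt by (auto simp: real_less_lsqrt intro: less_le_trans[OF True])
          (metis norm_ge_zero real_less_lsqrt real_sqrt_less_iff real_sqrt_abs abs_norm_cancel)+
      then show ?thesis using True using less_imp_le[OF less_trans[OF True exp_gt_zero]]
        by (simp add: emeasure_complex_ball y_def min_def)
    next
      case False
      have sq: "(norm c)\<^sup>2 < t \<longleftrightarrow> norm c < sqrt t" "x < (norm c)\<^sup>2 \<longleftrightarrow> \<not> norm c \<le> sqrt x" for c :: complex and t
        using False real_sqrt_less_iff[of "(norm c)\<^sup>2" t] real_sqrt_le_iff[of "(norm c)\<^sup>2" x] by auto
      have s: "{c::complex. x < (norm c)\<^sup>2 \<and> (norm c)\<^sup>2 < ?R} = ball 0 (sqrt ?R) - cball 0 (sqrt x)"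
        unfolding sq by auto
      show ?thesis
      proof (cases "x < ?R")
        case True
        have fin: "emeasure lborel (cball (0::complex) (sqrt x)) = ennreal (pi * x)"
          using False by (simp add: emeasure_cball unit_ball_vol_2)
        have "emeasure lborel (ball 0 (sqrt ?R) - cball (0::complex) (sqrt x)) =
            ennreal (pi * ?R) - ennreal (pi * x)"
          using True False fin le_less_trans[OF _ real_sqrt_less_mono[OF True]]
          by (subst emeasure_Diff) (auto simp: emeasure_complex_ball)
        also have "\<dots> = ennreal (pi * ?R - pi * x)"
          using False by (intro ennreal_minus) auto
        finally show ?thesis using True False s by (simp add: y_def algebra_simps)
      next
        case F: False
        then have le: "sqrt ?R \<le> sqrt x" by (simp add: real_sqrt_le_iff)
        have e: "ball 0 (sqrt ?R) - cball (0::complex) (sqrt x) = {}"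
          by (auto dest!: less_le_trans[OF _ le])
        show ?thesis unfolding s e using F by (simp add: y_def)
      qed
    qed
    then show "emeasure N1 {x<..} = emeasure N2 {x<..}" using A B by simp
    then show "emeasure N1 {x<..} < \<infinity>" using B by (simp add: less_top)
  qed
  let ?h = "\<lambda>t. ennreal (1 / (pi * t)) * indicator {exp l<..<exp u} t"
  have "(\<integral>\<^sup>+c. ennreal (1 / (pi * (norm (c::complex))\<^sup>2)) * indicator {l<..<u} (ln ((norm c)\<^sup>2)) \<partial>lborel)
     = (\<integral>\<^sup>+c. indicator {0..<?R} ((norm (c::complex))\<^sup>2) * ?h ((norm c)\<^sup>2) \<partial>lborel)"
  proof (rule nn_integral_cong)
    fix c :: complex
    have "l < ln ((norm c)\<^sup>2) \<and> ln ((norm c)\<^sup>2) < u \<longleftrightarrow> exp l < (norm c)\<^sup>2 \<and> (norm c)\<^sup>2 < exp u" if "c \<noteq> 0"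
    proof -
      have "(norm c)\<^sup>2 > 0" using that by simp
      then show ?thesis by (metis exp_less_cancel_iff exp_ln)
    qed
    then show "ennreal (1 / (pi * (norm c)\<^sup>2)) * indicator {l<..<u} (ln ((norm c)\<^sup>2)) = indicator {0..<?R} ((norm c)\<^sup>2) * ?h ((norm c)\<^sup>2)"
      by (cases "c = 0") (auto simp: indicator_def)
  qed
  also have "\<dots> = (\<integral>\<^sup>+t. ?h t \<partial>N1)"
    unfolding N1_def by (simp add: nn_integral_distr nn_integral_density)
  also have "\<dots> = (\<integral>\<^sup>+t. (ennreal pi * indicator {0..<?R} t) * ?h t \<partial>lborel)"
    unfolding N N2_def by (simp add: nn_integral_density)
  also have "\<dots> = (\<integral>\<^sup>+t. ennreal (1 / t) * indicator {exp l..exp u} t \<partial>lborel)"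
  proof (rule nn_integral_cong_AE)
    have "AE t in lborel. t \<noteq> exp l" "AE t in lborel. t \<noteq> exp u" by (rule AE_lborel_singleton)+
    then show "AE t in lborel. (ennreal pi * indicator {0..<?R} t) * ?h t = ennreal (1 / t) * indicator {exp l..exp u} t"
    proof eventually_elim
      case (elim t)
      show ?case
      proof (cases "exp l < t \<and> t < exp u")
        case True
        then have "t > 0" using less_trans[OF exp_gt_zero] by blast
        then have "ennreal pi * ennreal (1 / (pi * t)) = ennreal (1 / t)"
          by (subst ennreal_mult[symmetric]) auto
        then show ?thesis using True \<open>t > 0\<close> by simp
      qed (use elim in \<open>auto simp: indicator_def\<close>)
    qed
  qed
  also have "\<dots> = ennreal (ln (exp u) - ln (exp l))"
  proof (rule nn_integral_FTC_Icc)
    fix x assume "x \<in> {exp l..exp u}"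
    then have "x > 0" using less_le_trans[OF exp_gt_zero] by auto
    then show "(ln has_real_derivative 1 / x) (at x)" "0 \<le> 1 / x"
      by (auto intro!: derivative_eq_intros)
  qed (use lu in auto)
  finally show ?thesis by simp
qed

text \<open>The planar computation in every coordinate, multiplied over boxes. On the coordinate
  hyperplanes the density is 0 by the convention for division by zero, which makes the value of ln
  at 0 harmless.\<close>

lemma lborel_log_norm2:
  "(lborel :: (real^'m::finite) measure) =
    distr (density lborel (\<lambda>w::complex^'m. \<Prod>j\<in>UNIV. ennreal (1 / (pi * (norm (w $ j))\<^sup>2)))) borel
      (\<lambda>w. \<chi> j. ln ((norm (w $ j))\<^sup>2))"
proof (rule lborel_eqI)
  fix l u :: "real^'m"
  assume le: "\<And>b. b \<in> Basis \<Longrightarrow> l \<bullet> b \<le> u \<bullet> b"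
  have le': "l $ i \<le> u $ i" for i
    using le[of "axis i 1"] by (auto simp: inner_axis axis_in_Basis_iff)
  let ?L = "\<lambda>w::complex^'m. \<chi> j. ln ((norm (w $ j))\<^sup>2)"
  let ?d = "\<lambda>w::complex^'m. \<Prod>j\<in>UNIV. ennreal (1 / (pi * (norm (w $ j))\<^sup>2))"
  let ?g = "\<lambda>j c::complex. ennreal (1 / (pi * (norm c)\<^sup>2)) * indicator {l $ j<..<u $ j} (ln ((norm c)\<^sup>2))"
  have m[measurable]: "?L \<in> borel_measurable borel"
    by (intro borel_measurable_vec_lambda) measurable
  have md[measurable]: "?d \<in> borel_measurable borel" by measurable
  have "emeasure (distr (density lborel ?d) borel ?L) (box l u) = (\<integral>\<^sup>+w. ?d w * indicator (?L -` box l u) w \<partial>lborel)"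
    using measurable_sets[OF m, of "box l u"] by (subst emeasure_distr) (auto simp: emeasure_density)
  also have "\<dots> = (\<integral>\<^sup>+w. (\<Prod>j\<in>UNIV. ?g j (w $ j)) \<partial>lborel)"
  proof (rule nn_integral_cong)
    fix w :: "complex^'m"
    have "?L w \<in> box l u \<longleftrightarrow> (\<forall>j. ln ((norm (w $ j))\<^sup>2) \<in> {l $ j<..<u $ j})"
      by (auto simp: mem_box_cart)
    then have "(indicator (?L -` box l u) w :: ennreal) = (\<Prod>j\<in>UNIV. indicator {l $ j<..<u $ j} (ln ((norm (w $ j))\<^sup>2)))"
      by (auto simp: indicator_def)
    then show "?d w * indicator (?L -` box l u) w = (\<Prod>j\<in>UNIV. ?g j (w $ j))"
      by (simp add: prod.distrib)
  qed
  also have "\<dots> = (\<Prod>j\<in>UNIV. ennreal (u $ j - l $ j))"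
    by (subst nn_integral_lborel_vec_prod) (auto simp: nn_integral_log_norm2[OF le'] intro!: prod.cong)
  also have "\<dots> = ennreal (\<Prod>j\<in>UNIV. u $ j - l $ j)"
    using le' by (intro prod_ennreal) auto
  also have "(\<Prod>j\<in>UNIV. u $ j - l $ j) = (\<Prod>b\<in>Basis. (u - l) \<bullet> b)"
    by (simp add: Basis_vec_def UNION_singleton_eq_range prod.reindex inj_on_def axis_eq_axis inner_axis)
  finally show "emeasure (distr (density lborel ?d) borel ?L) (box l u) = ennreal (\<Prod>b\<in>Basis. (u - l) \<bullet> b)" .
qed simp

section \<open>Gaussian integrals\<close>

text \<open>With all coordinates but m fixed, the shear is a translation in coordinate m, under
  which Lebesgue measure on the line is invariant; Tonelli's theorem with coordinate m innermost
  does the rest.\<close>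

lemma nn_integral_lborel_shear:
  fixes f :: "real^'n::finite \<Rightarrow> ennreal"
  assumes [measurable]: "f \<in> borel_measurable borel" and mn: "m \<noteq> n"
  shows "(\<integral>\<^sup>+x. f x \<partial>lborel) = (\<integral>\<^sup>+x. f (\<chi> i. if i = m then x $ m + c * x $ n else x $ i) \<partial>lborel)"
proof -
  interpret product_sigma_finite "\<lambda>_::'n. lborel :: real measure" ..
  let ?P = "\<lambda>I. \<Pi>\<^sub>M i\<in>(I::'n set). (lborel :: real measure)"
  let ?J = "UNIV - {m}"
  have ins: "insert m ?J = UNIV" by auto
  have m: "(\<lambda>f. \<chi> i. f i) \<in> borel_measurable (?P UNIV)"
    by (intro borel_measurable_vec_lambda) measurable
  have s: "(\<lambda>x::real^'n. \<chi> i. if i = m then x $ m + c * x $ n else x $ i) \<in> borel_measurable borel"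
    by (intro borel_measurable_vec_lambda) measurable
  have g: "(\<integral>\<^sup>+x. g x \<partial>lborel) = (\<integral>\<^sup>+x. \<integral>\<^sup>+y. g (\<chi> i. (x(m := y)) i) \<partial>lborel \<partial>?P ?J)"
    if [measurable]: "g \<in> borel_measurable borel" for g :: "real^'n \<Rightarrow> ennreal"
  proof -
    have "(\<integral>\<^sup>+x. g x \<partial>lborel) = (\<integral>\<^sup>+x. g (\<chi> i. x i) \<partial>?P UNIV)"
      by (subst lborel_vec, subst nn_integral_distr[OF m]) auto
    also have "\<dots> = (\<integral>\<^sup>+x. g (\<chi> i. x i) \<partial>?P (insert m ?J))" by (simp only: ins)
    also have "\<dots> = (\<integral>\<^sup>+x. \<integral>\<^sup>+y. g (\<chi> i. (x(m := y)) i) \<partial>lborel \<partial>?P ?J)"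
      using measurable_compose[OF m that] by (intro product_nn_integral_insert) (auto simp: ins)
    finally show ?thesis .
  qed
  have "(\<integral>\<^sup>+x. f (\<chi> i. if i = m then x $ m + c * x $ n else x $ i) \<partial>lborel) =
      (\<integral>\<^sup>+x. \<integral>\<^sup>+y. f (\<chi> i. (x(m := c * x n + 1 * y)) i) \<partial>lborel \<partial>?P ?J)"
    using mn by (subst g[OF measurable_compose[OF s assms(1)]])
      (auto intro!: nn_integral_cong arg_cong[where f = f] simp: vec_eq_iff)
  also have "\<dots> = (\<integral>\<^sup>+x. \<integral>\<^sup>+y. f (\<chi> i. (x(m := y)) i) \<partial>lborel \<partial>?P ?J)"
  proof (rule nn_integral_cong)
    fix x :: "'n \<Rightarrow> real"
    have "(\<lambda>y. \<chi> i. (x(m := y)) i) \<in> borel_measurable borel"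
      by (intro borel_measurable_vec_lambda) simp
    from nn_integral_real_affine[OF measurable_compose[OF this assms(1)], of 1 "c * x n"]
    show "(\<integral>\<^sup>+y. f (\<chi> i. (x(m := c * x n + 1 * y)) i) \<partial>lborel) = (\<integral>\<^sup>+y. f (\<chi> i. (x(m := y)) i) \<partial>lborel)"
      by simp
  qed
  finally show ?thesis by (simp only: g[OF assms(1)])
qed

lemma borel_measurable_matrix_vector_mult [measurable]: "(*v) (A :: real^'n::finite^'m::finite) \<in> borel_measurable borel"
  by (intro borel_measurable_continuous_onI linear_continuous_on matrix_vector_mul_bounded_linear)

text \<open>The change of variables formulas of HOL-Analysis need a well-ordered index type.\<close>

lemma nn_integral_lborel_linear:
  fixes A :: "real^'n::finite^'n" and f :: "real^'n \<Rightarrow> ennreal"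
  assumes "det A \<noteq> 0" "f \<in> borel_measurable borel"
  shows "(\<integral>\<^sup>+x. f x \<partial>lborel) = ennreal \<bar>det A\<bar> * (\<integral>\<^sup>+x. f (A *v x) \<partial>lborel)"
proof -
  \<comment> \<open>The determinant condition sits inside \<open>P\<close>: matrices with a zero row
    satisfy it vacuously, and the induction has work to do only for products, diagonal matrices,
    column swaps and shears.\<close>
  define P where "P A \<longleftrightarrow> (det A \<noteq> 0 \<longrightarrow> (\<forall>f\<in>borel_measurable borel.
    (\<integral>\<^sup>+x. f x \<partial>lborel) = ennreal \<bar>det A\<bar> * (\<integral>\<^sup>+x. f (A *v x) \<partial>lborel)))" for A :: "real^'n^'n"
  have "P A"
  proof (rule induct_matrix_elementary)
    fix A B assume A: "P A" and B: "P B"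
    show "P (A ** B)" unfolding P_def
    proof (intro impI ballI)
      fix f :: "real^'n \<Rightarrow> ennreal" assume f[measurable]: "f \<in> borel_measurable borel"
      assume d: "det (A ** B) \<noteq> 0"
      have "(\<integral>\<^sup>+x. f x \<partial>lborel) = ennreal \<bar>det A\<bar> * (\<integral>\<^sup>+x. f (A *v x) \<partial>lborel)"
        using d by (intro A[unfolded P_def, rule_format] f) (auto simp: det_mul)
      also have "(\<integral>\<^sup>+x. f (A *v x) \<partial>lborel) = ennreal \<bar>det B\<bar> * (\<integral>\<^sup>+x. f (A *v (B *v x)) \<partial>lborel)"
        using d by (intro B[unfolded P_def, rule_format]) (auto simp: det_mul)
      finally show "(\<integral>\<^sup>+x. f x \<partial>lborel) = ennreal \<bar>det (A ** B)\<bar> * (\<integral>\<^sup>+x. f ((A ** B) *v x) \<partial>lborel)"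
        by (simp add: det_mul abs_mult ennreal_mult mult.assoc matrix_vector_mul_assoc)
    qed
  next
    fix A :: "real^'n^'n" and i assume "row i A = 0"
    then show "P A" using det_zero_row(1)[of i A] by (simp add: P_def)
  next
    fix A :: "real^'n^'n" assume diag: "\<And>i j. i \<noteq> j \<Longrightarrow> A $ i $ j = 0"
    show "P A" unfolding P_def
    proof (intro impI ballI)
      fix f :: "real^'n \<Rightarrow> ennreal" assume f[measurable]: "f \<in> borel_measurable borel"
      assume d: "det A \<noteq> 0"
      have det: "det A = (\<Prod>i\<in>UNIV. A $ i $ i)" by (rule det_diagonal[OF diag])
      then have nz: "A $ i $ i \<noteq> 0" for i using d by auto
      let ?c = "\<lambda>b. b \<bullet> (A *v b)"
      have c: "?c (axis i 1) = A $ i $ i" for i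
        by (simp add: inner_axis' matrix_vector_mult_basis column_def)
      have Av: "(\<Sum>j\<in>Basis. (?c j * (x \<bullet> j)) *\<^sub>R j) = A *v x" for x
      proof -
        have "(A *v x) $ i = A $ i $ i * x $ i" for i
          unfolding matrix_vector_mult_def using diag
          by (simp add: sum.remove[of UNIV i] sum.neutral)
        moreover have "(\<Sum>j\<in>Basis. (?c j * (x \<bullet> j)) *\<^sub>R j) = (\<Sum>i\<in>UNIV. (A $ i $ i * x $ i) *\<^sub>R axis i 1)"
          by (simp add: Basis_vec_def UNION_singleton_eq_range sum.reindex inj_on_def axis_eq_axis c inner_axis)
        ultimately show ?thesis by (simp add: vec_eq_iff axis_def if_distrib cong: if_cong)
      qed
      have P: "(\<Prod>j\<in>Basis. \<bar>?c j\<bar>) = \<bar>det A\<bar>"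
        by (simp add: Basis_vec_def UNION_singleton_eq_range prod.reindex inj_on_def axis_eq_axis c det abs_prod)
      have nzB: "?c j \<noteq> 0" if "j \<in> Basis" for j
        using that nz c by (auto simp: Basis_vec_def)
      have "lborel = density (distr lborel borel ((*v) A)) (\<lambda>_. ennreal \<bar>det A\<bar>)"
        using lborel_affine_euclidean[of ?c 0, OF nzB] by (simp add: Av P)
      then have "(\<integral>\<^sup>+x. f x \<partial>lborel) = (\<integral>\<^sup>+x. f x \<partial>density (distr lborel borel ((*v) A)) (\<lambda>_. ennreal \<bar>det A\<bar>))"
        by (rule arg_cong)
      also have "\<dots> = ennreal \<bar>det A\<bar> * (\<integral>\<^sup>+x. f (A *v x) \<partial>lborel)"
        by (simp add: nn_integral_density nn_integral_distr nn_integral_cmult)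
      finally show "(\<integral>\<^sup>+x. f x \<partial>lborel) = ennreal \<bar>det A\<bar> * (\<integral>\<^sup>+x. f (A *v x) \<partial>lborel)" .
    qed
  next
    fix m n :: 'n assume "m \<noteq> n"
    let ?t = "Transposition.transpose m n"
    let ?A = "(\<chi> i j. mat 1 $ i $ ?t j) :: real^'n^'n"
    have p: "?t permutes UNIV" by (rule permutes_swap_id) auto
    have "det ?A = of_int (sign ?t) * det (mat 1 :: real^'n^'n)"
      by (rule det_permute_columns[OF p])
    then have det: "\<bar>det ?A\<bar> = 1" by (simp add: sign_def)
    have Av: "?A *v x = (\<chi> i. x $ ?t i)" for x
    proof -
      have "(?A *v x) $ i = (\<Sum>j\<in>UNIV. (if j = ?t i then x $ j else 0))" for i
        unfolding matrix_vector_mult_def vec_lambda_beta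
        by (rule sum.cong[OF refl]) (auto simp: mat_def Transposition.transpose_def)
      then show ?thesis by (simp add: vec_eq_iff)
    qed
    have m[measurable]: "(\<lambda>x::real^'n. \<chi> i. x $ ?t i) \<in> borel_measurable borel"
      by (intro borel_measurable_vec_lambda) measurable
    have l: "lborel = distr lborel borel (\<lambda>x::real^'n. \<chi> i. x $ ?t i)"
    proof (rule lborel_eqI)
      fix l u :: "real^'n" assume le: "\<And>b. b \<in> Basis \<Longrightarrow> l \<bullet> b \<le> u \<bullet> b"
      have le': "l $ i \<le> u $ i" for i
        using le[of "axis i 1"] by (auto simp: inner_axis axis_in_Basis_iff)
      have B: "(\<Prod>b\<in>Basis. (y - x) \<bullet> b) = (\<Prod>i\<in>UNIV. y $ i - x $ i)" for x y :: "real^'n"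
        by (simp add: Basis_vec_def UNION_singleton_eq_range prod.reindex inj_on_def axis_eq_axis inner_axis)
      have "(\<lambda>x. \<chi> i. x $ ?t i) -` box l u = box (\<chi> i. l $ ?t i) (\<chi> i. u $ ?t i)"
        by (auto simp: mem_box_cart) (metis transpose_involutory)+
      then have "emeasure (distr lborel borel (\<lambda>x. \<chi> i. x $ ?t i)) (box l u) =
          emeasure lborel (box (\<chi> i. l $ ?t i) (\<chi> i. u $ ?t i))"
        by (subst emeasure_distr) auto
      also have "\<dots> = ennreal (\<Prod>b\<in>Basis. ((\<chi> i. u $ ?t i) - (\<chi> i. l $ ?t i)) \<bullet> b)"
        using le' by (intro emeasure_lborel_box) (auto simp: Basis_vec_def inner_axis)
      also have "\<dots> = ennreal (\<Prod>i\<in>UNIV. u $ ?t i - l $ ?t i)" by (simp only: B vec_lambda_beta)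
      also have "(\<Prod>i\<in>UNIV. u $ ?t i - l $ ?t i) = (\<Prod>i\<in>UNIV. u $ i - l $ i)"
        using prod.permute[OF p, of "\<lambda>i. u $ i - l $ i"] by (simp add: o_def)
      finally show "emeasure (distr lborel borel (\<lambda>x. \<chi> i. x $ ?t i)) (box l u) = ennreal (\<Prod>b\<in>Basis. (u - l) \<bullet> b)"
        by (simp only: B)
    qed simp
    show "P ?A" unfolding P_def det Av
      by (subst (1) l) (auto simp: nn_integral_distr)
  next
    fix m n :: 'n and c assume mn: "m \<noteq> n"
    let ?A = "(\<chi> i j. if i = m \<and> j = n then c else of_bool (i = j)) :: real^'n^'n"
    have "?A = (\<chi> k. if k = m then row m (mat 1) + c *s row n (mat 1) else row k (mat 1))"
      using mn by (auto simp: vec_eq_iff row_def mat_def)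
    then have det: "det ?A = 1" using det_row_operation[OF mn, of "mat 1" c] by simp
    have Av: "?A *v x = (\<chi> i. if i = m then x $ m + c * x $ n else x $ i)" for x
    proof -
      have "(?A *v x) $ i = (\<Sum>j\<in>UNIV. (if j = i then x $ j else 0) + (if j = n then (if i = m then c * x $ j else 0) else 0))" for i
        unfolding matrix_vector_mult_def using mn by (auto intro!: sum.cong)
      then show ?thesis by (simp add: vec_eq_iff sum.distrib)
    qed
    show "P ?A" unfolding P_def det Av using nn_integral_lborel_shear[OF _ mn, of _ c] by auto
  qed
  from this[unfolded P_def, rule_format, OF assms] show ?thesis .
qed

section \<open>Positive definite matrices and their Gaussian integrals\<close>

definition pos_def :: "real^'n::finite^'n \<Rightarrow> bool" where
  "pos_def A \<longleftrightarrow> transpose A = A \<and> (\<forall>x. x \<noteq> 0 \<longrightarrow> x \<bullet> (A *v x) > 0)"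

lemma symmetric_matrix_inner:
  fixes A :: "real^'n::finite^'n"
  assumes "transpose A = A" shows "x \<bullet> (A *v y) = (A *v x) \<bullet> y"
  by (metis assms dot_lmul_matrix transpose_matrix_vector)

text \<open>Gram-Schmidt for the inner product of A, by induction over the indices already treated.
  The next vector is taken orthogonal to the fewer than n vectors \<open>A *v e j\<close> and then
  normalized.\<close>

lemma pos_def_orthonormal:
  fixes A :: "real^'n::finite^'n"
  assumes "pos_def A"
  shows "\<exists>e :: 'n \<Rightarrow> real^'n. \<forall>i j. e i \<bullet> (A *v e j) = (if i = j then 1 else 0)"
proof -
  have sym: "transpose A = A" and pos: "\<And>x. x \<noteq> 0 \<Longrightarrow> x \<bullet> (A *v x) > 0"
    using assms by (auto simp: pos_def_def)
  have "\<exists>e :: 'n \<Rightarrow> real^'n. \<forall>i\<in>J. \<forall>j\<in>J. e i \<bullet> (A *v e j) = (if i = j then 1 else 0)" if "finite J" for J :: "'n set"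
    using that
  proof (induct J)
    case (insert k J)
    then obtain e :: "'n \<Rightarrow> real^'n" where e: "\<forall>i\<in>J. \<forall>j\<in>J. e i \<bullet> (A *v e j) = (if i = j then 1 else 0)" by blast
    have "dim ((\<lambda>j. A *v e j) ` J) \<le> card J"
      by (metis card_image_le dim_le_card' finite_imageI insert(1) le_trans)
    also have "card J < CARD('n)"
      using insert(2) by (metis UNIV_I finite psubsetI psubset_card_mono subset_UNIV)
    finally have "dim ((\<lambda>j. A *v e j) ` J) < DIM(real^'n)" by simp
    then obtain v where v: "v \<noteq> 0" "\<And>y. y \<in> span ((\<lambda>j. A *v e j) ` J) \<Longrightarrow> orthogonal v y"
      using orthogonal_to_subspace_exists by blast
    define w where "w = (1 / sqrt (v \<bullet> (A *v v))) *\<^sub>R v"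
    have ww: "w \<bullet> (A *v w) = 1"
      using pos[OF v(1)] by (simp add: w_def matrix_vector_mult_scaleR)
    have wj: "w \<bullet> (A *v e j) = 0" if "j \<in> J" for j
      using v(2)[OF span_base, of "A *v e j"] that by (simp add: w_def orthogonal_def)
    then have jw: "e j \<bullet> (A *v w) = 0" if "j \<in> J" for j
      using that symmetric_matrix_inner[OF sym, of "e j" w] by (simp add: inner_commute)
    show ?case
      by (rule exI[of _ "e(k := w)"]) (use insert(2) e ww wj jw in \<open>auto\<close>)
  qed auto
  from this[of UNIV] show ?thesis by auto
qed

text \<open>The columns of T are an A-orthonormal basis. Substituting T x turns the quadratic form
  into the squared norm, and the determinant relation supplies the Jacobian, which is det A to the
  power -1/2 up to sign.\<close>

lemma pos_def_factor:
  fixes A :: "real^'n::finite^'n"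
  assumes "pos_def A"
  shows "\<exists>T. (det T)\<^sup>2 * det A = 1 \<and> (\<forall>x. (T *v x) \<bullet> (A *v (T *v x)) = (norm x)\<^sup>2)"
proof -
  obtain e :: "'n \<Rightarrow> real^'n" where e: "\<And>i j. e i \<bullet> (A *v e j) = (if i = j then 1 else 0)"
    using pos_def_orthonormal[OF assms] by blast
  define T where "T = (\<chi> i j. e j $ i)"
  have Tx: "T *v axis j 1 = e j" for j
    by (simp add: T_def matrix_vector_mult_basis column_def vec_eq_iff)
  have M: "transpose T ** A ** T = mat 1"
  proof -
    have "(transpose T ** A ** T) $ i $ j = axis i 1 \<bullet> ((transpose T ** A ** T) *v axis j 1)" for i j
      by (simp add: matrix_vector_mult_basis column_def inner_axis')
    also have "\<dots> i j = (T *v axis i 1) \<bullet> (A *v (T *v axis j 1))" for i j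
      by (simp add: matrix_vector_mul_assoc[symmetric] transpose_matrix_vector dot_lmul_matrix[symmetric])
        (metis dot_lmul_matrix inner_commute)
    finally show ?thesis by (simp add: Tx e vec_eq_iff mat_def)
  qed
  have "det (transpose T ** A ** T) = 1" by (simp add: M)
  then have 1: "(det T)\<^sup>2 * det A = 1"
    by (simp add: det_mul det_transpose power2_eq_square mult_ac)
  have "(T *v x) \<bullet> (A *v (T *v x)) = x \<bullet> ((transpose T ** A ** T) *v x)" for x
    by (simp add: matrix_vector_mul_assoc[symmetric] transpose_matrix_vector)
      (metis dot_lmul_matrix inner_commute)
  then have "(T *v x) \<bullet> (A *v (T *v x)) = (norm x)\<^sup>2" for x
    by (simp add: M power2_norm_eq_inner)
  with 1 show ?thesis by blast
qed

lemma pos_def_det_pos: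
  fixes A :: "real^'n::finite^'n"
  assumes "pos_def A" shows "det A > 0"
proof -
  from assms
  obtain T :: "real^'n^'n" where "(det T)\<^sup>2 * det A = 1" using pos_def_factor by blast
  then show ?thesis by (metis mult_nonneg_nonpos not_le not_one_le_zero zero_le_power2)
qed

lemma nn_integral_std_gaussian:
  "(\<integral>\<^sup>+x. ennreal (exp (- (1/2) * (x::real)\<^sup>2)) \<partial>lborel) = ennreal (sqrt (2 * pi))"
proof -
  have "1 = (\<integral>\<^sup>+x. ennreal (std_normal_density x) \<partial>lborel)"
    using prob_space.emeasure_space_1[OF prob_space_normal_density[of 1 0]]
    by (simp add: emeasure_density)
  also have "\<dots> = (\<integral>\<^sup>+x. ennreal (1 / sqrt (2 * pi)) * ennreal (exp (- (1/2) * x\<^sup>2)) \<partial>lborel)"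
    by (intro nn_integral_cong) (simp add: std_normal_density_def ennreal_mult[symmetric])
  also have "\<dots> = ennreal (1 / sqrt (2 * pi)) * (\<integral>\<^sup>+x. ennreal (exp (- (1/2) * (x::real)\<^sup>2)) \<partial>lborel)"
    by (rule nn_integral_cmult) simp
  finally have "ennreal (sqrt (2 * pi)) * 1 = ennreal (sqrt (2 * pi)) * ennreal (1 / sqrt (2 * pi)) * (\<integral>\<^sup>+x. ennreal (exp (- (1/2) * (x::real)\<^sup>2)) \<partial>lborel)"
    by (simp only: mult.assoc)
  also have "ennreal (sqrt (2 * pi)) * ennreal (1 / sqrt (2 * pi)) = 1"
    by (subst ennreal_mult[symmetric]) auto
  finally show ?thesis by simp
qed

lemma nn_integral_gaussian:
  fixes A :: "real^'n::finite^'n"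
  assumes "pos_def A"
  shows "(\<integral>\<^sup>+x. ennreal (exp (- (1/2) * (x \<bullet> (A *v x)))) \<partial>lborel) =
    ennreal ((2 * pi) powr (real CARD('n) / 2) * det A powr (- 1 / 2))"
proof -
  obtain T where T: "(det T)\<^sup>2 * det A = 1" "\<And>x. (T *v x) \<bullet> (A *v (T *v x)) = (norm x)\<^sup>2"
    using pos_def_factor[OF assms] by blast
  note dA = pos_def_det_pos[OF assms]
  have dT: "det T \<noteq> 0" using T(1) by auto
  have "(det T)\<^sup>2 = 1 / det A" using T(1) dA by (simp add: field_simps)
  then have abs: "\<bar>det T\<bar> = det A powr (- 1 / 2)"
    using dA by (metis powr_half_sqrt powr_minus_divide real_sqrt_abs real_sqrt_divide real_sqrt_one order.strict_implies_order minus_divide_left)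
  have sq: "sqrt (2 * pi) ^ CARD('n) = (2 * pi) powr (real CARD('n) / 2)"
    by (simp add: powr_half_sqrt[symmetric] powr_powr powr_realpow[symmetric])
  have "(\<integral>\<^sup>+x. ennreal (exp (- (1/2) * (x \<bullet> (A *v x)))) \<partial>lborel) =
     ennreal \<bar>det T\<bar> * (\<integral>\<^sup>+x. ennreal (exp (- (1/2) * (norm (x::real^'n))\<^sup>2)) \<partial>lborel)"
    by (subst nn_integral_lborel_linear[OF dT]) (auto simp: T(2))
  also have "(\<integral>\<^sup>+x. ennreal (exp (- (1/2) * (norm (x::real^'n))\<^sup>2)) \<partial>lborel) =
     (\<integral>\<^sup>+x. (\<Prod>i\<in>UNIV. ennreal (exp (- (1/2) * ((x::real^'n) $ i)\<^sup>2))) \<partial>lborel)"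
  proof (rule nn_integral_cong)
    fix x :: "real^'n"
    have "- (1/2) * (norm x)\<^sup>2 = (\<Sum>i\<in>UNIV. - (1/2) * (x $ i)\<^sup>2)"
      unfolding sum_distrib_left[symmetric] power2_norm_eq_inner inner_vec_def
      by (simp add: power2_eq_square)
    then show "ennreal (exp (- (1/2) * (norm x)\<^sup>2)) = (\<Prod>i\<in>UNIV. ennreal (exp (- (1/2) * (x $ i)\<^sup>2)))"
      by (simp only: exp_sum finite prod_ennreal exp_ge_zero)
  qed
  also have "\<dots> = ennreal (sqrt (2 * pi)) ^ CARD('n)"
    by (subst nn_integral_lborel_vec_prod[where g = "\<lambda>i y. ennreal (exp (- (1/2) * y\<^sup>2))"])
      (simp_all only: nn_integral_std_gaussian prod_constant, measurable)
  also have "\<dots> = ennreal ((2 * pi) powr (real CARD('n) / 2))"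
    by (simp add: ennreal_power sq[symmetric])
  finally show ?thesis by (simp add: abs ennreal_mult[symmetric] mult.commute)
qed

lemma gaussian_integral:
  fixes A :: "real^'n::finite^'n"
  assumes "pos_def A"
  shows "integrable lborel (\<lambda>x. exp (- (1/2) * (x \<bullet> (A *v x))))"
    and "(\<integral>x. exp (- (1/2) * (x \<bullet> (A *v x))) \<partial>lborel) = (2 * pi) powr (real CARD('n) / 2) * det A powr (- 1 / 2)"
  using nn_integral_gaussian[OF assms]
  by (auto intro!: integrableI_nonneg integral_eq_nn_integral[THEN trans] simp: enn2real_ennreal)

lemma pos_def_matrix_inv:
  fixes A :: "real^'n::finite^'n"
  assumes "pos_def A"
  shows "A ** matrix_inv A = mat 1" "matrix_inv A ** A = mat 1"
    and "pos_def (matrix_inv A)" "det (matrix_inv A) = 1 / det A"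
proof -
  let ?B = "matrix_inv A"
  have inv: "invertible A" using pos_def_det_pos[OF assms] by (simp add: invertible_det_nz)
  show 1: "A ** ?B = mat 1" and 2: "?B ** A = mat 1"
    using someI_ex[OF inv[unfolded invertible_def]] by (auto simp: matrix_inv_def)
  have sym: "transpose A = A" using assms by (simp add: pos_def_def)
  have "transpose ?B = transpose ?B ** (A ** ?B)" by (simp add: 1)
  also have "\<dots> = transpose (transpose A ** ?B) ** ?B"
    by (simp add: matrix_transpose_mul matrix_mul_assoc)
  also have "\<dots> = ?B" by (simp add: sym 1)
  finally have "transpose ?B = ?B" .
  moreover have "x \<bullet> (?B *v x) > 0" if "x \<noteq> 0" for x
  proof -
    have x: "A *v (?B *v x) = x" by (simp add: matrix_vector_mul_assoc 1)
    then have "?B *v x \<noteq> 0" using that by auto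
    then have "(?B *v x) \<bullet> (A *v (?B *v x)) > 0" using assms by (simp add: pos_def_def)
    then show ?thesis by (simp add: x inner_commute)
  qed
  ultimately show "pos_def ?B" by (simp add: pos_def_def)
  have "det A * det ?B = 1" using 1 by (metis det_I det_mul)
  then show "det ?B = 1 / det A" using pos_def_det_pos[OF assms] by (simp add: field_simps)
qed

text \<open>Completing the square: translation by the solution \<open>?s\<close> of A s = y removes
  the linear term and leaves half of y . s as a constant.\<close>

lemma gaussian_laplace_transform:
  fixes A :: "real^'n::finite^'n"
  assumes "pos_def A"
  shows "integrable lborel (\<lambda>t. exp (y \<bullet> t - (1/2) * (t \<bullet> (A *v t))))"
    and "(\<integral>t. exp (y \<bullet> t - (1/2) * (t \<bullet> (A *v t))) \<partial>lborel) =
      exp ((1/2) * (y \<bullet> (matrix_inv A *v y))) * (\<integral>t. exp (- (1/2) * (t \<bullet> (A *v t))) \<partial>lborel)"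
proof -
  let ?s = "matrix_inv A *v y"
  have As: "A *v ?s = y" by (simp add: matrix_vector_mul_assoc pos_def_matrix_inv(1)[OF assms])
  have sym: "transpose A = A" using assms by (simp add: pos_def_def)
  have e: "exp (y \<bullet> (?s + t) - (1/2) * ((?s + t) \<bullet> (A *v (?s + t)))) =
      exp ((1/2) * (y \<bullet> ?s)) * exp (- (1/2) * (t \<bullet> (A *v t)))" for t
    using symmetric_matrix_inner[OF sym, of ?s t]
    by (simp add: matrix_vector_right_distrib inner_add_left inner_add_right As exp_add[symmetric] inner_commute field_simps)
  let ?g = "\<lambda>t. exp (y \<bullet> t - (1/2) * (t \<bullet> (A *v t)))"
  have gm[measurable]: "?g \<in> borel_measurable borel" by measurable
  have i: "integrable lborel (\<lambda>t. ?g (?s + t))"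
    unfolding e by (intro integrable_mult_right gaussian_integral(1)[OF assms])
  then have "integrable (distr lborel borel ((+) ?s)) ?g"
    by (subst integrable_distr_eq) auto
  then show "integrable lborel ?g" by (simp add: lborel_distr_plus)
  have "(\<integral>t. ?g t \<partial>lborel) = (\<integral>t. ?g t \<partial>distr lborel borel ((+) ?s))" by (simp only: lborel_distr_plus)
  also have "\<dots> = (\<integral>t. ?g (?s + t) \<partial>lborel)" by (subst integral_distr) auto
  also have "\<dots> = exp ((1/2) * (y \<bullet> ?s)) * (\<integral>t. exp (- (1/2) * (t \<bullet> (A *v t))) \<partial>lborel)"
    unfolding e by simp
  finally show "(\<integral>t. ?g t \<partial>lborel) = exp ((1/2) * (y \<bullet> ?s)) * (\<integral>t. exp (- (1/2) * (t \<bullet> (A *v t))) \<partial>lborel)" .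
qed

text \<open>The explicit normalizing constant is traded for an integral, because the limit of a
  quotient of two lattice sums arises in this shape.\<close>

lemma integral_gaussian:
  fixes H :: "real^'m::finite^'m" and f :: "real^'m \<Rightarrow> real"
  assumes H: "pos_def H" and [measurable]: "f \<in> borel_measurable borel"
  shows "(\<integral>x. f x \<partial>gaussian 0 H) =
    (\<integral>x. f x * exp (- (1/2) * (x \<bullet> (matrix_inv H *v x))) \<partial>lborel) /
    (\<integral>x. exp (- (1/2) * (x \<bullet> (matrix_inv H *v x))) \<partial>lborel)"
proof -
  let ?c = "(2 * pi) powr (- real CARD('m) / 2) * det H powr (- 1 / 2)"
  let ?g = "\<lambda>x. exp (- (1/2) * (x \<bullet> (matrix_inv H *v x)))"
  have d: "det H > 0" by (rule pos_def_det_pos[OF H])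
  have "(\<integral>x. ?g x \<partial>lborel) = (2 * pi) powr (real CARD('m) / 2) * (1 / det H) powr (- 1 / 2)"
    using gaussian_integral(2)[OF pos_def_matrix_inv(3)[OF H]] pos_def_matrix_inv(4)[OF H] by simp
  also have "\<dots> = inverse ?c"
    using d by (simp add: powr_minus powr_divide field_simps)
  finally have Z: "(\<integral>x. ?g x \<partial>lborel) = inverse ?c" .
  have "(\<integral>x. f x \<partial>gaussian 0 H) = (\<integral>x. (?c * ?g x) *\<^sub>R f x \<partial>lborel)"
    unfolding gaussian_def by (subst integral_density) (auto simp: inner_commute)
  also have "\<dots> = ?c * (\<integral>x. f x * ?g x \<partial>lborel)"
    by (simp add: mult_ac flip: integral_mult_right_zero)
  finally show ?thesis unfolding Z by (simp add: field_simps)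
qed

section \<open>Sums over the rescaled lattice\<close>

definition rescaled :: "real^'m::finite \<Rightarrow> nat \<Rightarrow> int^'m \<Rightarrow> real^'m" where
  "rescaled x0 k \<alpha> = sqrt (real k) *\<^sub>R ((1 / real k) *\<^sub>R real_vec \<alpha> - x0)"

text \<open>For k > 0 the points x sent to \<alpha> form the half-open cube of side k^(-1/2) with
  lower corner \<open>rescaled x0 k \<alpha>\<close>; these cubes tile the space.\<close>

definition lattice_floor :: "real^'m::finite \<Rightarrow> nat \<Rightarrow> real^'m \<Rightarrow> int^'m" where
  "lattice_floor x0 k x = (\<chi> j. \<lfloor>real k * x0 $ j + sqrt (real k) * x $ j\<rfloor>)"

lemma rescaled_nth: "k > 0 \<Longrightarrow> rescaled x0 k \<alpha> $ j = (real_of_int (\<alpha> $ j) - real k * x0 $ j) / sqrt (real k)"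
  by (simp add: rescaled_def real_vec_def field_simps)

lemma rescaled_lattice_floor:
  fixes x :: "real^'m::finite"
  assumes "k > 0"
  shows "norm (rescaled x0 k (lattice_floor x0 k x) - x) \<le> real CARD('m) / sqrt (real k)"
proof -
  have s: "sqrt (real k) > 0" using assms by simp
  have "\<bar>(rescaled x0 k (lattice_floor x0 k x) - x) $ j\<bar> \<le> 1 / sqrt (real k)" for j
  proof -
    let ?v = "real k * x0 $ j + sqrt (real k) * x $ j"
    have "(rescaled x0 k (lattice_floor x0 k x) - x) $ j = (real_of_int \<lfloor>?v\<rfloor> - ?v) / sqrt (real k)"
      using s by (simp add: rescaled_nth[OF assms] lattice_floor_def field_simps)
    moreover have "\<bar>real_of_int \<lfloor>?v\<rfloor> - ?v\<bar> \<le> 1" by linarith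
    ultimately show ?thesis using s by (simp add: abs_divide divide_right_mono)
  qed
  then have "(\<Sum>j\<in>UNIV. \<bar>(rescaled x0 k (lattice_floor x0 k x) - x) $ j\<bar>) \<le> (\<Sum>j\<in>(UNIV::'m set). 1 / sqrt (real k))"
    by (intro sum_mono)
  then show ?thesis using norm_le_l1_cart[of "rescaled x0 k (lattice_floor x0 k x) - x"] by simp
qed

lemma lattice_cell:
  fixes \<alpha> :: "int^'m::finite"
  assumes "k > 0"
  shows "{x. lattice_floor x0 k x = \<alpha>} \<in> sets lborel"
    and "emeasure lborel {x. lattice_floor x0 k x = \<alpha>} = ennreal ((1 / sqrt (real k)) ^ CARD('m))"
proof -
  have s: "sqrt (real k) > 0" using assms by simp
  let ?I = "\<lambda>j. {(real_of_int (\<alpha> $ j) - real k * x0 $ j) / sqrt (real k) ..<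
      (real_of_int (\<alpha> $ j) - real k * x0 $ j) / sqrt (real k) + 1 / sqrt (real k)}"
  have "\<lfloor>real k * x0 $ j + sqrt (real k) * x\<rfloor> = \<alpha> $ j \<longleftrightarrow> x \<in> ?I j" for x j
    using s by (simp add: floor_eq_iff field_simps)
  then have cell: "{x. lattice_floor x0 k x = \<alpha>} = {x. \<forall>j. x $ j \<in> ?I j}"
    by (simp add: lattice_floor_def vec_eq_iff)
  then have ind: "(indicator {x. lattice_floor x0 k x = \<alpha>} x :: ennreal) = (\<Prod>j\<in>UNIV. indicator (?I j) (x $ j))" for x
    by (auto simp: indicator_def)
  have "{x. \<forall>j. x $ j \<in> ?I j} = (\<Inter>j\<in>UNIV. (\<lambda>x. x $ j) -` ?I j)" by auto
  also have "\<dots> \<in> sets borel"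
    by (intro sets.finite_INT) (auto intro!: measurable_sets_borel[OF borel_measurable_vec_nth])
  finally show m: "{x. lattice_floor x0 k x = \<alpha>} \<in> sets lborel" by (simp add: cell)
  have "emeasure lborel {x. lattice_floor x0 k x = \<alpha>} = (\<integral>\<^sup>+x. (\<Prod>j\<in>UNIV. indicator (?I j) (x $ j)) \<partial>lborel)"
    using m by (simp flip: ind)
  also have "\<dots> = (\<Prod>j\<in>(UNIV::'m set). ennreal (1 / sqrt (real k)))"
    by (subst nn_integral_lborel_vec_prod) (auto intro!: prod.cong)
  also have "\<dots> = ennreal ((1 / sqrt (real k)) ^ CARD('m))" by (simp add: ennreal_power)
  finally show "emeasure lborel {x. lattice_floor x0 k x = \<alpha>} = ennreal ((1 / sqrt (real k)) ^ CARD('m))" .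
qed

lemma lattice_step_integral:
  fixes S :: "(int^'m::finite) set" and W :: "int^'m \<Rightarrow> real"
  assumes "k > 0" "finite S"
  shows "(\<lambda>x. if lattice_floor x0 k x \<in> S then W (lattice_floor x0 k x) else 0) \<in> borel_measurable lborel"
    and "(\<integral>x. (if lattice_floor x0 k x \<in> S then W (lattice_floor x0 k x) else 0) \<partial>lborel) =
      (1 / sqrt (real k)) ^ CARD('m) * (\<Sum>\<alpha>\<in>S. W \<alpha>)"
proof -
  let ?C = "\<lambda>\<alpha>. {x. lattice_floor x0 k x = \<alpha>}"
  note c = lattice_cell[OF assms(1), of x0]
  have eq: "(if lattice_floor x0 k x \<in> S then W (lattice_floor x0 k x) else 0) = (\<Sum>\<alpha>\<in>S. W \<alpha> * indicator (?C \<alpha>) x)" for x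
    using assms(2) by (simp add: indicator_def if_distrib cong: if_cong)
  show "(\<lambda>x. if lattice_floor x0 k x \<in> S then W (lattice_floor x0 k x) else 0) \<in> borel_measurable lborel"
    unfolding eq using c(1) by (intro borel_measurable_sum borel_measurable_times borel_measurable_indicator) auto
  have i: "integrable lborel (\<lambda>x. W \<alpha> * indicator (?C \<alpha>) x)" for \<alpha>
    using c by (intro integrable_mult_right integrable_real_indicator) auto
  have "(\<integral>x. (\<Sum>\<alpha>\<in>S. W \<alpha> * indicator (?C \<alpha>) x) \<partial>lborel) = (\<Sum>\<alpha>\<in>S. \<integral>x. W \<alpha> * indicator (?C \<alpha>) x \<partial>lborel)"
    by (rule Bochner_Integration.integral_sum) (rule i)
  also have "\<dots> = (\<Sum>\<alpha>\<in>S. W \<alpha> * (1 / sqrt (real k)) ^ CARD('m))"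
    using c by (intro sum.cong refl) (simp add: measure_def enn2real_ennreal)
  finally show "(\<integral>x. (if lattice_floor x0 k x \<in> S then W (lattice_floor x0 k x) else 0) \<partial>lborel) =
      (1 / sqrt (real k)) ^ CARD('m) * (\<Sum>\<alpha>\<in>S. W \<alpha>)"
    unfolding eq by (simp add: sum_distrib_right[symmetric] mult.commute)
qed

lemma mat_vector_mult: "(mat c :: real^'n::finite^'n) *v x = c *\<^sub>R x"
proof -
  have "((mat c :: real^'n^'n) *v x) $ i = (\<Sum>j\<in>UNIV. if j = i then c * x $ j else 0)" for i
    unfolding matrix_vector_mult_def vec_lambda_beta mat_def by (rule sum.cong) auto
  then show ?thesis by (simp add: vec_eq_iff)
qed

lemma pos_def_scalar: "c > 0 \<Longrightarrow> pos_def (mat c :: real^'n::finite^'n)"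
  by (auto simp: pos_def_def mat_vector_mult transpose_mat)

lemma integrable_exp_norm2:
  assumes "c > 0"
  shows "integrable lborel (\<lambda>x::real^'n::finite. exp (- c * (norm x)\<^sup>2))"
proof -
  have "pos_def (mat (2 * c) :: real^'n^'n)" using assms by (intro pos_def_scalar) simp
  from gaussian_integral(1)[OF this] show ?thesis
    by (simp add: mat_vector_mult power2_norm_eq_inner)
qed

text \<open>A sum over the lattice is the integral of a step function that is constant on the cells of
  the rescaled lattice, so that dominated convergence applies.\<close>

lemma lattice_sum_converges:
  fixes W :: "nat \<Rightarrow> int^'m::finite \<Rightarrow> real" and G :: "real^'m \<Rightarrow> real"
  assumes fin: "\<And>k. finite (S k)" and c: "c > 0"
    and bound: "\<And>k \<alpha>. k \<ge> k0 \<Longrightarrow> \<alpha> \<in> S k \<Longrightarrow> \<bar>W k \<alpha>\<bar> \<le> C * exp (- c * (norm (rescaled x0 k \<alpha>))\<^sup>2)"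
    and lim: "\<And>y A. (\<lambda>k. rescaled x0 k (A k)) \<longlonglongrightarrow> y \<Longrightarrow>
      eventually (\<lambda>k. A k \<in> S k) sequentially \<and> (\<lambda>k. W k (A k)) \<longlonglongrightarrow> G y"
  shows "(\<lambda>k. (1 / sqrt (real k)) ^ CARD('m) * (\<Sum>\<alpha>\<in>S k. W k \<alpha>)) \<longlonglongrightarrow> (\<integral>y. G y \<partial>lborel)"
proof -
  \<comment> \<open>Set to 0 for small k: the bound is available from \<open>k0\<close> on, and at k
    = 0 the cells degenerate.\<close>
  define s where "s k x = (if k \<ge> max k0 1 \<and> lattice_floor x0 k x \<in> S k then W k (lattice_floor x0 k x) else 0)" for k x
  have s_eq: "s k = (\<lambda>x. if lattice_floor x0 k x \<in> S k then W k (lattice_floor x0 k x) else 0)" if "k \<ge> max k0 1" for k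
    using that by (auto simp: s_def)
  have meas: "s k \<in> borel_measurable lborel" for k
  proof (cases "k \<ge> max k0 1")
    case True
    then show ?thesis unfolding s_eq[OF True] by (intro lattice_step_integral(1) fin) auto
  next
    case False
    then have "s k = (\<lambda>x. 0)" by (auto simp: s_def fun_eq_iff)
    then show ?thesis by simp
  qed
  let ?m = "real CARD('m)"
  \<comment> \<open>The lower corners of the cells containing x converge to x, so the hypothesis on
    arbitrary lattice sequences gives pointwise convergence of the step functions.\<close>
  have conv: "(\<lambda>k. s k x) \<longlonglongrightarrow> G x" for x
  proof -
    have "(\<lambda>k. rescaled x0 k (lattice_floor x0 k x) - x) \<longlonglongrightarrow> 0"
    proof (rule Lim_null_comparison)
      show "eventually (\<lambda>k. norm (rescaled x0 k (lattice_floor x0 k x) - x) \<le> ?m / sqrt (real k)) sequentially"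
        using rescaled_lattice_floor[of _ x0 x] by (auto simp: eventually_sequentially intro!: exI[of _ 1])
      show "(\<lambda>k. ?m / sqrt (real k)) \<longlonglongrightarrow> 0"
        by (intro tendsto_divide_0[OF tendsto_const] filterlim_at_top_imp_at_infinity
            filterlim_compose[OF sqrt_at_top] filterlim_real_sequentially)
    qed
    then have "(\<lambda>k. rescaled x0 k (lattice_floor x0 k x)) \<longlonglongrightarrow> x" by (rule LIM_zero_cancel)
    from lim[OF this] have ev: "eventually (\<lambda>k. lattice_floor x0 k x \<in> S k) sequentially"
      and l: "(\<lambda>k. W k (lattice_floor x0 k x)) \<longlonglongrightarrow> G x" by auto
    show ?thesis
    proof (rule Lim_transform_eventually[OF l])
      show "eventually (\<lambda>k. W k (lattice_floor x0 k x) = s k x) sequentially"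
        using ev eventually_ge_at_top[of "max k0 1"] by eventually_elim (simp add: s_def)
    qed
  qed
  have C0: "C \<ge> 0 \<or> (\<forall>k\<ge>k0. S k = {})"
  proof (rule ccontr)
    assume "\<not> ?thesis"
    then obtain k \<alpha> where "C < 0" "k \<ge> k0" "\<alpha> \<in> S k" by auto
    then have "0 \<le> C * exp (- c * (norm (rescaled x0 k \<alpha>))\<^sup>2)"
      using bound[of k \<alpha>] abs_ge_zero[of "W k \<alpha>"] by linarith
    then show False using \<open>C < 0\<close> by (simp add: zero_le_mult_iff) 
  qed
  \<comment> \<open>The Gaussian bound is given at the corner y of the cell, and for k \<ge> 1 the
    distance from y to x is at most the dimension m. Then |y|^2 \<ge> |x|^2 / 2 - m^2 moves the
    bound to x, at the price of half the exponent and a constant factor.\<close>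
  let ?w = "\<lambda>x::real^'m. \<bar>C\<bar> * exp (c * ?m\<^sup>2) * exp (- (c/2) * (norm x)\<^sup>2)"
  have dom: "norm (s k x) \<le> ?w x" for k x
  proof (cases "k \<ge> max k0 1 \<and> lattice_floor x0 k x \<in> S k")
    case True
    define y where "y = rescaled x0 k (lattice_floor x0 k x)"
    have k: "k > 0" using True by auto
    have "norm (y - x) \<le> ?m / sqrt (real k)" unfolding y_def by (rule rescaled_lattice_floor[OF k])
    also have "\<dots> \<le> ?m / 1" using k by (intro divide_left_mono) auto
    finally have d: "norm (y - x) \<le> ?m" by simp
    have "norm x \<le> norm y + norm (y - x)" by (metis norm_minus_commute norm_triangle_sub add.commute)
    then have "norm x \<le> norm y + ?m" using d by linarith
    then have "(norm x)\<^sup>2 \<le> (norm y + ?m)\<^sup>2" by (intro power_mono) auto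
    also have "\<dots> \<le> 2 * (norm y)\<^sup>2 + 2 * ?m\<^sup>2"
      using sum_squares_bound[of "norm y" ?m] by (simp add: power2_eq_square algebra_simps)
    finally have "(norm x)\<^sup>2 / 2 - ?m\<^sup>2 \<le> (norm y)\<^sup>2" by simp
    then have "c * ((norm x)\<^sup>2 / 2 - ?m\<^sup>2) \<le> c * (norm y)\<^sup>2" using c by (intro mult_left_mono) auto
    then have e: "exp (- c * (norm y)\<^sup>2) \<le> exp (c * ?m\<^sup>2) * exp (- (c/2) * (norm x)\<^sup>2)"
      by (simp add: exp_add[symmetric] algebra_simps)
    have "norm (s k x) \<le> C * exp (- c * (norm y)\<^sup>2)"
      using True bound[of k "lattice_floor x0 k x"] by (simp add: s_def y_def)
    also have "\<dots> \<le> \<bar>C\<bar> * exp (- c * (norm y)\<^sup>2)" by (intro mult_right_mono) auto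
    also have "\<dots> \<le> \<bar>C\<bar> * (exp (c * ?m\<^sup>2) * exp (- (c/2) * (norm x)\<^sup>2))"
      using e by (intro mult_left_mono) auto
    finally show ?thesis by simp
  qed (auto simp: s_def)
  have "(\<lambda>k. \<integral>x. s k x \<partial>lborel) \<longlonglongrightarrow> (\<integral>y. G y \<partial>lborel)"
  proof (rule integral_dominated_convergence[where w = ?w])
    show "G \<in> borel_measurable lborel" by (rule borel_measurable_LIMSEQ_real[OF conv meas])
    show "integrable lborel ?w"
      using c by (intro integrable_mult_right integrable_exp_norm2) auto
  qed (use conv dom meas in auto)
  then show ?thesis
  proof (rule Lim_transform_eventually)
    show "eventually (\<lambda>k. (\<integral>x. s k x \<partial>lborel) = (1 / sqrt (real k)) ^ CARD('m) * (\<Sum>\<alpha>\<in>S k. W k \<alpha>)) sequentially"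
      using eventually_ge_at_top[of "max k0 1"]
    proof eventually_elim
      case (elim k)
      then show ?case unfolding s_eq[OF elim] by (intro lattice_step_integral(2) fin) auto
    qed
  qed
qed

section \<open>Laplace asymptotics for a strictly convex potential\<close>

lemma bounded_bilinear_matrix_vector_mult:
  "bounded_bilinear ((*v) :: real^'n::finite^'m::finite \<Rightarrow> real^'n \<Rightarrow> real^'m)"
  unfolding bilinear_conv_bounded_bilinear[symmetric] bilinear_def
  by (auto intro!: linearI simp: matrix_vector_mult_def vec_eq_iff algebra_simps sum.distrib sum_distrib_left)

text \<open>Positivity of the Hessian is only pointwise. A uniform lower bound is impossible for the
  toric potential, whose gradient stays in a polytope, so quantitative bounds on the Hessian have to
  be local.\<close>

locale convex_potential =
  fixes \<phi> :: "real^'m::finite \<Rightarrow> real"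
  assumes C2: "Cn 2 UNIV \<phi>"
    and hessian_pos: "u \<noteq> 0 \<Longrightarrow> u \<bullet> (hessian \<phi> x *v u) > 0"
begin

lemma derivatives:
  shows "(\<phi> has_derivative frechet_derivative \<phi> (at x)) (at x)"
    and "((\<lambda>y. frechet_derivative \<phi> (at y) v) has_derivative
      frechet_derivative (\<lambda>y. frechet_derivative \<phi> (at y) v) (at x)) (at x)"
    and "continuous_on UNIV (\<lambda>x. frechet_derivative (\<lambda>y. frechet_derivative \<phi> (at y) v) (at x) w)"
  using Cn_Suc_E(1)[OF C2[unfolded numeral_2_eq_2]]
    Cn_Suc_E[OF Cn_Suc_E(2)[OF C2[unfolded numeral_2_eq_2]]] by auto

lemma frechet_gradient: "frechet_derivative \<phi> (at x) v = gradient \<phi> x \<bullet> v"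
proof -
  have lin: "linear (frechet_derivative \<phi> (at x))" using derivatives(1) by (rule has_derivative_linear)
  have "frechet_derivative \<phi> (at x) v = frechet_derivative \<phi> (at x) (\<Sum>j\<in>UNIV. v $ j *\<^sub>R axis j 1)"
    using basis_expansion[of v] by (simp add: scalar_mult_eq_scaleR)
  then show ?thesis
    by (simp only: linear_sum[OF lin] linear_cmul[OF lin])
      (simp add: gradient_def inner_vec_def mult.commute)
qed

lemma continuous_hessian: "continuous_on UNIV (hessian \<phi>)"
  unfolding hessian_def by (intro continuous_on_vec_lambda derivatives(3))

lemma gradient_derivative:
  "((\<lambda>y. gradient \<phi> y \<bullet> s) has_derivative (\<lambda>v. v \<bullet> (hessian \<phi> x *v s))) (at x)"
proof -
  let ?D = "\<lambda>j. frechet_derivative (\<lambda>y. frechet_derivative \<phi> (at y) (axis j 1)) (at x)"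
  have lin: "linear (?D j)" for j using derivatives(2) by (rule has_derivative_linear)
  have D: "?D j v = (\<Sum>i\<in>UNIV. v $ i * hessian \<phi> x $ i $ j)" for j v
  proof -
    have "?D j v = ?D j (\<Sum>i\<in>UNIV. v $ i *\<^sub>R axis i 1)"
      using basis_expansion[of v] by (simp add: scalar_mult_eq_scaleR)
    then show ?thesis by (simp only: linear_sum[OF lin] linear_cmul[OF lin]) (simp add: hessian_def)
  qed
  have "((\<lambda>y. \<Sum>j\<in>UNIV. s $ j *\<^sub>R frechet_derivative \<phi> (at y) (axis j 1)) has_derivative
      (\<lambda>v. \<Sum>j\<in>UNIV. s $ j *\<^sub>R ?D j v)) (at x)"
    by (intro has_derivative_sum has_derivative_scaleR_right derivatives(2))
  moreover have "(\<Sum>j\<in>UNIV. s $ j *\<^sub>R frechet_derivative \<phi> (at y) (axis j 1)) = gradient \<phi> y \<bullet> s" for y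
    by (simp add: gradient_def inner_vec_def mult.commute)
  moreover have "(\<Sum>j\<in>UNIV. s $ j *\<^sub>R ?D j v) = v \<bullet> (hessian \<phi> x *v s)" for v
    unfolding D inner_vec_def matrix_vector_mult_def vec_lambda_beta
    by (simp add: sum_distrib_left) (subst sum.swap, simp add: mult_ac)
  ultimately show ?thesis by simp
qed

lemma pos_def_hessian: "pos_def (hessian \<phi> x)"
proof -
  have "hessian \<phi> x $ i $ j = hessian \<phi> x $ j $ i" for i j
    unfolding hessian_def vec_lambda_beta by (rule second_derivative_commute[OF open_UNIV UNIV_I C2])
  then show ?thesis using hessian_pos by (simp add: pos_def_def transpose_def vec_eq_iff)
qed

lemma line_derivatives:
  shows "((\<lambda>t. \<phi> (x + t *\<^sub>R s)) has_real_derivative gradient \<phi> (x + t *\<^sub>R s) \<bullet> s) (at t)"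
    and "((\<lambda>t. gradient \<phi> (x + t *\<^sub>R s) \<bullet> s) has_real_derivative s \<bullet> (hessian \<phi> (x + t *\<^sub>R s) *v s)) (at t)"
proof -
  have l: "((\<lambda>t. x + t *\<^sub>R s) has_derivative (\<lambda>t. t *\<^sub>R s)) (at t)"
    by (auto intro!: derivative_eq_intros)
  have "((\<lambda>t. \<phi> (x + t *\<^sub>R s)) has_derivative (\<lambda>r. frechet_derivative \<phi> (at (x + t *\<^sub>R s)) (r *\<^sub>R s))) (at t)"
    by (rule has_derivative_compose[where g = \<phi>, OF l derivatives(1)])
  then show "((\<lambda>t. \<phi> (x + t *\<^sub>R s)) has_real_derivative gradient \<phi> (x + t *\<^sub>R s) \<bullet> s) (at t)"
    unfolding has_field_derivative_def frechet_gradient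
    by (rule has_derivative_eq_rhs) (auto simp: mult.commute)
  have "((\<lambda>t. gradient \<phi> (x + t *\<^sub>R s) \<bullet> s) has_derivative (\<lambda>r. (r *\<^sub>R s) \<bullet> (hessian \<phi> (x + t *\<^sub>R s) *v s))) (at t)"
    by (rule has_derivative_compose[where g = "\<lambda>y. gradient \<phi> y \<bullet> s", OF l gradient_derivative])
  then show "((\<lambda>t. gradient \<phi> (x + t *\<^sub>R s) \<bullet> s) has_real_derivative s \<bullet> (hessian \<phi> (x + t *\<^sub>R s) *v s)) (at t)"
    unfolding has_field_derivative_def
    by (rule has_derivative_eq_rhs) (auto simp: mult.commute)
qed

lemma taylor:
  "\<exists>t. 0 < t \<and> t < 1 \<and> \<phi> (x + s) = \<phi> x + gradient \<phi> x \<bullet> s + (1/2) * (s \<bullet> (hessian \<phi> (x + t *\<^sub>R s) *v s))"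
proof -
  let ?d = "\<lambda>(n::nat) t. if n = 0 then \<phi> (x + t *\<^sub>R s) else if n = 1 then gradient \<phi> (x + t *\<^sub>R s) \<bullet> s
    else s \<bullet> (hessian \<phi> (x + t *\<^sub>R s) *v s)"
  have "\<exists>t>0. t < 1 \<and> \<phi> (x + 1 *\<^sub>R s) = (\<Sum>m<2. ?d m 0 / fact m * (1 - 0) ^ m) + ?d 2 t / fact 2 * (1 - 0) ^ 2"
    by (rule Taylor_up[where a = 0 and b = 1 and c = 0 and diff = ?d and f = "\<lambda>t. \<phi> (x + t *\<^sub>R s)"])
      (auto simp: less_2_cases_iff line_derivatives)
  then show ?thesis by (auto simp: numeral_2_eq_2 lessThan_Suc)
qed

lemma tangent: "\<phi> (x + s) \<ge> \<phi> x + gradient \<phi> x \<bullet> s"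
proof -
  obtain t where "\<phi> (x + s) = \<phi> x + gradient \<phi> x \<bullet> s + (1/2) * (s \<bullet> (hessian \<phi> (x + t *\<^sub>R s) *v s))"
    using taylor by blast
  moreover have "s \<bullet> (hessian \<phi> (x + t *\<^sub>R s) *v s) \<ge> 0"
    using hessian_pos[of s "x + t *\<^sub>R s"] by (cases "s = 0") auto
  ultimately show ?thesis by linarith
qed

lemma continuous_potential: "continuous_on UNIV \<phi>"
  by (rule Cn_imp_continuous_on[OF C2])

end

locale centered_potential = convex_potential \<phi> for \<phi> :: "real^'m::finite \<Rightarrow> real" +
  fixes \<rho>0 :: "real^'m"
begin

abbreviation "x0 \<equiv> gradient \<phi> \<rho>0"
abbreviation "H \<equiv> hessian \<phi> \<rho>0"

text \<open>The Bregman divergence of \<phi> from the base point. Subtracting the tangent plane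
  centres the exponent of the integrand, and the slope of that plane is the value of the moment
  map.\<close>

definition G :: "real^'m \<Rightarrow> real" where
  "G s = \<phi> (\<rho>0 + s) - \<phi> \<rho>0 - x0 \<bullet> s"

lemma quadratic_bounds:
  "\<exists>c A. 0 < c \<and> c \<le> A \<and> (\<forall>x\<in>cball \<rho>0 1. \<forall>s. c * (norm s)\<^sup>2 \<le> s \<bullet> (hessian \<phi> x *v s) \<and>
    s \<bullet> (hessian \<phi> x *v s) \<le> A * (norm s)\<^sup>2)"
proof -
  let ?K = "cball \<rho>0 1 \<times> sphere (0::real^'m) 1"
  let ?q = "\<lambda>(x,u). u \<bullet> (hessian \<phi> x *v u)"
  have K: "compact ?K" "?K \<noteq> {}"
    by (auto intro!: compact_Times)
  have q: "continuous_on ?K ?q"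
    unfolding case_prod_beta
    by (intro continuous_intros bounded_bilinear.continuous_on[OF bounded_bilinear_matrix_vector_mult]
        continuous_on_compose2[OF continuous_hessian]) auto
  obtain p where p: "p \<in> ?K" "\<And>z. z \<in> ?K \<Longrightarrow> ?q p \<le> ?q z"
    using continuous_attains_inf[OF K q] by blast
  obtain r where r: "r \<in> ?K" "\<And>z. z \<in> ?K \<Longrightarrow> ?q z \<le> ?q r"
    using continuous_attains_sup[OF K q] by blast
  have pp: "?q p > 0" using p(1) hessian_pos[of "snd p" "fst p"] by (cases p) (force simp: dist_norm)
  have "?q p * (norm s)\<^sup>2 \<le> s \<bullet> (hessian \<phi> x *v s) \<and> s \<bullet> (hessian \<phi> x *v s) \<le> ?q r * (norm s)\<^sup>2"
    if x: "x \<in> cball \<rho>0 1" for x s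
  proof (cases "s = 0")
    case False
    define u where "u = (1 / norm s) *\<^sub>R s"
    have "(x, u) \<in> ?K" using x False by (simp add: u_def)
    then have b: "?q p \<le> u \<bullet> (hessian \<phi> x *v u)" "u \<bullet> (hessian \<phi> x *v u) \<le> ?q r"
      using p(2)[of "(x,u)"] r(2)[of "(x,u)"] by auto
    have "s = norm s *\<^sub>R u" using False by (simp add: u_def)
    then have "s \<bullet> (hessian \<phi> x *v s) = (norm s)\<^sup>2 * (u \<bullet> (hessian \<phi> x *v u))"
      by (metis (no_types, lifting) inner_scaleR_left inner_scaleR_right matrix_vector_mult_scaleR mult.assoc power2_eq_square)
    then show ?thesis using b by (simp add: mult.commute mult_left_mono)
  qed auto
  moreover have "?q p \<le> ?q r" using p(2)[OF r(1)] .
  ultimately show ?thesis using pp by blast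
qed

text \<open>Inside the unit ball this is Taylor's formula. Outside, convexity along a ray gives t
  G(u) \<le> G(t u) for a unit vector u and t \<ge> 1, so the quadratic bound on the sphere
  propagates as linear growth.\<close>

lemma G_near:
  assumes "c > 0" "\<And>x s. x \<in> cball \<rho>0 1 \<Longrightarrow> c * (norm s)\<^sup>2 \<le> s \<bullet> (hessian \<phi> x *v s) \<and>
    s \<bullet> (hessian \<phi> x *v s) \<le> A * (norm s)\<^sup>2"
  shows "norm s \<le> 1 \<Longrightarrow> c / 2 * (norm s)\<^sup>2 \<le> G s" "norm s \<le> 1 \<Longrightarrow> G s \<le> A / 2 * (norm s)\<^sup>2"
    and "norm s \<ge> 1 \<Longrightarrow> c / 2 * norm s \<le> G s"
proof -
  have near: "c / 2 * (norm s)\<^sup>2 \<le> G s \<and> G s \<le> A / 2 * (norm s)\<^sup>2" if s: "norm s \<le> 1" for s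
  proof -
    obtain t where t: "0 < t" "t < 1" "\<phi> (\<rho>0 + s) = \<phi> \<rho>0 + x0 \<bullet> s + (1/2) * (s \<bullet> (hessian \<phi> (\<rho>0 + t *\<^sub>R s) *v s))"
      using taylor by blast
    have "t * norm s \<le> 1 * 1" using t s by (intro mult_mono) auto
    then have "\<rho>0 + t *\<^sub>R s \<in> cball \<rho>0 1" using t by (simp add: dist_norm)
    from assms(2)[OF this, of s] t(3) show ?thesis unfolding G_def by auto
  qed
  then show "norm s \<le> 1 \<Longrightarrow> c / 2 * (norm s)\<^sup>2 \<le> G s" "norm s \<le> 1 \<Longrightarrow> G s \<le> A / 2 * (norm s)\<^sup>2" by auto
  assume s: "norm s \<ge> 1"
  define u where "u = (1 / norm s) *\<^sub>R s"
  define t where "t = norm s"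
  have su: "s = t *\<^sub>R u" and u: "norm u = 1" and t: "t \<ge> 1"
    using s by (auto simp: u_def t_def)
  have 1: "\<phi> (\<rho>0 + u) + gradient \<phi> (\<rho>0 + u) \<bullet> ((t - 1) *\<^sub>R u) \<le> \<phi> (\<rho>0 + u + (t - 1) *\<^sub>R u)"
    by (rule tangent)
  \<comment> \<open>The tangent at \<open>\<rho>0 + u\<close>, read at \<open>\<rho>0\<close>,
    bounds the slope in direction u from below; fact \<open>1\<close> follows the same tangent
    outwards to s.\<close>
  have 2: "\<phi> (\<rho>0 + u) + gradient \<phi> (\<rho>0 + u) \<bullet> (- u) \<le> \<phi> (\<rho>0 + u + - u)"
    by (rule tangent)
  have e: "\<rho>0 + u + (t - 1) *\<^sub>R u = \<rho>0 + s" by (simp add: su algebra_simps)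
  have "G u + x0 \<bullet> u \<le> gradient \<phi> (\<rho>0 + u) \<bullet> u" using 2 by (simp add: G_def)
  then have "(t - 1) * (G u + x0 \<bullet> u) \<le> (t - 1) * (gradient \<phi> (\<rho>0 + u) \<bullet> u)"
    using t by (intro mult_left_mono) auto
  then have "\<phi> (\<rho>0 + u) + (t - 1) * (G u + x0 \<bullet> u) \<le> \<phi> (\<rho>0 + s)" using 1 unfolding e by simp
  then have "t * G u \<le> G s" unfolding su by (simp add: G_def algebra_simps)
  moreover have "t * (c / 2) \<le> t * G u"
    using near[of u] u t by (intro mult_left_mono) auto
  ultimately show "c / 2 * norm s \<le> G s" by (simp add: t_def mult.commute)
qed

text \<open>A lower bound for the Hessian on the unit ball, fixed once by choice because several
  rates and thresholds below are multiples of it.\<close>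

definition c0 :: real where
  "c0 = (SOME c. c > 0 \<and> (\<exists>A. \<forall>x\<in>cball \<rho>0 1. \<forall>s. c * (norm s)\<^sup>2 \<le> s \<bullet> (hessian \<phi> x *v s) \<and>
    s \<bullet> (hessian \<phi> x *v s) \<le> A * (norm s)\<^sup>2))"

lemma
  shows c0_pos: "c0 > 0"
    and c0_A: "\<exists>A. \<forall>x\<in>cball \<rho>0 1. \<forall>s. c0 * (norm s)\<^sup>2 \<le> s \<bullet> (hessian \<phi> x *v s) \<and>
    s \<bullet> (hessian \<phi> x *v s) \<le> A * (norm s)\<^sup>2"
  using someI_ex[of "\<lambda>c. c > 0 \<and> (\<exists>A. \<forall>x\<in>cball \<rho>0 1. \<forall>s. c * (norm s)\<^sup>2 \<le> s \<bullet> (hessian \<phi> x *v s) \<and>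
    s \<bullet> (hessian \<phi> x *v s) \<le> A * (norm s)\<^sup>2)"] quadratic_bounds unfolding c0_def[symmetric] by blast+

lemma G_lower: "norm s \<le> 1 \<Longrightarrow> c0 / 2 * (norm s)\<^sup>2 \<le> G s" "norm s \<ge> 1 \<Longrightarrow> c0 / 2 * norm s \<le> G s"
  using c0_A G_near(1,3)[OF c0_pos] by blast+

lemma G_upper: "\<exists>A>0. \<forall>s. norm s \<le> 1 \<longrightarrow> G s \<le> A / 2 * (norm s)\<^sup>2"
proof -
  obtain A where A: "norm s \<le> 1 \<Longrightarrow> G s \<le> A / 2 * (norm s)\<^sup>2" for s
    using c0_A G_near(2)[OF c0_pos] by blast
  have "G s \<le> (\<bar>A\<bar> + 1) / 2 * (norm s)\<^sup>2" if "norm s \<le> 1" for s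
  proof -
    have "A / 2 * (norm s)\<^sup>2 \<le> (\<bar>A\<bar> + 1) / 2 * (norm s)\<^sup>2"
      by (intro mult_right_mono divide_right_mono) auto
    with A[OF that] show ?thesis by linarith
  qed
  then show ?thesis by (intro exI[of _ "\<bar>A\<bar> + 1"]) auto
qed

text \<open>The Legendre transform of \<phi> is finite on a ball around \<open>x0\<close>: there (x
  - x0) . s grows at most like c0/2 |s|, which the linear growth of \<open>G\<close> absorbs. This
  will show that \<open>x0\<close> is an interior point of the polytope.\<close>

lemma dual_bounded:
  assumes "norm (x - x0) < c0 / 2"
  shows "x \<bullet> \<rho> - \<phi> \<rho> \<le> x \<bullet> \<rho>0 - \<phi> \<rho>0 + c0"
proof -
  define s where "s = \<rho> - \<rho>0"
  have e: "x \<bullet> \<rho> - \<phi> \<rho> = x \<bullet> \<rho>0 - \<phi> \<rho>0 + ((x - x0) \<bullet> s - G s)"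
    by (simp add: s_def G_def inner_diff_left inner_diff_right)
  have cs: "(x - x0) \<bullet> s \<le> c0 / 2 * norm s"
    using norm_cauchy_schwarz[of "x - x0" s] mult_right_mono[of "norm (x - x0)" "c0/2" "norm s"] assms by auto
  have "(x - x0) \<bullet> s - G s \<le> c0"
  proof (cases "norm s \<le> 1")
    case True
    have "0 \<le> c0 / 2 * (norm s)\<^sup>2" using c0_pos by simp
    moreover have "c0 / 2 * norm s \<le> c0 / 2 * 1" using True c0_pos by (intro mult_left_mono) auto
    ultimately show ?thesis using cs G_lower(1)[OF True] c0_pos by linarith
  next
    case False
    then show ?thesis using cs G_lower(2)[of s] c0_pos by linarith
  qed
  with e show ?thesis by linarith
qed

text \<open>Taylor's formula with the Hessian at an intermediate point, which tends to the base
  point; k cancels against the two factors k^(-1/2).\<close>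

lemma G_scaled_limit: "(\<lambda>k. real k * G ((1 / sqrt (real k)) *\<^sub>R t)) \<longlonglongrightarrow> (1/2) * (t \<bullet> (H *v t))"
proof -
  let ?s = "\<lambda>k. (1 / sqrt (real k)) *\<^sub>R t"
  have "\<exists>r. 0 < r \<and> r < 1 \<and> \<phi> (\<rho>0 + ?s k) = \<phi> \<rho>0 + x0 \<bullet> ?s k + (1/2) * (?s k \<bullet> (hessian \<phi> (\<rho>0 + r *\<^sub>R ?s k) *v ?s k))" for k
    by (rule taylor)
  then obtain r where r: "\<And>k. 0 < r k \<and> r k < 1"
    "\<And>k. G (?s k) = (1/2) * (?s k \<bullet> (hessian \<phi> (\<rho>0 + r k *\<^sub>R ?s k) *v ?s k))"
    unfolding G_def by (metis (no_types, lifting) add_diff_cancel_left' diff_diff_eq)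
  have s0: "?s \<longlonglongrightarrow> 0 *\<^sub>R t"
    by (intro tendsto_scaleR tendsto_const tendsto_divide_0[OF tendsto_const] filterlim_at_top_imp_at_infinity
            filterlim_compose[OF sqrt_at_top] filterlim_real_sequentially)
  have "(\<lambda>k. r k *\<^sub>R ?s k) \<longlonglongrightarrow> 0"
  proof (rule Lim_null_comparison)
    show "eventually (\<lambda>k. norm (r k *\<^sub>R ?s k) \<le> norm (?s k)) sequentially"
    proof (intro always_eventually allI)
      fix k
      have "\<bar>r k\<bar> * norm (?s k) \<le> 1 * norm (?s k)"
        using r(1)[of k] by (intro mult_right_mono) auto
      then show "norm (r k *\<^sub>R ?s k) \<le> norm (?s k)" by (subst norm_scaleR) simp
    qed
    show "(\<lambda>k. norm (?s k)) \<longlonglongrightarrow> 0" using tendsto_norm[OF s0] by simp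
  qed
  from tendsto_add[OF tendsto_const this, of \<rho>0]
  have p: "(\<lambda>k. \<rho>0 + r k *\<^sub>R ?s k) \<longlonglongrightarrow> \<rho>0" by simp
  have "(\<lambda>k. hessian \<phi> (\<rho>0 + r k *\<^sub>R ?s k)) \<longlonglongrightarrow> H"
    using continuous_on_tendsto_compose[OF continuous_hessian p] by simp
  then have "(\<lambda>k. (1/2) * (t \<bullet> (hessian \<phi> (\<rho>0 + r k *\<^sub>R ?s k) *v t))) \<longlonglongrightarrow> (1/2) * (t \<bullet> (H *v t))"
    by (intro tendsto_intros bounded_bilinear.tendsto[OF bounded_bilinear_matrix_vector_mult])
  then show ?thesis
  proof (rule Lim_transform_eventually)
    show "eventually (\<lambda>k. (1/2) * (t \<bullet> (hessian \<phi> (\<rho>0 + r k *\<^sub>R ?s k) *v t)) = real k * G (?s k)) sequentially"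
      using eventually_gt_at_top[of 0]
    proof eventually_elim
      case (elim k)
      then show ?case unfolding r(2) by (simp add: matrix_vector_mult_scaleR)
    qed
  qed
qed

end

section \<open>The Laplace integral over the unit ball\<close>

context centered_potential
begin

text \<open>The density of the Liouville measure in the variable \<rho>, after the angles have
  contributed (2 pi)^m.\<close>

definition vol_density :: "real^'m \<Rightarrow> real" where
  "vol_density x = (2 * pi) ^ CARD('m) * det (hessian \<phi> x)"

lemma vol_density_pos: "vol_density x > 0"
  using pos_def_det_pos[OF pos_def_hessian] by (simp add: vol_density_def)

lemma continuous_vol_density: "continuous_on UNIV vol_density"
  unfolding vol_density_def det_def
  by (intro continuous_intros continuous_on_compose2[OF continuous_hessian]) auto

lemma continuous_G: "continuous_on UNIV G"
  unfolding G_def by (intro continuous_intros continuous_on_compose2[OF continuous_potential]) auto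

lemma borel_measurable_vol_density [measurable]: "vol_density \<in> borel_measurable borel"
  by (rule borel_measurable_continuous_onI[OF continuous_vol_density])

lemma vol_density_bounds: "\<exists>d D. 0 < d \<and> 0 < D \<and> (\<forall>x\<in>cball \<rho>0 1. d \<le> vol_density x \<and> vol_density x \<le> D)"
proof -
  have c: "continuous_on (cball \<rho>0 1) vol_density"
    by (rule continuous_on_subset[OF continuous_vol_density]) auto
  obtain p where p: "\<forall>x\<in>cball \<rho>0 1. vol_density p \<le> vol_density x"
    using continuous_attains_inf[OF compact_cball _ c] by auto
  obtain q where q: "\<forall>x\<in>cball \<rho>0 1. vol_density x \<le> vol_density q"
    using continuous_attains_sup[OF compact_cball _ c] by auto
  show ?thesis using p q vol_density_pos by blast
qed

text \<open>The part of the normalized squared norm that comes from the points with |\<rho> -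
  \<rho>0| \<le> 1, written in s = \<rho> - \<rho>0.\<close>

definition local_int :: "nat \<Rightarrow> real^'m \<Rightarrow> real" where
  "local_int k y = (\<integral>s. indicator (cball 0 1) s *
     (vol_density (\<rho>0 + s) * exp (sqrt (real k) * (y \<bullet> s) - real k * G s)) \<partial>lborel)"

definition scaled_integrand :: "nat \<Rightarrow> real^'m \<Rightarrow> real^'m \<Rightarrow> real" where
  "scaled_integrand k y t = indicator (cball 0 1) ((1 / sqrt (real k)) *\<^sub>R t) *
     (vol_density (\<rho>0 + (1 / sqrt (real k)) *\<^sub>R t) * exp (y \<bullet> t - real k * G ((1 / sqrt (real k)) *\<^sub>R t)))"

lemma borel_measurable_scaled_integrand [measurable]: "scaled_integrand k y \<in> borel_measurable borel"
proof -
  have "(\<lambda>t::real^'m. (1 / sqrt (real k)) *\<^sub>R t) \<in> borel_measurable borel"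
    by (intro borel_measurable_continuous_onI linear_continuous_on bounded_linear_scaleR_right)
  moreover have "(indicator (cball (0::real^'m) 1) :: real^'m \<Rightarrow> real) \<in> borel_measurable borel"
    by (rule borel_measurable_indicator) simp
  ultimately have "(\<lambda>t. indicator (cball (0::real^'m) 1) ((1 / sqrt (real k)) *\<^sub>R t) :: real) \<in> borel_measurable borel"
    by (rule measurable_compose)
  moreover have "(\<lambda>t. vol_density (\<rho>0 + (1 / sqrt (real k)) *\<^sub>R t) *
      exp (y \<bullet> t - real k * G ((1 / sqrt (real k)) *\<^sub>R t))) \<in> borel_measurable borel"
    by (intro borel_measurable_continuous_onI continuous_intros continuous_on_compose2[OF continuous_vol_density]
        continuous_on_compose2[OF continuous_G]) auto
  ultimately show ?thesis
    unfolding scaled_integrand_def[abs_def] by (rule borel_measurable_times)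
qed

lemma scaled_integrand_nonneg: "0 \<le> scaled_integrand k y t"
  using vol_density_pos by (simp add: scaled_integrand_def less_imp_le)

lemma local_int_scaled:
  assumes "k > 0"
  shows "sqrt (real k) ^ CARD('m) * local_int k y = (\<integral>t. scaled_integrand k y t \<partial>lborel)"
proof -
  let ?c = "1 / sqrt (real k)"
  let ?f = "\<lambda>s. indicator (cball 0 1) s *
     (vol_density (\<rho>0 + s) * exp (sqrt (real k) * (y \<bullet> s) - real k * G s))"
  have c: "?c > 0" "sqrt (real k) > 0" using assms by auto
  have fm[measurable]: "?f \<in> borel_measurable borel"
    by (intro borel_measurable_times borel_measurable_indicator borel_measurable_continuous_onI continuous_intros
        continuous_on_compose2[OF continuous_vol_density] continuous_on_compose2[OF continuous_G]) auto
  have L: "(lborel :: (real^'m) measure) = density (distr lborel borel ((*\<^sub>R) ?c)) (\<lambda>_. ennreal (?c ^ CARD('m)))"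
    using lborel_affine[of ?c "0 :: real^'m"] c by (simp add: power_abs)
  have "local_int k y = (\<integral>s. ?f s \<partial>density (distr lborel borel ((*\<^sub>R) ?c)) (\<lambda>_. ennreal (?c ^ CARD('m))))"
    unfolding local_int_def by (subst (1) L) (rule refl)
  also have "\<dots> = (\<integral>s. ?c ^ CARD('m) *\<^sub>R ?f s \<partial>distr lborel borel ((*\<^sub>R) ?c))"
    using c by (subst integral_density) auto
  also have "\<dots> = (\<integral>t. ?c ^ CARD('m) *\<^sub>R ?f (?c *\<^sub>R t) \<partial>lborel)"
    by (subst integral_distr) auto
  also have "(\<lambda>t. ?c ^ CARD('m) *\<^sub>R ?f (?c *\<^sub>R t)) = (\<lambda>t. ?c ^ CARD('m) * scaled_integrand k y t)"
    using c by (auto simp: scaled_integrand_def fun_eq_iff)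
  finally have "local_int k y = ?c ^ CARD('m) * (\<integral>t. scaled_integrand k y t \<partial>lborel)" by simp
  then show ?thesis using c by (simp add: power_divide)
qed

lemma norm_scaled: "(norm ((1 / sqrt (real k)) *\<^sub>R t))\<^sup>2 = (norm t)\<^sup>2 / real k"
  by (simp add: power_divide)

text \<open>Half of the decay c0/2 |t|^2 supplied by \<open>G\<close> is spent on the linear term,
  through K |t| \<le> K^2/c0 + c0/4 |t|^2. The bound depends on y only through K, as dominated
  convergence along a moving y requires.\<close>

lemma scaled_integrand_bound:
  assumes "k > 0" "\<And>x. x \<in> cball \<rho>0 1 \<Longrightarrow> vol_density x \<le> D" "norm y \<le> K" "D > 0"
  shows "scaled_integrand k y t \<le> D * exp (K\<^sup>2 / c0) * exp (- (c0 / 4) * (norm t)\<^sup>2)"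
proof (cases "norm ((1 / sqrt (real k)) *\<^sub>R t) \<le> 1")
  case True
  let ?s = "(1 / sqrt (real k)) *\<^sub>R t"
  have k: "sqrt (real k) > 0" using assms(1) by simp
  have "c0 / 2 * (norm t)\<^sup>2 = real k * (c0 / 2 * (norm ?s)\<^sup>2)"
    unfolding norm_scaled using assms(1) by simp
  also have "\<dots> \<le> real k * G ?s" by (intro mult_left_mono G_lower(1)[OF True]) auto
  finally have 1: "c0 / 2 * (norm t)\<^sup>2 \<le> real k * G ?s" .
  have "y \<bullet> t \<le> K * norm t"
    using norm_cauchy_schwarz[of y t] mult_right_mono[OF assms(3), of "norm t"] by auto
  also have "\<dots> \<le> K\<^sup>2 / c0 + c0 / 4 * (norm t)\<^sup>2"
  proof -
    have "0 \<le> (K / sqrt c0 - sqrt c0 / 2 * norm t)\<^sup>2" by simp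
    also have "\<dots> = K\<^sup>2 / c0 + c0 / 4 * (norm t)\<^sup>2 - K * norm t"
      using c0_pos by (simp add: power2_diff power_divide power_mult_distrib)
    finally show ?thesis by simp
  qed
  finally have "y \<bullet> t - real k * G ?s \<le> K\<^sup>2 / c0 - c0 / 4 * (norm t)\<^sup>2" using 1 by linarith
  then have "exp (y \<bullet> t - real k * G ?s) \<le> exp (K\<^sup>2 / c0) * exp (- (c0 / 4) * (norm t)\<^sup>2)"
    by (simp add: exp_add[symmetric])
  moreover have "vol_density (\<rho>0 + ?s) \<le> D" using True by (intro assms(2)) (simp add: dist_norm)
  ultimately have "vol_density (\<rho>0 + ?s) * exp (y \<bullet> t - real k * G ?s) \<le> D * (exp (K\<^sup>2 / c0) * exp (- (c0 / 4) * (norm t)\<^sup>2))"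
    using assms(4) by (intro mult_mono) auto
  then show ?thesis using True by (simp add: scaled_integrand_def)
next
  case False
  then show ?thesis using assms(4) by (simp add: scaled_integrand_def)
qed

lemma integrable_scaled_integrand:
  assumes "k > 0" shows "integrable lborel (scaled_integrand k y)"
proof -
  obtain d D where D: "0 < D" "\<And>x. x \<in> cball \<rho>0 1 \<Longrightarrow> vol_density x \<le> D"
    using vol_density_bounds by blast
  show ?thesis
  proof (rule Bochner_Integration.integrable_bound)
    show "integrable lborel (\<lambda>t::real^'m. D * exp ((norm y)\<^sup>2 / c0) * exp (- (c0 / 4) * (norm t)\<^sup>2))"
      using c0_pos by (intro integrable_mult_right integrable_exp_norm2) auto
    show "AE t in lborel. norm (scaled_integrand k y t) \<le> norm (D * exp ((norm y)\<^sup>2 / c0) * exp (- (c0 / 4) * (norm t)\<^sup>2))"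
    proof (rule AE_I2)
      fix t
      have "scaled_integrand k y t \<le> D * exp ((norm y)\<^sup>2 / c0) * exp (- (c0 / 4) * (norm t)\<^sup>2)"
        by (rule scaled_integrand_bound[OF assms D(2) order_refl D(1)])
      then show "norm (scaled_integrand k y t) \<le> norm (D * exp ((norm y)\<^sup>2 / c0) * exp (- (c0 / 4) * (norm t)\<^sup>2))"
        using scaled_integrand_nonneg[of k y t] D(1) by simp
    qed
  qed simp
qed

definition laplace_const :: real where
  "laplace_const = vol_density \<rho>0 * (\<integral>t. exp (- (1/2) * (t \<bullet> (H *v t))) \<partial>lborel)"

lemma laplace_const_pos: "laplace_const > 0"
  unfolding laplace_const_def gaussian_integral(2)[OF pos_def_hessian]
  using pos_def_det_pos[OF pos_def_hessian, of \<rho>0] by (intro mult_pos_pos vol_density_pos) auto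

text \<open>The parameter varies with k because lattice points only approximate a given y. After
  rescaling, the indicator of the ball tends to 1 and the Laplace transform of a Gaussian with
  matrix \<open>H\<close> remains.\<close>

lemma local_int_limit:
  assumes y: "Y \<longlonglongrightarrow> y"
  shows "(\<lambda>k. sqrt (real k) ^ CARD('m) * local_int k (Y k)) \<longlonglongrightarrow>
    laplace_const * exp ((1/2) * (y \<bullet> (matrix_inv H *v y)))"
proof -
  obtain d D where D: "0 < D" "\<And>x. x \<in> cball \<rho>0 1 \<Longrightarrow> vol_density x \<le> D"
    using vol_density_bounds by blast
  obtain K where K: "\<And>k. norm (Y k) \<le> K"
    using convergent_imp_Bseq[of Y] y by (auto simp: convergent_def Bseq_def)
  \<comment> \<open>Shifted by one, since the domination holds for k > 0.\<close>
  let ?F = "\<lambda>k t. scaled_integrand (Suc k) (Y (Suc k)) t"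
  let ?f = "\<lambda>t. vol_density \<rho>0 * exp (y \<bullet> t - (1/2) * (t \<bullet> (H *v t)))"
  have "(\<lambda>k. \<integral>t. ?F k t \<partial>lborel) \<longlonglongrightarrow> (\<integral>t. ?f t \<partial>lborel)"
  proof (rule integral_dominated_convergence)
    show "?f \<in> borel_measurable lborel" by measurable
    show "integrable lborel (\<lambda>t::real^'m. D * exp (K\<^sup>2 / c0) * exp (- (c0 / 4) * (norm t)\<^sup>2))"
      using c0_pos by (intro integrable_mult_right integrable_exp_norm2) auto
    show "AE t in lborel. norm (?F k t) \<le> D * exp (K\<^sup>2 / c0) * exp (- (c0 / 4) * (norm t)\<^sup>2)" for k
      using scaled_integrand_bound[OF _ D(2) K D(1), of "Suc k"] scaled_integrand_nonneg[of "Suc k" "Y (Suc k)"]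
      by (intro AE_I2) auto
    show "AE t in lborel. (\<lambda>k. ?F k t) \<longlonglongrightarrow> ?f t"
    proof (rule AE_I2)
      fix t :: "real^'m"
      let ?s = "\<lambda>k. (1 / sqrt (real k)) *\<^sub>R t"
      have "?s \<longlonglongrightarrow> 0 *\<^sub>R t"
        by (intro tendsto_scaleR tendsto_const tendsto_divide_0[OF tendsto_const] filterlim_at_top_imp_at_infinity
            filterlim_compose[OF sqrt_at_top] filterlim_real_sequentially)
      then have s0: "?s \<longlonglongrightarrow> 0" by simp
      have "(\<lambda>k. \<rho>0 + ?s k) \<longlonglongrightarrow> \<rho>0" using tendsto_add[OF tendsto_const s0, of \<rho>0] by simp
      then have v: "(\<lambda>k. vol_density (\<rho>0 + ?s k)) \<longlonglongrightarrow> vol_density \<rho>0"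
        using continuous_on_tendsto_compose[OF continuous_vol_density] by simp
      have "(\<lambda>k. vol_density (\<rho>0 + ?s k) * exp (Y k \<bullet> t - real k * G (?s k))) \<longlonglongrightarrow> ?f t"
        by (intro tendsto_intros v y G_scaled_limit)
      moreover have "eventually (\<lambda>k. vol_density (\<rho>0 + ?s k) * exp (Y k \<bullet> t - real k * G (?s k)) = scaled_integrand k (Y k) t) sequentially"
      proof -
        have "eventually (\<lambda>k. dist (?s k) 0 < 1) sequentially" using s0 by (rule tendstoD) simp
        then show ?thesis
          by eventually_elim (simp add: scaled_integrand_def)
      qed
      ultimately have "(\<lambda>k. scaled_integrand k (Y k) t) \<longlonglongrightarrow> ?f t" by (rule Lim_transform_eventually)
      then show "(\<lambda>k. ?F k t) \<longlonglongrightarrow> ?f t" by (rule LIMSEQ_Suc)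
    qed
  qed simp
  also have "(\<integral>t. ?f t \<partial>lborel) = laplace_const * exp ((1/2) * (y \<bullet> (matrix_inv H *v y)))"
    by (simp only: integral_mult_right_zero gaussian_laplace_transform(2)[OF pos_def_hessian] laplace_const_def)
      (simp add: mult_ac)
  finally have "(\<lambda>k. sqrt (real (Suc k)) ^ CARD('m) * local_int (Suc k) (Y (Suc k))) \<longlonglongrightarrow>
      laplace_const * exp ((1/2) * (y \<bullet> (matrix_inv H *v y)))"
    by (simp only: local_int_scaled zero_less_Suc)
  then show ?thesis by (rule LIMSEQ_imp_Suc)
qed

text \<open>This becomes the domination of the lattice sums, so it must hold up to |y| = R sqrt k,
  where the maximum of the exponent may lie outside the unit ball. Only a ball of radius 1/2 around
  t = e y is kept: for small e the gain e |y|^2 of the linear term beats the quadratic loss A/2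
  |t|^2.\<close>

lemma local_int_lower:
  assumes R: "R > 0"
  shows "\<exists>C>0. \<exists>c>0. \<forall>k\<ge>1. \<forall>y. norm y \<le> R * sqrt (real k) \<longrightarrow>
    C * exp (c * (norm y)\<^sup>2) \<le> sqrt (real k) ^ CARD('m) * local_int k y"
proof -
  obtain d where d: "0 < d" "\<And>x. x \<in> cball \<rho>0 1 \<Longrightarrow> d \<le> vol_density x"
    using vol_density_bounds by blast
  obtain A where A: "A > 0" "\<And>s. norm s \<le> 1 \<Longrightarrow> G s \<le> A / 2 * (norm s)\<^sup>2"
    using G_upper by blast
  \<comment> \<open>e R \<le> 1/2 keeps the small ball inside |t| \<le> sqrt k, and A e \<le> 1/2
    limits the y-dependent part of the quadratic loss to half of the gain.\<close>
  define e where "e = min (1 / (2 * R)) (1 / (2 * A))"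
  have e: "e > 0" "e * R \<le> 1/2" "A * e \<le> 1/2"
    using R A(1) by (auto simp: e_def min_def field_simps)
  \<comment> \<open>The losses independent of y: A/4 from the radius 1/2 of the ball, and 1/(4 e)
    from bounding y . u by e/4 |y|^2 plus a constant. Of the gain e |y|^2 there remains e/4
    |y|^2.\<close>
  define b where "b = exp (- A / 4 - 1 / (4 * e))"
  define v where "v = measure lborel (ball (0::real^'m) (1/2))"
  have v: "v > 0" unfolding v_def by (rule content_ball_pos) simp
  have "d * b * v * exp (e / 4 * (norm y)\<^sup>2) \<le> sqrt (real k) ^ CARD('m) * local_int k y"
    if k: "k \<ge> 1" and y: "norm y \<le> R * sqrt (real k)" for k y
  proof -
    have sk: "sqrt (real k) \<ge> 1" using k by simp
    let ?B = "ball (e *\<^sub>R y) (1/2)"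
    have low: "d * b * exp (e / 4 * (norm y)\<^sup>2) * indicator ?B t \<le> scaled_integrand k y t" for t
    proof (cases "t \<in> ?B")
      case True
      define u where "u = t - e *\<^sub>R y"
      have t: "t = e *\<^sub>R y + u" and u: "norm u \<le> 1/2" using True by (auto simp: u_def dist_norm norm_minus_commute)
      let ?s = "(1 / sqrt (real k)) *\<^sub>R t"
      have nt: "norm t \<le> e * norm y + norm u" unfolding t using norm_triangle_ineq[of "e *\<^sub>R y" u] e by simp
      also have "\<dots> \<le> e * (R * sqrt (real k)) + 1/2 * sqrt (real k)"
      proof (rule add_mono)
        show "e * norm y \<le> e * (R * sqrt (real k))" using y e by (intro mult_left_mono) auto
        show "norm u \<le> 1/2 * sqrt (real k)" using u sk by linarith
      qed
      also have "\<dots> \<le> sqrt (real k)"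
      proof -
        have "e * R * sqrt (real k) \<le> 1/2 * sqrt (real k)" by (intro mult_right_mono e(2)) simp
        then show ?thesis by (simp only: mult.assoc)
      qed
      finally have s1: "norm ?s \<le> 1" using sk by (simp add: field_simps)
      have "real k * G ?s \<le> real k * (A / 2 * (norm ?s)\<^sup>2)" using A(2)[OF s1] by (intro mult_left_mono) auto
      also have "\<dots> = A / 2 * (norm t)\<^sup>2" unfolding norm_scaled using k by simp
      also have "\<dots> \<le> A / 2 * (2 * (e * norm y)\<^sup>2 + 2 * (norm u)\<^sup>2)"
      proof -
        have "(norm t)\<^sup>2 \<le> (e * norm y + norm u)\<^sup>2"
          using norm_triangle_ineq[of "e *\<^sub>R y" u] e unfolding t by (intro power_mono) auto
        also have "\<dots> \<le> 2 * (e * norm y)\<^sup>2 + 2 * (norm u)\<^sup>2"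
          using sum_squares_bound[of "e * norm y" "norm u"] by (simp add: power2_eq_square algebra_simps)
        finally show ?thesis using A(1) by (intro mult_left_mono) auto
      qed
      also have "\<dots> \<le> e / 2 * (norm y)\<^sup>2 + A / 4"
      proof -
        have "(norm u)\<^sup>2 \<le> (1/2)\<^sup>2" using u by (intro power_mono) auto
        then have 1: "A * (norm u)\<^sup>2 \<le> A * (1/4)" using A(1) by (intro mult_left_mono) (auto simp: power2_eq_square)
        have "(A * e) * (e * (norm y)\<^sup>2) \<le> 1/2 * (e * (norm y)\<^sup>2)" using e by (intro mult_right_mono) auto
        then have "A * (e * norm y)\<^sup>2 \<le> e / 2 * (norm y)\<^sup>2" by (simp add: power2_eq_square mult_ac)
        with 1 show ?thesis by (simp add: algebra_simps)
      qed
      finally have g: "real k * G ?s \<le> e / 2 * (norm y)\<^sup>2 + A / 4" .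
      have "\<bar>y \<bullet> u\<bar> \<le> norm y * norm u" by (rule Cauchy_Schwarz_ineq2)
      also have "\<dots> \<le> norm y * (1/2)" using u by (intro mult_left_mono) auto
      also have "\<dots> \<le> e / 4 * (norm y)\<^sup>2 + 1 / (4 * e)"
      proof -
        have "0 \<le> (sqrt e / 2 * norm y - 1 / (2 * sqrt e))\<^sup>2" by simp
        also have "\<dots> = e / 4 * (norm y)\<^sup>2 + 1 / (4 * e) - norm y * (1/2)"
          using e by (simp add: power2_diff power_divide power_mult_distrib)
        finally show ?thesis by simp
      qed
      finally have "y \<bullet> u \<ge> - (e / 4 * (norm y)\<^sup>2 + 1 / (4 * e))" by linarith
      then have "y \<bullet> t \<ge> e * (norm y)\<^sup>2 - (e / 4 * (norm y)\<^sup>2 + 1 / (4 * e))"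
        unfolding t by (simp add: inner_add_right power2_norm_eq_inner)
      then have "e / 4 * (norm y)\<^sup>2 + (- A / 4 - 1 / (4 * e)) \<le> y \<bullet> t - real k * G ?s" using g by (simp add: field_simps)
      then have "exp (e / 4 * (norm y)\<^sup>2) * b \<le> exp (y \<bullet> t - real k * G ?s)"
        unfolding b_def exp_add[symmetric] by simp
      moreover have "d \<le> vol_density (\<rho>0 + ?s)" using s1 by (intro d(2)) (simp add: dist_norm)
      ultimately have "d * (exp (e / 4 * (norm y)\<^sup>2) * b) \<le> vol_density (\<rho>0 + ?s) * exp (y \<bullet> t - real k * G ?s)"
        using d(1) by (intro mult_mono) (auto simp: b_def)
      then show ?thesis using True s1 by (simp add: scaled_integrand_def mult_ac)
    qed (use scaled_integrand_nonneg in auto)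
    have "measure lborel ?B = v" unfolding v_def by (simp add: content_ball)
    then have "d * b * v * exp (e / 4 * (norm y)\<^sup>2) = (\<integral>t. d * b * exp (e / 4 * (norm y)\<^sup>2) * indicator ?B t \<partial>lborel)"
      by (simp add: mult_ac)
    also have "\<dots> \<le> (\<integral>t. scaled_integrand k y t \<partial>lborel)"
      using k by (intro integral_mono low integrable_scaled_integrand integrable_mult_right integrable_real_indicator)
        (use emeasure_lborel_ball_finite[of "e *\<^sub>R y" "1/2"] in auto)
    also have "\<dots> = sqrt (real k) ^ CARD('m) * local_int k y" using k by (intro local_int_scaled[symmetric]) auto
    finally show ?thesis .
  qed
  moreover have "d * b * v > 0" using d v by (simp add: b_def)
  moreover have "e / 4 > 0" using e by simp
  ultimately show ?thesis by blast
qed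

text \<open>For |s| \<ge> 1 linear growth gives k G s \<ge> c0/2 k |s|, twice the largest value that
  the condition on y allows for the linear term.\<close>

lemma far_bound:
  assumes "norm y \<le> c0 / 4 * sqrt (real k)" "norm s \<ge> 1"
  shows "exp (sqrt (real k) * (y \<bullet> s) - real k * G s) \<le> exp (- (c0 / 4 * real k))"
proof -
  have "sqrt (real k) * (y \<bullet> s) \<le> sqrt (real k) * (c0 / 4 * sqrt (real k) * norm s)"
    using norm_cauchy_schwarz[of y s] mult_right_mono[OF assms(1), of "norm s"] by (intro mult_left_mono) auto
  also have "\<dots> = (sqrt (real k) * sqrt (real k)) * (c0 / 4 * norm s)" by (simp only: mult_ac)
  also have "\<dots> = c0 / 4 * real k * norm s" by simp
  finally have 1: "sqrt (real k) * (y \<bullet> s) \<le> c0 / 4 * real k * norm s" .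
  have "real k * (c0 / 2 * norm s) \<le> real k * G s" using G_lower(2)[OF assms(2)] by (intro mult_left_mono) auto
  then have 2: "2 * (c0 / 4 * real k * norm s) \<le> real k * G s" by (simp add: mult_ac)
  have "c0 / 4 * real k * 1 \<le> c0 / 4 * real k * norm s"
    using assms(2) c0_pos by (intro mult_left_mono) auto
  then have "sqrt (real k) * (y \<bullet> s) - real k * G s \<le> - (c0 / 4 * real k)" using 1 2 by linarith
  then show ?thesis by simp
qed

lemma power_exp_tendsto_0:
  assumes "c > 0"
  shows "(\<lambda>k. sqrt (real k) ^ n * exp (- (c * real k))) \<longlonglongrightarrow> 0"
proof (rule Lim_null_comparison)
  have "filterlim (\<lambda>k. c * real k) at_top sequentially"
    by (intro filterlim_tendsto_pos_mult_at_top[OF tendsto_const assms] filterlim_real_sequentially)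
  from filterlim_compose[OF tendsto_power_div_exp_0[of n] this]
  have "(\<lambda>k. (1 / c) ^ n * ((c * real k) ^ n / exp (c * real k))) \<longlonglongrightarrow> 0"
    by (rule tendsto_mult_right_zero)
  then show "(\<lambda>k. real k ^ n * exp (- (c * real k))) \<longlonglongrightarrow> 0"
    using assms by (simp add: power_mult_distrib power_divide exp_minus field_simps)
  show "eventually (\<lambda>k. norm (sqrt (real k) ^ n * exp (- (c * real k))) \<le> real k ^ n * exp (- (c * real k))) sequentially"
    using eventually_ge_at_top[of 1]
  proof eventually_elim
    case (elim k)
    have "sqrt (real k) \<le> sqrt (real k) * sqrt (real k)" using elim by (intro mult_le_cancel_left1[THEN iffD2]) auto
    then have "sqrt (real k) ^ n \<le> real k ^ n" using elim by (intro power_mono) auto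
    then show ?case using elim by simp
  qed
qed

text \<open>In the application \<open>J k \<alpha>\<close> is the quotient of \<open>\<parallel>s\<^sub>\<alpha>\<parallel>\<^sup>2\<close> and of the pointwise norm of
  \<open>s\<^sub>\<alpha>\<close> at the point under consideration.\<close>

lemma weighted_lattice_limit:
  fixes J :: "nat \<Rightarrow> int^'m \<Rightarrow> real" and P :: "(real^'m) set" and f :: "real^'m \<Rightarrow> real"
  assumes S_def: "\<And>k. S k = {\<alpha>. real_vec \<alpha> \<in> (\<lambda>x. real k *\<^sub>R x) ` P}"
    and fin: "\<And>k. finite (S k)" and P: "bounded P" "x0 \<in> interior P" and V: "V \<ge> 0"
    and lower: "\<And>k \<alpha>. k \<ge> 1 \<Longrightarrow> \<alpha> \<in> S k \<Longrightarrow> local_int k (rescaled x0 k \<alpha>) \<le> J k \<alpha>"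
    and upper: "\<And>k \<alpha> B. k \<ge> 1 \<Longrightarrow> \<alpha> \<in> S k \<Longrightarrow> B \<ge> 0 \<Longrightarrow>
      (\<And>s. norm s \<ge> 1 \<Longrightarrow> exp (sqrt (real k) * (rescaled x0 k \<alpha> \<bullet> s) - real k * G s) \<le> B) \<Longrightarrow>
      J k \<alpha> \<le> local_int k (rescaled x0 k \<alpha>) + V * B"
    and f: "continuous_on UNIV f" "bounded (range f)"
  shows "(\<lambda>k. (1 / sqrt (real k)) ^ CARD('m) * (\<Sum>\<alpha>\<in>S k. f (rescaled x0 k \<alpha>) / (sqrt (real k) ^ CARD('m) * J k \<alpha>)))
    \<longlonglongrightarrow> (\<integral>y. f y * exp (- (1/2) * (y \<bullet> (matrix_inv H *v y))) \<partial>lborel) / laplace_const"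
proof -
  obtain R1 where R1: "\<And>x. x \<in> P \<Longrightarrow> norm x \<le> R1" using P(1) unfolding bounded_iff by blast
  \<comment> \<open>Bounds |x - x0| on P, so that rescaled lattice points satisfy |y| \<le> R sqrt
    k; the +1 makes it positive.\<close>
  define R where "R = \<bar>R1\<bar> + norm x0 + 1"
  have R: "R > 0" using norm_ge_zero[of x0] by (simp add: R_def add_nonneg_pos)
  have y_bound: "norm (rescaled x0 k \<alpha>) \<le> R * sqrt (real k)" if k: "k \<ge> 1" and \<alpha>: "\<alpha> \<in> S k" for k \<alpha>
  proof -
    obtain x where x: "x \<in> P" "real_vec \<alpha> = real k *\<^sub>R x" using \<alpha> by (auto simp: S_def)
    have "rescaled x0 k \<alpha> = sqrt (real k) *\<^sub>R (x - x0)" using k by (simp add: rescaled_def x(2))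
    moreover have "norm (x - x0) \<le> R" using R1[OF x(1)] norm_triangle_ineq4[of x x0] by (simp add: R_def)
    ultimately show ?thesis using mult_right_mono[of "norm (x - x0)" R "sqrt (real k)"]
      by (simp add: mult.commute)
  qed
  obtain C c where Cc: "C > 0" "c > 0" "\<And>k y. k \<ge> 1 \<Longrightarrow> norm y \<le> R * sqrt (real k) \<Longrightarrow>
    C * exp (c * (norm y)\<^sup>2) \<le> sqrt (real k) ^ CARD('m) * local_int k y"
    using local_int_lower[OF R] by blast
  have N: "C * exp (c * (norm (rescaled x0 k \<alpha>))\<^sup>2) \<le> sqrt (real k) ^ CARD('m) * J k \<alpha>"
    if k: "k \<ge> 1" and \<alpha>: "\<alpha> \<in> S k" for k \<alpha>
    using Cc(3)[OF k y_bound[OF k \<alpha>]] mult_left_mono[OF lower[OF k \<alpha>], of "sqrt (real k) ^ CARD('m)"] by auto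
  obtain F where F: "\<And>x. \<bar>f x\<bar> \<le> F" using f(2) unfolding bounded_iff by auto
  have F0: "F \<ge> 0" using F[of 0] by linarith
  let ?g = "\<lambda>y. exp (- (1/2) * (y \<bullet> (matrix_inv H *v y)))"
  have "(\<lambda>k. (1 / sqrt (real k)) ^ CARD('m) * (\<Sum>\<alpha>\<in>S k. f (rescaled x0 k \<alpha>) / (sqrt (real k) ^ CARD('m) * J k \<alpha>)))
    \<longlonglongrightarrow> (\<integral>y. f y * ?g y / laplace_const \<partial>lborel)"
  proof (rule lattice_sum_converges[OF fin Cc(2)])
    fix k \<alpha> assume k: "1 \<le> k" and \<alpha>: "\<alpha> \<in> S k"
    let ?E = "exp (c * (norm (rescaled x0 k \<alpha>))\<^sup>2)"
    have p: "C * ?E > 0" using Cc by simp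
    have "\<bar>f (rescaled x0 k \<alpha>) / (sqrt (real k) ^ CARD('m) * J k \<alpha>)\<bar> = \<bar>f (rescaled x0 k \<alpha>)\<bar> / (sqrt (real k) ^ CARD('m) * J k \<alpha>)"
      using N[OF k \<alpha>] p by (simp add: abs_divide)
    also have "\<dots> \<le> F / (C * ?E)"
      using N[OF k \<alpha>] p F F0 by (intro frac_le) auto
    finally show "\<bar>f (rescaled x0 k \<alpha>) / (sqrt (real k) ^ CARD('m) * J k \<alpha>)\<bar> \<le> F / C * exp (- c * (norm (rescaled x0 k \<alpha>))\<^sup>2)"
      by (simp add: exp_minus field_simps)
  next
    fix y A assume y: "(\<lambda>k. rescaled x0 k (A k)) \<longlonglongrightarrow> y"
    \<comment> \<open>The point rebuilt here is \<open>A k\<close> divided by k. It tends to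
      \<open>x0\<close>, an interior point of P, so every lattice sequence with convergent rescaling
      is eventually admissible.\<close>
    have "(\<lambda>k. x0 + (1 / sqrt (real k)) *\<^sub>R rescaled x0 k (A k)) \<longlonglongrightarrow> x0 + 0 *\<^sub>R y"
      by (intro tendsto_intros y tendsto_divide_0[OF tendsto_const] filterlim_at_top_imp_at_infinity
          filterlim_compose[OF sqrt_at_top] filterlim_real_sequentially)
    then have "eventually (\<lambda>k. x0 + (1 / sqrt (real k)) *\<^sub>R rescaled x0 k (A k) \<in> interior P) sequentially"
      using P(2) by (intro topological_tendstoD) auto
    then have ev: "eventually (\<lambda>k. A k \<in> S k) sequentially"
      using eventually_ge_at_top[of 1]
    proof eventually_elim
      case (elim k)
      have "x0 + (1 / sqrt (real k)) *\<^sub>R rescaled x0 k (A k) = (1 / real k) *\<^sub>R real_vec (A k)"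
        using elim(2) by (simp add: rescaled_def)
      then have "(1 / real k) *\<^sub>R real_vec (A k) \<in> P" using elim(1) interior_subset by auto
      then show ?case using elim(2) unfolding S_def
        by (auto intro!: image_eqI[of _ _ "(1 / real k) *\<^sub>R real_vec (A k)"])
    qed
    let ?l = "\<lambda>k. sqrt (real k) ^ CARD('m) * local_int k (rescaled x0 k (A k))"
    let ?L = "laplace_const * exp ((1/2) * (y \<bullet> (matrix_inv H *v y)))"
    have l: "?l \<longlonglongrightarrow> ?L" by (rule local_int_limit[OF y])
    obtain K where K: "\<And>k. norm (rescaled x0 k (A k)) \<le> K"
      using convergent_imp_Bseq[of "\<lambda>k. rescaled x0 k (A k)"] y by (auto simp: convergent_def Bseq_def)
    have "filterlim (\<lambda>k. c0 / 4 * sqrt (real k)) at_top sequentially"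
      using c0_pos by (intro filterlim_tendsto_pos_mult_at_top[OF tendsto_const]
          filterlim_compose[OF sqrt_at_top] filterlim_real_sequentially) auto
    then have evK: "eventually (\<lambda>k. K \<le> c0 / 4 * sqrt (real k)) sequentially"
      by (simp add: filterlim_at_top)
    \<comment> \<open>The excess of \<open>J\<close> over the local integral is eventually at most V
      exp (- c0 k / 4), which stays negligible after multiplication by k^(m/2).\<close>
    have NL: "(\<lambda>k. sqrt (real k) ^ CARD('m) * J k (A k)) \<longlonglongrightarrow> ?L"
    proof (rule tendsto_sandwich[OF _ _ l])
      show "eventually (\<lambda>k. ?l k \<le> sqrt (real k) ^ CARD('m) * J k (A k)) sequentially"
        using ev eventually_ge_at_top[of 1] by eventually_elim (intro mult_left_mono lower, auto)
      show "eventually (\<lambda>k. sqrt (real k) ^ CARD('m) * J k (A k) \<le>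
          ?l k + V * (sqrt (real k) ^ CARD('m) * exp (- (c0 / 4 * real k)))) sequentially"
        using ev eventually_ge_at_top[of 1] evK
      proof eventually_elim
        case (elim k)
        have "J k (A k) \<le> local_int k (rescaled x0 k (A k)) + V * exp (- (c0 / 4 * real k))"
          using K[of k] elim by (intro upper far_bound) auto
        then have "sqrt (real k) ^ CARD('m) * J k (A k) \<le>
            sqrt (real k) ^ CARD('m) * (local_int k (rescaled x0 k (A k)) + V * exp (- (c0 / 4 * real k)))"
          by (intro mult_left_mono) auto
        then show ?case by (simp add: algebra_simps)
      qed
      have "(\<lambda>k. ?l k + V * (sqrt (real k) ^ CARD('m) * exp (- (c0 / 4 * real k)))) \<longlonglongrightarrow> ?L + V * 0"
        using c0_pos by (intro tendsto_intros l power_exp_tendsto_0) auto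
      then show "(\<lambda>k. ?l k + V * (sqrt (real k) ^ CARD('m) * exp (- (c0 / 4 * real k)))) \<longlonglongrightarrow> ?L" by simp
    qed
    have "isCont f y" using f(1) by (simp add: continuous_on_eq_continuous_at)
    then have "(\<lambda>k. f (rescaled x0 k (A k))) \<longlonglongrightarrow> f y" using y by (rule isCont_tendsto_compose)
    then have "(\<lambda>k. f (rescaled x0 k (A k)) / (sqrt (real k) ^ CARD('m) * J k (A k))) \<longlonglongrightarrow> f y / ?L"
      using laplace_const_pos by (intro tendsto_divide NL) auto
    also have "f y / ?L = f y * ?g y / laplace_const" by (simp add: exp_minus field_simps)
    finally show "eventually (\<lambda>k. A k \<in> S k) sequentially \<and>
        (\<lambda>k. f (rescaled x0 k (A k)) / (sqrt (real k) ^ CARD('m) * J k (A k))) \<longlonglongrightarrow> f y * ?g y / laplace_const"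
      using ev by blast
  qed
  then show ?thesis by simp
qed

text \<open>The previous limit for f, divided by the one for the constant 1. The powers of k and
  \<open>laplace_const\<close> cancel.\<close>

lemma normalized_lattice_limit:
  fixes J :: "nat \<Rightarrow> int^'m \<Rightarrow> real" and P :: "(real^'m) set" and f :: "real^'m \<Rightarrow> real"
  assumes S_def: "\<And>k. S k = {\<alpha>. real_vec \<alpha> \<in> (\<lambda>x. real k *\<^sub>R x) ` P}"
    and fin: "\<And>k. finite (S k)" and P: "bounded P" "x0 \<in> interior P" and V: "V \<ge> 0"
    and lower: "\<And>k \<alpha>. k \<ge> 1 \<Longrightarrow> \<alpha> \<in> S k \<Longrightarrow> local_int k (rescaled x0 k \<alpha>) \<le> J k \<alpha>"
    and upper: "\<And>k \<alpha> B. k \<ge> 1 \<Longrightarrow> \<alpha> \<in> S k \<Longrightarrow> B \<ge> 0 \<Longrightarrow>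
      (\<And>s. norm s \<ge> 1 \<Longrightarrow> exp (sqrt (real k) * (rescaled x0 k \<alpha> \<bullet> s) - real k * G s) \<le> B) \<Longrightarrow>
      J k \<alpha> \<le> local_int k (rescaled x0 k \<alpha>) + V * B"
    and f: "continuous_on UNIV f" "bounded (range f)"
  shows "(\<lambda>k. (\<Sum>\<alpha>\<in>S k. f (rescaled x0 k \<alpha>) / J k \<alpha>) / (\<Sum>\<alpha>\<in>S k. 1 / J k \<alpha>)) \<longlonglongrightarrow> (\<integral>x. f x \<partial>gaussian 0 H)"
proof -
  let ?N = "\<lambda>k. sqrt (real k) ^ CARD('m)"
  let ?A = "\<lambda>f k. (1 / sqrt (real k)) ^ CARD('m) * (\<Sum>\<alpha>\<in>S k. f (rescaled x0 k \<alpha>) / (?N k * J k \<alpha>))"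
  let ?g = "\<lambda>y. exp (- (1/2) * (y \<bullet> (matrix_inv H *v y)))"
  note lim = weighted_lattice_limit[where P = P and J = J, OF S_def fin P V lower upper]
  have 1: "?A f \<longlonglongrightarrow> (\<integral>y. f y * ?g y \<partial>lborel) / laplace_const"
    by (rule lim) (use f in auto)
  have 2: "?A (\<lambda>_. 1) \<longlonglongrightarrow> (\<integral>y. 1 * ?g y \<partial>lborel) / laplace_const"
    by (rule lim) auto
  have gpos: "(\<integral>y. ?g y \<partial>lborel) > 0"
    unfolding gaussian_integral(2)[OF pos_def_matrix_inv(3)[OF pos_def_hessian]]
    using pos_def_det_pos[OF pos_def_matrix_inv(3)[OF pos_def_hessian], of \<rho>0] by simp
  have l: "(\<lambda>k. ?A f k / ?A (\<lambda>_. 1) k) \<longlonglongrightarrow>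
      ((\<integral>y. f y * ?g y \<partial>lborel) / laplace_const) / ((\<integral>y. 1 * ?g y \<partial>lborel) / laplace_const)"
    using gpos laplace_const_pos by (intro tendsto_divide 1 2) auto
  have "((\<integral>y. f y * ?g y \<partial>lborel) / laplace_const) / ((\<integral>y. 1 * ?g y \<partial>lborel) / laplace_const) =
      (\<integral>x. f x \<partial>gaussian 0 H)"
    using laplace_const_pos by (subst integral_gaussian[OF pos_def_hessian borel_measurable_continuous_onI[OF f(1)]]) simp
  from l[unfolded this] show ?thesis
  proof (rule Lim_transform_eventually)
    show "eventually (\<lambda>k. ?A f k / ?A (\<lambda>_. 1) k = (\<Sum>\<alpha>\<in>S k. f (rescaled x0 k \<alpha>) / J k \<alpha>) / (\<Sum>\<alpha>\<in>S k. 1 / J k \<alpha>)) sequentially"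
      using eventually_gt_at_top[of 0]
    proof eventually_elim
      case (elim k)
      have E: "?A h k = (1 / sqrt (real k)) ^ CARD('m) / ?N k * (\<Sum>\<alpha>\<in>S k. h (rescaled x0 k \<alpha>) / J k \<alpha>)" for h
        unfolding sum_distrib_left by (rule sum.cong[OF refl]) simp
      have nz: "(1 / sqrt (real k)) ^ CARD('m) / ?N k \<noteq> 0" using elim by simp
      show ?case unfolding E[of f] E[of "\<lambda>_. 1"] by (rule mult_divide_mult_cancel_left[OF nz])
    qed
  qed
qed

end

section \<open>Charts and the open orbit\<close>

lemma top_chartD:
  assumes "top_chart (U, c)"
  shows "open U" "open (c ` U)" "homeomorphism U (c ` U) c (inv_into U c)"
  using assms by (auto simp: top_chart_def)

lemma top_chart_inv: "top_chart (U, c) \<Longrightarrow> p \<in> U \<Longrightarrow> inv_into U c (c p) = p"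
  using homeomorphism_apply1[OF top_chartD(3)] by blast

lemma top_chart_open_image:
  assumes "top_chart (U, c)" "open W" shows "open (c ` (U \<inter> W))"
proof -
  have "openin (top_of_set (c ` U)) (c ` (U \<inter> W))"
    by (rule homeomorphism_imp_open_map[OF top_chartD(3)[OF assms(1)]])
      (use assms(2) in \<open>simp add: openin_open_Int\<close>)
  then show ?thesis using top_chartD(2)[OF assms(1)] openin_open_eq by blast
qed

lemma holo_compose_holo_map:
  fixes g :: "complex^'n::finite \<Rightarrow> complex^'m::finite"
  assumes g: "holo_map S g" and f: "holo T f" and gS: "g ` S \<subseteq> T"
  shows "holo S (\<lambda>w. f (g w))"
  unfolding holo_def
proof
  fix w assume w: "w \<in> S"
  then have gw: "g w \<in> T" using gS by auto
  let ?D = "\<lambda>v. \<chi> a. \<Sum>j\<in>UNIV. wirt j (\<lambda>w. g w $ a) w * v $ j"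
  have d: "((\<lambda>w. f (g w)) has_derivative (\<lambda>v. frechet_derivative f (at (g w)) (?D v))) (at w)"
    by (rule has_derivative_compose[where g = f, OF holo_map_has_derivative[OF g w] holo_has_derivative(1)[OF f gw]])
  have "?D (c *s v) = c *s ?D v" for c v
    by (simp add: vec_eq_iff sum_distrib_left mult_ac)
  then show "\<exists>D. ((\<lambda>w. f (g w)) has_derivative D) (at w) \<and> (\<forall>c v. D (c *s v) = c * D v)"
    using d holo_has_derivative(2)[OF f gw] by (intro exI[of _ "\<lambda>v. frechet_derivative f (at (g w)) (?D v)"]) simp
qed

lemma holo_cong:
  assumes "open S" "holo S f" "\<And>w. w \<in> S \<Longrightarrow> f w = g w"
  shows "holo S g"
  unfolding holo_def
proof
  fix w assume w: "w \<in> S"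
  show "\<exists>D. (g has_derivative D) (at w) \<and> (\<forall>c v. D (c *s v) = c * D v)"
    using has_derivative_transform_within_open[OF holo_has_derivative(1)[OF assms(2) w] assms(1) w assms(3)]
      holo_has_derivative(2)[OF assms(2) w] by blast
qed

lemma holo_local: "(\<And>w. w \<in> S \<Longrightarrow> \<exists>T. w \<in> T \<and> holo T f) \<Longrightarrow> holo S f"
  unfolding holo_def by blast

lemma holo_subset: "holo S f \<Longrightarrow> T \<subseteq> S \<Longrightarrow> holo T f"
  unfolding holo_def by blast

locale toric_kaehler =
  fixes X :: "('a::t2_space, 'i, 'm::finite) toric_data"
  assumes ptk: "polarized_toric_kaehler X"
begin

lemma
  shows complex_manifold: "complex_manifold X" and compact: "compact (UNIV :: 'a set)"
    and holo_action: "holo_action X" and open_dense_orbit: "open_dense_orbit X"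
    and line_bundle: "line_bundle X" and ample: "ample X"
    and invariant_frame: "invariant_frame X" and associated_polytope: "associated_polytope X"
    and positive_metric: "positive_metric X" and invariant_metric: "invariant_metric X"
    and liouville_measure: "liouville_measure X"
  using ptk by (auto simp: polarized_toric_kaehler_def)

text \<open>The inverse of \<open>zcoord\<close> on the torus, written through the action so that
  the action laws apply to it.\<close>

definition pt :: "complex^'m \<Rightarrow> 'a" where
  "pt w = act X w (base X)"

lemma atlas_chart: "C \<in> atlas X \<Longrightarrow> holo_chart X C"
  using complex_manifold by (simp add: complex_manifold_def)

lemma atlas_top_chart: "C \<in> atlas X \<Longrightarrow> top_chart C"
  using atlas_chart by (simp add: holo_chart_def)

lemma atlas_cover: "\<exists>U c. (U, c) \<in> atlas X \<and> p \<in> U"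
proof -
  have "p \<in> (\<Union>C\<in>atlas X. fst C)" using complex_manifold by (simp add: complex_manifold_def)
  then show ?thesis by auto
qed

lemma orbit_chart: "holo_chart X (orbit X, zcoord X)" "top_chart (orbit X, zcoord X)"
  using open_dense_orbit by (auto simp: open_dense_orbit_def holo_chart_def)

lemma open_orbit: "open (orbit X)"
  using open_dense_orbit by (simp add: open_dense_orbit_def)

lemma dense_orbit: "closure (orbit X) = UNIV"
  using open_dense_orbit by (simp add: open_dense_orbit_def)

lemma orbit_eq: "orbit X = pt ` ctorus"
  by (simp add: orbit_def pt_def)

lemma pt_in_orbit: "w \<in> ctorus \<Longrightarrow> pt w \<in> orbit X"
  by (simp add: orbit_eq)

lemma zcoord_pt: "w \<in> ctorus \<Longrightarrow> zcoord X (pt w) = w"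
  using open_dense_orbit inv_into_f_f[of "\<lambda>t. act X t (base X)" ctorus w]
  by (simp add: open_dense_orbit_def zcoord_def pt_def)

lemma pt_zcoord: "p \<in> orbit X \<Longrightarrow> pt (zcoord X p) = p"
  by (auto simp: orbit_eq zcoord_pt)

lemma zcoord_in_ctorus: "p \<in> orbit X \<Longrightarrow> zcoord X p \<in> ctorus"
  by (auto simp: orbit_eq zcoord_pt)

lemma inv_zcoord: "w \<in> ctorus \<Longrightarrow> inv_into (orbit X) (zcoord X) w = pt w"
  using top_chart_inv[OF orbit_chart(2) pt_in_orbit] zcoord_pt by metis

lemma zcoord_image: "zcoord X ` (orbit X \<inter> W) = {w \<in> ctorus. pt w \<in> W}"
proof safe
  fix w assume "w \<in> ctorus" "pt w \<in> W"
  then show "w \<in> zcoord X ` (orbit X \<inter> W)"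
    by (intro image_eqI[of _ _ "pt w"]) (auto simp: zcoord_pt pt_in_orbit)
qed (auto simp: pt_zcoord zcoord_in_ctorus)

lemma open_ctorus: "open (ctorus :: (complex^'m) set)"
  using top_chartD(2)[OF orbit_chart(2)] zcoord_image[of UNIV] by simp

lemma open_pt_preimage: "open W \<Longrightarrow> open {w \<in> ctorus. pt w \<in> W}"
  using top_chart_open_image[OF orbit_chart(2)] by (simp add: zcoord_image)

lemma continuous_zcoord: "continuous_on (orbit X) (zcoord X)"
  using homeomorphism_cont1[OF top_chartD(3)[OF orbit_chart(2)]] .

lemma continuous_pt: "continuous_on ctorus pt"
proof -
  have "continuous_on (zcoord X ` orbit X) (inv_into (orbit X) (zcoord X))"
    using homeomorphism_cont2[OF top_chartD(3)[OF orbit_chart(2)]] .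
  then have "continuous_on ctorus (inv_into (orbit X) (zcoord X))"
    using zcoord_image[of UNIV] by simp
  then show ?thesis by (rule continuous_on_eq) (rule inv_zcoord)
qed

lemma transition_holo_map:
  assumes "(U, c) \<in> atlas X"
  shows "holo_map {w \<in> ctorus. pt w \<in> U} (\<lambda>w. c (pt w))"
  unfolding holo_map_def
proof
  fix j
  have "holo_transition (orbit X, zcoord X) (U, c)"
    using orbit_chart(1) assms by (auto simp: holo_chart_def)
  then have "holo {w \<in> ctorus. pt w \<in> U} (\<lambda>w. c (inv_into (orbit X) (zcoord X) w) $ j)"
    by (simp add: holo_transition_def zcoord_image)
  then show "holo {w \<in> ctorus. pt w \<in> U} (\<lambda>w. c (pt w) $ j)"
    by (rule holo_cong[OF open_pt_preimage[OF top_chartD(1)[OF atlas_top_chart[OF assms]]]]) (simp add: inv_zcoord)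
qed

lemma inverse_transition_holo_map:
  assumes "(U, c) \<in> atlas X"
  shows "holo_map (c ` (U \<inter> orbit X)) (\<lambda>w. zcoord X (inv_into U c w))"
proof -
  have "holo_transition (U, c) (orbit X, zcoord X)"
    using orbit_chart(1) assms by (auto simp: holo_chart_def)
  then show ?thesis by (simp add: holo_transition_def holo_map_def)
qed

text \<open>Holomorphy on the manifold is tested in the given atlas, to which the orbit chart need
  not belong. It belongs to the maximal atlas, so its transition maps to atlas charts are
  holomorphic and carry the property over locally.\<close>

lemma mholo_orbit:
  assumes W: "open W" and f: "mholo X W f"
  shows "holo {w \<in> ctorus. pt w \<in> W} (\<lambda>w. f (pt w))"
proof (rule holo_local)
  fix w assume w: "w \<in> {w \<in> ctorus. pt w \<in> W}"
  obtain U c where C: "(U, c) \<in> atlas X" "pt w \<in> U" using atlas_cover by blast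
  note t = atlas_top_chart[OF C(1)]
  let ?T = "{w \<in> ctorus. pt w \<in> U \<inter> W}"
  have T: "open ?T" by (intro open_pt_preimage open_Int W top_chartD(1)[OF t])
  have u: "holo (c ` (U \<inter> W)) (\<lambda>w. f (inv_into U c w))"
    using f C(1) by (auto simp: mholo_def)
  have g: "holo_map ?T (\<lambda>w. c (pt w))"
    using transition_holo_map[OF C(1)] by (auto simp: holo_map_def intro: holo_subset)
  have "holo ?T (\<lambda>w. f (inv_into U c (c (pt w))))"
    by (rule holo_compose_holo_map[OF g u]) auto
  then have "holo ?T (\<lambda>w. f (pt w))"
    by (rule holo_cong[OF T]) (simp add: top_chart_inv[OF t])
  then show "\<exists>T. w \<in> T \<and> holo T (\<lambda>w. f (pt w))" using w C(2) by (intro exI[of _ ?T]) simp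
qed

lemma msmooth_orbit:
  assumes W: "open W" and f: "msmooth X W f"
  shows "Cn n {w \<in> ctorus. pt w \<in> W} (\<lambda>w. f (pt w))"
proof (rule Cn_local)
  fix w assume w: "w \<in> {w \<in> ctorus. pt w \<in> W}"
  obtain U c where C: "(U, c) \<in> atlas X" "pt w \<in> U" using atlas_cover by blast
  note t = atlas_top_chart[OF C(1)]
  let ?T = "{w \<in> ctorus. pt w \<in> U \<inter> W}"
  let ?U = "{w \<in> ctorus. pt w \<in> U}"
  have U: "open ?U" by (intro open_pt_preimage top_chartD(1)[OF t])
  have T: "open ?T" by (intro open_pt_preimage open_Int W top_chartD(1)[OF t])
  have u: "Cn n (c ` (U \<inter> W)) (\<lambda>w. f (inv_into U c w))"
    using f C(1) by (auto simp: msmooth_def smooth_def Ck_eq_Cn)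
  have g: "holo_map ?T (\<lambda>w. c (pt w))"
    using transition_holo_map[OF C(1)] by (auto simp: holo_map_def intro: holo_subset)
  have "Cn n ?T (\<lambda>w. f (inv_into U c (c (pt w))))"
    by (rule Cn_compose[OF T top_chart_open_image[OF t W] _ holo_map_Cn[OF T g] u]) auto
  then have "Cn n ?T (\<lambda>w. f (pt w))"
    by (rule Cn_cong[OF T, rotated]) (simp add: top_chart_inv[OF t])
  moreover have "{w \<in> ctorus. pt w \<in> W} \<inter> ?U = ?T" by auto
  ultimately show "\<exists>U. open U \<and> w \<in> U \<and> Cn n ({w \<in> ctorus. pt w \<in> W} \<inter> U) (\<lambda>w. f (pt w))"
    using U w C(2) by (intro exI[of _ ?U]) auto
qed

section \<open>Pointwise norms\<close>

lemma triv_cover: "\<exists>i. p \<in> triv X i"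
  using line_bundle by (auto simp: line_bundle_def)

lemma open_triv: "open (triv X i)"
  using line_bundle by (simp add: line_bundle_def)

lemma hmet_pos: "p \<in> triv X i \<Longrightarrow> hmet X i p > 0"
  using positive_metric unfolding positive_metric_def by blast

text \<open>\<open>hnorm2\<close> picks a trivialization by choice. The k-th power of the transition
  function in the section cancels against that in the metric.\<close>

lemma hnorm2_eq:
  assumes s: "s \<in> sections X k W" and p: "p \<in> W" "p \<in> triv X i"
  shows "hnorm2 X k s p = (norm (s i p))\<^sup>2 * hmet X i p ^ k"
proof -
  define j where "j = (SOME j. p \<in> triv X j)"
  have j: "p \<in> triv X j" unfolding j_def by (rule someI_ex[OF triv_cover])
  have 1: "s i p = trans X i j p ^ k * s j p"
    using s p j unfolding sections_def by blast
  have 2: "hmet X j p = (norm (trans X i j p))\<^sup>2 * hmet X i p"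
    using positive_metric p j unfolding positive_metric_def by blast
  have "(norm (s i p))\<^sup>2 * hmet X i p ^ k = (norm (s j p))\<^sup>2 * hmet X j p ^ k"
    unfolding 1 2 norm_mult norm_power power_mult_distrib power_mult[symmetric]
    by (simp add: mult_ac)
  then show ?thesis unfolding hnorm2_def Let_def j_def[symmetric] by simp
qed

lemma frame_sections: "frame X \<in> sections X 1 (orbit X)"
  using invariant_frame unfolding invariant_frame_def by blast

lemma frame_nonzero: "p \<in> orbit X \<Longrightarrow> p \<in> triv X i \<Longrightarrow> frame X i p \<noteq> 0"
  using invariant_frame unfolding invariant_frame_def by blast

lemma hnorm2_frame:
  assumes "p \<in> orbit X" "p \<in> triv X i"
  shows "hnorm2 X 1 (frame X) p = (norm (frame X i p))\<^sup>2 * hmet X i p"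
  using hnorm2_eq[OF frame_sections assms] by simp

lemma hnorm2_frame_pos: "p \<in> orbit X \<Longrightarrow> hnorm2 X 1 (frame X) p > 0"
  using triv_cover[of p] hnorm2_frame frame_nonzero hmet_pos by fastforce

lemma act_mult:
  "s \<in> ctorus \<Longrightarrow> t \<in> ctorus \<Longrightarrow> act X s (pt t) = pt (s * t)"
  using holo_action by (simp add: holo_action_def pt_def)

lemma rtorus_subset: "(t::complex^'m) \<in> rtorus \<Longrightarrow> t \<in> ctorus"
proof -
  assume "t \<in> rtorus"
  then have "norm (t $ j) = 1" for j by (simp add: rtorus_def)
  then have "t $ j \<noteq> 0" for j by (metis norm_zero zero_neq_one)
  then show "t \<in> ctorus" by (simp add: ctorus_def)
qed

lemma ctorus_mult: "s \<in> ctorus \<Longrightarrow> t \<in> ctorus \<Longrightarrow> s * t \<in> ctorus"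
  by (simp add: ctorus_def)

text \<open>The linearization factor multiplies the coefficient of the invariant frame, and for
  rotations the metric changes by the inverse of its squared modulus.\<close>

lemma hnorm2_frame_invariant:
  assumes t: "t \<in> rtorus" and w: "w \<in> ctorus"
  shows "hnorm2 X 1 (frame X) (pt (t * w)) = hnorm2 X 1 (frame X) (pt w)"
proof -
  obtain i j where i: "pt w \<in> triv X i" and j: "pt (t * w) \<in> triv X j"
    using triv_cover by meson
  note tc = rtorus_subset[OF t]
  have j': "act X t (pt w) \<in> triv X j" using j act_mult[OF tc w] by simp
  have "frame X j (act X t (pt w)) = lin X t i j (pt w) * frame X i (pt w)"
    using invariant_frame tc i j' pt_in_orbit[OF w] unfolding invariant_frame_def by blast
  moreover have "(norm (lin X t i j (pt w)))\<^sup>2 * hmet X j (act X t (pt w)) = hmet X i (pt w)"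
    using invariant_metric t i j' unfolding invariant_metric_def by blast
  moreover note act_mult[OF tc w]
  ultimately show ?thesis
    using hnorm2_frame[OF pt_in_orbit[OF w] i] hnorm2_frame[OF pt_in_orbit[OF ctorus_mult[OF tc w]] j]
    by (simp add: norm_mult power_mult_distrib mult_ac)
qed

lemma cexp_ctorus: "cexp \<zeta> \<in> ctorus"
  by (simp add: ctorus_def)

text \<open>\<open>potential\<close> is defined through the positive real points of the torus.
  Splitting exp \<zeta> into phases and moduli and rotating the phases away extends the formula to
  the whole orbit.\<close>

lemma potential_twice_Re:
  "potential X (twice_Re \<zeta>) = - ln (hnorm2 X 1 (frame X) (pt (cexp \<zeta>)))"
proof -
  let ?r = "(\<chi> j. complex_of_real (exp (Re (\<zeta> $ j)))) :: complex^'m"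
  let ?t = "(\<chi> j. cis (Im (\<zeta> $ j))) :: complex^'m"
  have "cexp \<zeta> = ?t * ?r"
    by (simp add: vec_eq_iff cexp_def exp_eq_polar mult.commute)
  moreover have "?t \<in> rtorus" "?r \<in> ctorus" by (simp_all add: rtorus_def ctorus_def)
  ultimately have "hnorm2 X 1 (frame X) (pt (cexp \<zeta>)) = hnorm2 X 1 (frame X) (pt ?r)"
    using hnorm2_frame_invariant by simp
  then show ?thesis by (simp add: potential_def twice_Re_def pt_def)
qed

lemma hnorm2_frame_rho:
  assumes "p \<in> orbit X"
  shows "hnorm2 X 1 (frame X) p = exp (- potential X (rho X p))"
    and "\<exists>\<zeta>. p = pt (cexp \<zeta>) \<and> rho X p = twice_Re \<zeta>"
proof -
  have "zcoord X p \<in> ctorus" by (rule zcoord_in_ctorus[OF assms])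
  then obtain \<zeta> where z: "cexp \<zeta> = zcoord X p" using cexp_surj by (auto simp: ctorus_def)
  then have p: "p = pt (cexp \<zeta>)" using pt_zcoord[OF assms] by simp
  have r: "rho X p = twice_Re \<zeta>"
    by (simp add: rho_def twice_Re_def z[symmetric] cexp_def vec_eq_iff ln_realpow)
  show "\<exists>\<zeta>. p = pt (cexp \<zeta>) \<and> rho X p = twice_Re \<zeta>" using p r by blast
  show "hnorm2 X 1 (frame X) p = exp (- potential X (rho X p))"
    using hnorm2_frame_pos[OF assms] by (simp add: r potential_twice_Re p[symmetric])
qed

section \<open>The Kaehler potential\<close>

text \<open>The domain of the local frame in the coordinate \<zeta>; \<open>tset\<close> is the same
  domain in the torus coordinate w = exp \<zeta>.\<close>

definition cset :: "'i \<Rightarrow> (complex^'m) set" where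
  "cset i = {\<zeta>. pt (cexp \<zeta>) \<in> triv X i}"

definition tset :: "'i \<Rightarrow> (complex^'m) set" where
  "tset i = {w \<in> ctorus. pt w \<in> triv X i}"

lemma open_tset: "open (tset i)"
  unfolding tset_def by (rule open_pt_preimage[OF open_triv])

lemma continuous_cexp: "continuous_on UNIV cexp"
  using holo_map_Cn[OF open_UNIV holo_map_cexp, of 0] by simp

lemma open_cset: "open (cset i)"
proof -
  have "cset i = cexp -` tset i" by (auto simp: cset_def tset_def cexp_ctorus)
  then show ?thesis using open_vimage[OF open_tset continuous_cexp] by simp
qed

lemma cexp_cset: "cexp ` cset i \<subseteq> tset i"
  by (auto simp: cset_def tset_def cexp_ctorus)

lemma cset_cover: "\<exists>i. \<zeta> \<in> cset i"
  using triv_cover by (simp add: cset_def)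

lemma holo_frame_tset: "holo (tset i) (\<lambda>w. frame X i (pt w))"
proof -
  have "mholo X (orbit X \<inter> triv X i) (frame X i)"
    using frame_sections by (auto simp: sections_def)
  from mholo_orbit[OF open_Int[OF open_orbit open_triv] this]
  show ?thesis by (rule holo_subset) (auto simp: tset_def pt_in_orbit)
qed

lemma holo_frame_cset: "holo (cset i) (\<lambda>\<zeta>. frame X i (pt (cexp \<zeta>)))"
  by (rule holo_compose_holo_map[OF holo_map_cexp holo_frame_tset cexp_cset])

lemma frame_cset_nonzero: "\<zeta> \<in> cset i \<Longrightarrow> frame X i (pt (cexp \<zeta>)) \<noteq> 0"
  by (rule frame_nonzero) (auto simp: cset_def pt_in_orbit cexp_ctorus)

lemma Cn_hmet_tset: "Cn n (tset i) (\<lambda>w. hmet X i (pt w))"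
proof -
  have "msmooth X (triv X i) (hmet X i)" using positive_metric unfolding positive_metric_def by blast
  from msmooth_orbit[OF open_triv this] show ?thesis by (simp add: tset_def)
qed

lemma Cn_weight_tset: "Cn n (tset i) (\<lambda>w. - ln (hmet X i (pt w)))"
  by (intro Cn_minus Cn_ln open_tset Cn_hmet_tset) (auto simp: tset_def hmet_pos)

lemma Cn_weight_cset: "Cn n (cset i) (\<lambda>\<zeta>. - ln (hmet X i (pt (cexp \<zeta>))))"
  by (rule Cn_compose[OF open_cset open_tset cexp_cset holo_map_Cn[OF open_cset holo_map_cexp] Cn_weight_tset])

lemma Cn_ln_frame_cset: "Cn n (cset i) (\<lambda>\<zeta>. ln ((norm (frame X i (pt (cexp \<zeta>))))\<^sup>2))"
  by (intro Cn_ln open_cset Cn_norm2 holo_imp_Cn holo_frame_cset) (simp add: frame_cset_nonzero)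

text \<open>Over the orbit the local weight and the potential differ by a pluriharmonic term. This
  yields both the smoothness of the potential and the equality of the Levi matrices.\<close>

lemma weight_cset:
  assumes "\<zeta> \<in> cset i"
  shows "- ln (hmet X i (pt (cexp \<zeta>))) = potential X (twice_Re \<zeta>) + ln ((norm (frame X i (pt (cexp \<zeta>))))\<^sup>2)"
proof -
  have t: "pt (cexp \<zeta>) \<in> triv X i" using assms by (simp add: cset_def)
  have "ln (hnorm2 X 1 (frame X) (pt (cexp \<zeta>))) = ln ((norm (frame X i (pt (cexp \<zeta>))))\<^sup>2) + ln (hmet X i (pt (cexp \<zeta>)))"
    unfolding hnorm2_frame[OF pt_in_orbit[OF cexp_ctorus] t]
    by (rule ln_mult_pos) (use frame_cset_nonzero[OF assms] hmet_pos[OF t] in auto)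
  then show ?thesis unfolding potential_twice_Re by linarith
qed

lemma Cn_potential_twice_Re: "Cn n UNIV (\<lambda>\<zeta>. potential X (twice_Re \<zeta>))"
proof (rule Cn_local)
  fix \<zeta> :: "complex^'m"
  obtain i where i: "\<zeta> \<in> cset i" using cset_cover by blast
  have "Cn n (cset i) (\<lambda>\<zeta>. - ln (hmet X i (pt (cexp \<zeta>))) + - ln ((norm (frame X i (pt (cexp \<zeta>))))\<^sup>2))"
    by (intro Cn_add Cn_minus[OF _ Cn_ln_frame_cset] Cn_weight_cset open_cset)
  then have "Cn n (cset i) (\<lambda>\<zeta>. potential X (twice_Re \<zeta>))"
    by (rule Cn_cong[OF open_cset, rotated]) (simp add: weight_cset)
  then show "\<exists>U. open U \<and> \<zeta> \<in> U \<and> Cn n (UNIV \<inter> U) (\<lambda>\<zeta>. potential X (twice_Re \<zeta>))"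
    using open_cset i by auto
qed

text \<open>The real slice \<zeta> = \<rho>/2 is a linear right inverse of \<open>twice_Re\<close>
  and transfers smoothness from \<zeta> to \<rho>.\<close>

lemma Cn_potential: "Cn n UNIV (potential X)"
proof -
  let ?h = "\<lambda>\<rho>::real^'m. (\<chi> j. complex_of_real (\<rho> $ j / 2))"
  have "bounded_linear ?h"
    by (rule linear_conv_bounded_linear[THEN iffD1], rule linearI) (auto simp: vec_eq_iff scaleR_conv_of_real[where 'a=complex] add_divide_distrib)
  then have "Cn n UNIV (\<lambda>\<rho>. potential X (twice_Re (?h \<rho>)))"
    by (intro Cn_compose[OF open_UNIV open_UNIV subset_UNIV _ Cn_potential_twice_Re] Cn_bounded_linear open_UNIV)
  moreover have "twice_Re (?h \<rho>) = \<rho>" for \<rho> :: "real^'m" by (simp add: twice_Re_def vec_eq_iff)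
  ultimately show ?thesis by simp
qed

end

section \<open>Curvature and strict convexity of the potential\<close>

context toric_kaehler
begin

abbreviation "\<phi> \<equiv> potential X"

lemma levi_weight_cset:
  assumes "\<zeta> \<in> cset i"
  shows "levi (\<lambda>\<zeta>. - ln (hmet X i (pt (cexp \<zeta>)))) \<zeta> $ j $ k = of_real (hessian \<phi> (twice_Re \<zeta>) $ j $ k)"
proof -
  have "levi (\<lambda>\<zeta>. - ln (hmet X i (pt (cexp \<zeta>)))) \<zeta> =
      levi (\<lambda>\<zeta>. \<phi> (twice_Re \<zeta>) + ln ((norm (frame X i (pt (cexp \<zeta>))))\<^sup>2)) \<zeta>"
    by (rule levi_cong[OF open_cset Cn_weight_cset assms weight_cset])
  also have "\<dots> $ j $ k = levi (\<lambda>\<zeta>. \<phi> (twice_Re \<zeta>)) \<zeta> $ j $ k + levi (\<lambda>\<zeta>. ln ((norm (frame X i (pt (cexp \<zeta>))))\<^sup>2)) \<zeta> $ j $ k"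
    by (rule levi_add[OF open_cset Cn_subset[OF Cn_potential_twice_Re subset_UNIV] Cn_ln_frame_cset assms])
  also have "\<dots> = of_real (hessian \<phi> (twice_Re \<zeta>) $ j $ k)"
    using levi_ln_norm2_holo[OF open_cset holo_frame_cset frame_cset_nonzero assms]
    by (simp add: levi_twice_Re[OF Cn_potential])
  finally show ?thesis .
qed

text \<open>The Jacobian of \<open>cexp\<close> is diagonal, so the transformation law of the Levi
  matrix has a single term.\<close>

lemma levi_weight_tset:
  assumes "\<zeta> \<in> cset i"
  shows "levi (\<lambda>w. - ln (hmet X i (pt w))) (cexp \<zeta>) $ j $ k * (cexp \<zeta> $ j * cnj (cexp \<zeta> $ k)) =
    of_real (hessian \<phi> (twice_Re \<zeta>) $ j $ k)"
proof -
  let ?L = "levi (\<lambda>w. - ln (hmet X i (pt w))) (cexp \<zeta>)"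
  have "of_real (hessian \<phi> (twice_Re \<zeta>) $ j $ k) = (\<Sum>a\<in>UNIV. \<Sum>b\<in>UNIV.
      ?L $ a $ b * wirt j (\<lambda>w. cexp w $ a) \<zeta> * cnj (wirt k (\<lambda>w. cexp w $ b) \<zeta>))"
    unfolding levi_weight_cset[OF assms, symmetric]
    by (rule levi_compose_holo[OF open_cset open_tset holo_map_cexp cexp_cset Cn_weight_tset assms])
  also have "\<dots> = (\<Sum>a\<in>UNIV. \<Sum>b\<in>UNIV. if b = k then (if a = j then ?L $ j $ k * (cexp \<zeta> $ j * cnj (cexp \<zeta> $ k)) else 0) else 0)"
    by (intro sum.cong refl) (auto simp: wirt_cexp)
  also have "\<dots> = ?L $ j $ k * (cexp \<zeta> $ j * cnj (cexp \<zeta> $ k))"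
    by simp
  finally show ?thesis by simp
qed

definition log_norm2 :: "complex^'m \<Rightarrow> real^'m" where
  "log_norm2 w = (\<chi> j. ln ((norm (w $ j))\<^sup>2))"

lemma rho_pt: "w \<in> ctorus \<Longrightarrow> rho X (pt w) = log_norm2 w"
  by (simp add: rho_def log_norm2_def zcoord_pt)

lemma log_norm2_cexp: "log_norm2 (cexp \<zeta>) = twice_Re \<zeta>"
  by (simp add: log_norm2_def twice_Re_def cexp_def vec_eq_iff ln_realpow)

lemma det_levi_orbit_chart:
  assumes w: "w \<in> tset i"
  shows "det (levi (local_weight X (orbit X, zcoord X) i) w) =
    of_real (det (hessian \<phi> (log_norm2 w)) / (\<Prod>j\<in>UNIV. (norm (w $ j))\<^sup>2))"
proof -
  have nz: "w $ j \<noteq> 0" for j using w by (auto simp: tset_def ctorus_def)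
  obtain \<zeta> where z: "cexp \<zeta> = w" using cexp_surj[OF nz] by blast
  have c: "\<zeta> \<in> cset i" using w by (simp add: cset_def tset_def z)
  have "levi (\<lambda>w. - ln (hmet X i (pt w))) w = levi (local_weight X (orbit X, zcoord X) i) w"
    by (rule levi_cong[OF open_tset Cn_weight_tset w]) (auto simp: local_weight_def tset_def inv_zcoord)
  then show ?thesis
    using det_of_real_scaled[OF levi_weight_tset[OF c]] nz by (simp add: z[symmetric] log_norm2_cexp)
qed

lemma open_chart_triv: "(U, c) \<in> atlas X \<Longrightarrow> open (c ` (U \<inter> triv X i))"
  by (rule top_chart_open_image[OF atlas_top_chart open_triv])

lemma Cn_local_weight:
  assumes C: "(U, c) \<in> atlas X"
  shows "Cn n (c ` (U \<inter> triv X i)) (local_weight X (U, c) i)"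
proof -
  have "msmooth X (triv X i) (hmet X i)" using positive_metric unfolding positive_metric_def by blast
  then have "Cn n (c ` (U \<inter> triv X i)) (\<lambda>w. hmet X i (inv_into U c w))"
    using C by (auto simp: msmooth_def smooth_def Ck_eq_Cn)
  then have "Cn n (c ` (U \<inter> triv X i)) (\<lambda>w. - ln (hmet X i (inv_into U c w)))"
    by (intro Cn_minus Cn_ln open_chart_triv[OF C])
      (auto simp: top_chart_inv[OF atlas_top_chart[OF C]] hmet_pos)
  moreover have "local_weight X (U, c) i = (\<lambda>w. - ln (hmet X i (inv_into U c w)))"
    by (simp add: local_weight_def fun_eq_iff)
  ultimately show ?thesis by simp
qed

text \<open>Inserting \<open>\<i> *s v\<close> makes the two summands of the skew form contribute
  equally, so the assumed positivity is that of twice the Levi form.\<close>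

lemma levi_form_positive:
  assumes C: "(U, c) \<in> atlas X" "p \<in> U \<inter> triv X i" and v: "v \<noteq> 0"
  shows "Re (\<Sum>a\<in>UNIV. \<Sum>b\<in>UNIV. levi (local_weight X (U, c) i) (c p) $ a $ b * (v $ a * cnj (v $ b))) > 0"
proof -
  let ?L = "levi (local_weight X (U, c) i) (c p)"
  have pos: "\<forall>C\<in>atlas X. \<forall>i. \<forall>p\<in>fst C \<inter> triv X i. \<forall>u. u \<noteq> 0 \<longrightarrow> omega X C i p u (\<i> *s u) > 0"
    using positive_metric unfolding positive_metric_def by blast
  have "omega X (U, c) i p v (\<i> *s v) > 0"
    using pos[rule_format, OF C(1), of p i v] C(2) v by simp
  moreover have e: "\<i> * (\<Sum>a\<in>UNIV. \<Sum>b\<in>UNIV. ?L $ a $ b * (v $ a * cnj ((\<i> *s v) $ b) - (\<i> *s v) $ a * cnj (v $ b)))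
      = 2 * (\<Sum>a\<in>UNIV. \<Sum>b\<in>UNIV. ?L $ a $ b * (v $ a * cnj (v $ b)))"
    unfolding sum_distrib_left by (intro sum.cong refl) (simp add: algebra_simps)
  moreover have "Re (2 * x) = 2 * Re x" for x :: complex by simp
  ultimately show ?thesis by (simp only: omega_def snd_conv e)
qed

text \<open>The Hessian is the Levi matrix of the local weight pulled back by the map g from \<zeta>
  to an atlas chart. Its value on u is thus the Levi form on the image v of u under the Jacobian of
  g, and positivity in the chart applies once v is nonzero.\<close>

lemma hessian_potential_pos:
  fixes u :: "real^'m"
  assumes u: "u \<noteq> 0"
  shows "u \<bullet> (hessian \<phi> \<rho> *v u) > 0"
proof -
  define \<zeta> where "\<zeta> = (\<chi> j. complex_of_real (\<rho> $ j / 2))"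
  have \<zeta>: "twice_Re \<zeta> = \<rho>" by (simp add: twice_Re_def \<zeta>_def vec_eq_iff)
  obtain i where i: "\<zeta> \<in> cset i" using cset_cover by blast
  define p where "p = pt (cexp \<zeta>)"
  obtain U c where C: "(U, c) \<in> atlas X" "p \<in> U" using atlas_cover by blast
  note t = atlas_top_chart[OF C(1)]
  have pi: "p \<in> U \<inter> triv X i" using i C by (simp add: cset_def p_def)
  let ?W = "{w \<in> ctorus. pt w \<in> U \<inter> triv X i}"
  let ?S = "cexp -` ?W"
  have W: "open ?W" by (intro open_pt_preimage open_Int open_triv top_chartD(1)[OF t])
  have S: "open ?S" by (rule open_vimage[OF W continuous_cexp])
  have zS: "\<zeta> \<in> ?S" using pi by (simp add: cexp_ctorus p_def)
  define g where "g \<zeta> = c (pt (cexp \<zeta>))" for \<zeta>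
  have gh: "holo_map ?S g"
    unfolding holo_map_def g_def
  proof
    fix a
    have "holo ?W (\<lambda>w. c (pt w) $ a)"
      using transition_holo_map[OF C(1)] by (auto simp: holo_map_def intro: holo_subset)
    then show "holo ?S (\<lambda>\<zeta>. c (pt (cexp \<zeta>)) $ a)"
      by (rule holo_compose_holo_map[OF holo_map_cexp]) auto
  qed
  let ?J = "\<lambda>j a. wirt j (\<lambda>\<zeta>. g \<zeta> $ a) \<zeta>"
  define v where "v = (\<chi> a. \<Sum>j\<in>UNIV. ?J j a * complex_of_real (u $ j))"
  let ?u = "(\<chi> j. complex_of_real (u $ j)) :: complex^'m"
  have dg: "(g has_derivative (\<lambda>x. \<chi> a. \<Sum>j\<in>UNIV. ?J j a * x $ j)) (at \<zeta>)"
    by (rule holo_map_has_derivative[OF gh zS])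
  \<comment> \<open>Following g by the coordinate change back to the torus gives
    \<open>cexp\<close>, whose derivative is diagonal and nonsingular; so the Jacobian of g kills no
    nonzero vector.\<close>
  have v: "v \<noteq> 0"
  proof
    assume v0: "v = 0"
    let ?T = "c ` (U \<inter> orbit X)"
    define h where "h w = zcoord X (inv_into U c w)" for w
    have h: "holo_map ?T h" unfolding h_def by (rule inverse_transition_holo_map[OF C(1)])
    have gT: "g \<zeta> \<in> ?T" using C(2) by (simp add: g_def p_def pt_in_orbit cexp_ctorus)
    obtain D where D: "(h has_derivative D) (at (g \<zeta>))" using holo_map_has_derivative[OF h gT] by blast
    have "h (g \<zeta>') = cexp \<zeta>'" if "\<zeta>' \<in> ?S" for \<zeta>'
      using that by (simp add: h_def g_def top_chart_inv[OF t] zcoord_pt)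
    then have "(cexp has_derivative (\<lambda>x. D (\<chi> a. \<Sum>j\<in>UNIV. ?J j a * x $ j))) (at \<zeta>)"
      by (rule has_derivative_transform_within_open[OF has_derivative_compose[where g = h, OF dg D] S zS])
    then have e: "((\<lambda>\<zeta>. cexp \<zeta> $ a) has_derivative (\<lambda>x. D (\<chi> a. \<Sum>j\<in>UNIV. ?J j a * x $ j) $ a)) (at \<zeta>)" for a
      by (rule bounded_linear.has_derivative[OF bounded_linear_vec_nth])
    have "D (\<chi> a. \<Sum>j\<in>UNIV. ?J j a * ?u $ j) $ a = cexp \<zeta> $ a * ?u $ a" for a
      by (rule fun_cong[OF has_derivative_unique[OF e cexp_derivative]])
    moreover have "(\<chi> a. \<Sum>j\<in>UNIV. ?J j a * ?u $ j) = 0" using v0 by (simp add: v_def)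
    moreover have "D 0 = 0" using linear_0[OF has_derivative_linear[OF D]] .
    ultimately have "u $ a = 0" for a by simp
    then show False using u by (simp add: vec_eq_iff)
  qed
  have gS: "g ` ?S \<subseteq> c ` (U \<inter> triv X i)" by (auto simp: g_def)
  have lw: "local_weight X (U, c) i (g \<zeta>') = - ln (hmet X i (pt (cexp \<zeta>')))" if "\<zeta>' \<in> ?S" for \<zeta>'
    using that by (simp add: local_weight_def g_def top_chart_inv[OF t])
  have gp: "g \<zeta> = c p" by (simp add: g_def p_def)
  let ?L = "levi (local_weight X (U, c) i) (c p)"
  have Hjk: "complex_of_real (hessian \<phi> \<rho> $ j $ k) = (\<Sum>a\<in>UNIV. \<Sum>b\<in>UNIV. ?L $ a $ b * ?J j a * cnj (?J k b))" for j k
  proof -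
    have "Cn 2 ?S (\<lambda>\<zeta>. local_weight X (U, c) i (g \<zeta>))"
      by (rule Cn_compose[OF S open_chart_triv[OF C(1)] gS holo_map_Cn[OF S gh] Cn_local_weight[OF C(1)]])
    from levi_cong[OF S this zS lw]
    have "levi (\<lambda>\<zeta>. local_weight X (U, c) i (g \<zeta>)) \<zeta> = levi (\<lambda>\<zeta>. - ln (hmet X i (pt (cexp \<zeta>)))) \<zeta>" .
    then have "complex_of_real (hessian \<phi> \<rho> $ j $ k) = levi (\<lambda>\<zeta>. local_weight X (U, c) i (g \<zeta>)) \<zeta> $ j $ k"
      using levi_weight_cset[OF i] by (simp add: \<zeta>)
    then show ?thesis
      using levi_compose_holo[OF S open_chart_triv[OF C(1)] gh gS Cn_local_weight[OF C(1)] zS] by (simp only: gp)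
  qed
  have va: "v $ a = (\<Sum>j\<in>UNIV. ?J j a * complex_of_real (u $ j))" for a by (simp add: v_def)
  have vb: "cnj (v $ b) = (\<Sum>k\<in>UNIV. cnj (?J k b) * complex_of_real (u $ k))" for b by (simp add: v_def)
  have vv: "v $ a * cnj (v $ b) = (\<Sum>j\<in>UNIV. \<Sum>k\<in>UNIV.
      (?J j a * complex_of_real (u $ j)) * (cnj (?J k b) * complex_of_real (u $ k)))" for a b
    by (subst vb, subst va, rule sum_product)
  have "complex_of_real (u \<bullet> (hessian \<phi> \<rho> *v u)) =
      (\<Sum>j\<in>UNIV. \<Sum>k\<in>UNIV. complex_of_real (u $ j) * (complex_of_real (hessian \<phi> \<rho> $ j $ k) * complex_of_real (u $ k)))"
    by (simp add: inner_vec_def matrix_vector_mult_def sum_distrib_left)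
  also have "\<dots> = (\<Sum>j\<in>UNIV. \<Sum>k\<in>UNIV. \<Sum>a\<in>UNIV. \<Sum>b\<in>UNIV.
      ?L $ a $ b * ((?J j a * complex_of_real (u $ j)) * (cnj (?J k b) * complex_of_real (u $ k))))"
    unfolding Hjk sum_distrib_left sum_distrib_right by (intro sum.cong refl) (simp only: mult_ac)
  \<comment> \<open>The sums are reordered until those over the chart indices a and b are outermost
    and the inner ones form v and its conjugate.\<close>
  also have "\<dots> = (\<Sum>j\<in>UNIV. \<Sum>a\<in>UNIV. \<Sum>k\<in>UNIV. \<Sum>b\<in>UNIV.
      ?L $ a $ b * ((?J j a * complex_of_real (u $ j)) * (cnj (?J k b) * complex_of_real (u $ k))))"
    by (rule sum.cong[OF refl], rule sum.swap)
  also have "\<dots> = (\<Sum>a\<in>UNIV. \<Sum>j\<in>UNIV. \<Sum>k\<in>UNIV. \<Sum>b\<in>UNIV.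
      ?L $ a $ b * ((?J j a * complex_of_real (u $ j)) * (cnj (?J k b) * complex_of_real (u $ k))))"
    by (rule sum.swap)
  also have "\<dots> = (\<Sum>a\<in>UNIV. \<Sum>j\<in>UNIV. \<Sum>b\<in>UNIV. \<Sum>k\<in>UNIV.
      ?L $ a $ b * ((?J j a * complex_of_real (u $ j)) * (cnj (?J k b) * complex_of_real (u $ k))))"
    by (rule sum.cong[OF refl], rule sum.cong[OF refl], rule sum.swap)
  also have "\<dots> = (\<Sum>a\<in>UNIV. \<Sum>b\<in>UNIV. \<Sum>j\<in>UNIV. \<Sum>k\<in>UNIV.
      ?L $ a $ b * ((?J j a * complex_of_real (u $ j)) * (cnj (?J k b) * complex_of_real (u $ k))))"
    by (rule sum.cong[OF refl], rule sum.swap)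
  also have "\<dots> = (\<Sum>a\<in>UNIV. \<Sum>b\<in>UNIV. ?L $ a $ b * (v $ a * cnj (v $ b)))"
    unfolding vv sum_distrib_left by (rule refl)
  finally have "u \<bullet> (hessian \<phi> \<rho> *v u) = Re (\<Sum>a\<in>UNIV. \<Sum>b\<in>UNIV. ?L $ a $ b * (v $ a * cnj (v $ b)))"
    by (metis Re_complex_of_real)
  then show ?thesis using levi_form_positive[OF C(1) pi v] by simp
qed

sublocale convex_potential "potential X"
  by unfold_locales (auto intro: Cn_potential hessian_potential_pos)

section \<open>The Liouville measure\<close>

lemma sets_vol: "sets (vol X) = sets borel"
  using liouville_measure by (simp add: liouville_measure_def)

lemma space_vol: "space (vol X) = UNIV"
  using sets_eq_imp_space_eq[OF sets_vol] by simp

lemma emeasure_vol_chart: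
  assumes "holo_chart X (U, c)" "A \<in> sets borel" "A \<subseteq> U \<inter> triv X i"
  shows "emeasure (vol X) A = (\<integral>\<^sup>+ w. indicator (c ` A) w *
    ennreal (2 ^ CARD('m) * Re (det (levi (local_weight X (U, c) i) w))) \<partial>lborel)"
  using liouville_measure assms unfolding liouville_measure_def by blast

text \<open>The density is continuous in each chart, so small neighbourhoods have finite mass, and
  finitely many of them cover the compact manifold.\<close>

lemma finite_vol: "emeasure (vol X) UNIV < \<infinity>"
proof -
  have "\<exists>W. open W \<and> p \<in> W \<and> emeasure (vol X) W < \<infinity>" for p
  proof -
    obtain U c where C: "(U, c) \<in> atlas X" "p \<in> U" using atlas_cover by blast
    note t = atlas_top_chart[OF C(1)]
    obtain i where i: "p \<in> triv X i" using triv_cover by blast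
    let ?T = "c ` (U \<inter> triv X i)"
    have "c p \<in> ?T" using C i by auto
    then obtain e where e: "e > 0" "cball (c p) e \<subseteq> ?T"
      using open_chart_triv[OF C(1)] open_contains_cball by blast
    let ?d = "\<lambda>w. 2 ^ CARD('m) * Re (det (levi (local_weight X (U, c) i) w))"
    have "continuous_on ?T ?d"
      unfolding det_def
      by (intro continuous_intros levi_continuous open_chart_triv[OF C(1)] Cn_local_weight[OF C(1)])
    then have "continuous_on (cball (c p) e) ?d" using e(2) by (rule continuous_on_subset)
    then have "bounded (?d ` cball (c p) e)" by (intro compact_imp_bounded compact_continuous_image) auto
    then obtain K where K: "\<forall>w\<in>cball (c p) e. \<bar>?d w\<bar> \<le> K" by (auto simp: bounded_iff)
    define W where "W = (c -` ball (c p) e \<inter> U) \<inter> triv X i"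
    have "continuous_on U c" using homeomorphism_cont1[OF top_chartD(3)[OF t]] .
    then have "open (c -` ball (c p) e \<inter> U)"
      using top_chartD(1)[OF t] continuous_on_open_vimage[of U c] by auto
    from open_Int[OF this open_triv] have W: "open W" unfolding W_def .
    have "emeasure (vol X) W = (\<integral>\<^sup>+ w. indicator (c ` W) w * ennreal (?d w) \<partial>lborel)"
      using W by (intro emeasure_vol_chart atlas_chart C) (auto simp: W_def)
    also have "\<dots> \<le> (\<integral>\<^sup>+ w. ennreal K * indicator (ball (c p) e) w \<partial>lborel)"
    proof (rule nn_integral_mono)
      fix w
      show "indicator (c ` W) w * ennreal (?d w) \<le> ennreal K * indicator (ball (c p) e) w"
      proof (cases "w \<in> c ` W")
        case True
        then have b: "w \<in> ball (c p) e" by (auto simp: W_def)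
        then have "w \<in> cball (c p) e" by simp
        then have "?d w \<le> K" using K abs_le_D1 by blast
        then show ?thesis using True b by (simp add: ennreal_leI)
      qed simp
    qed
    also have "\<dots> = ennreal K * emeasure lborel (ball (c p) e)"
      by (rule nn_integral_cmult_indicator) simp
    also have "\<dots> < \<infinity>"
      using emeasure_lborel_ball_finite[of "c p" e] by (simp add: ennreal_mult_less_top)
    finally show ?thesis using W C(2) i e(1) by (intro exI[of _ W]) (auto simp: W_def)
  qed
  then obtain W where W: "\<And>p. open (W p)" "\<And>p. p \<in> W p" "\<And>p. emeasure (vol X) (W p) < \<infinity>" by metis
  obtain I where I: "finite I" "UNIV \<subseteq> (\<Union>p\<in>I. W p)"
    by (rule compactE_image[OF compact, of UNIV W]) (use W in auto)
  have "emeasure (vol X) UNIV \<le> emeasure (vol X) (\<Union>p\<in>I. W p)"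
    using W(1) by (intro emeasure_mono I) (simp add: sets_vol open_UN)
  also have "\<dots> \<le> (\<Sum>p\<in>I. emeasure (vol X) (W p))"
    using W(1) by (intro emeasure_subadditive_finite I) (auto simp: sets_vol)
  also have "\<dots> < \<infinity>" using W(3) I(1) by (simp add: less_top)
  finally show ?thesis .
qed

section \<open>The Liouville measure on the orbit and in the variable \<rho>\<close>

lemma borel_pt_preimage:
  assumes "A \<in> sets borel" shows "{w \<in> ctorus. pt w \<in> A} \<in> sets borel"
proof -
  have "pt \<in> borel_measurable (restrict_space borel ctorus)"
    by (rule borel_measurable_continuous_on_restrict[OF continuous_pt])
  from measurable_sets[OF this assms]
  have "pt -` A \<inter> ctorus \<in> sets (restrict_space borel ctorus)" by (simp add: space_restrict_space)
  then have "pt -` A \<inter> ctorus \<in> sets borel"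
    using open_ctorus by (subst (asm) sets_restrict_space_iff) auto
  moreover have "pt -` A \<inter> ctorus = {w \<in> ctorus. pt w \<in> A}" by auto
  ultimately show ?thesis by simp
qed

lemma zcoord_image_subset: "A \<subseteq> orbit X \<Longrightarrow> zcoord X ` A = {w \<in> ctorus. pt w \<in> A}"
  using zcoord_image[of A] by (simp add: Int_absorb1)

text \<open>The Liouville density in the orbit chart: the Levi matrix has the entries
  \<open>\<phi>\<^sub>j\<^sub>k / (w\<^sub>j * cnj w\<^sub>k)\<close>, and the product is the Jacobian of the logarithmic polar
  coordinates.\<close>

definition orbit_density :: "complex^'m \<Rightarrow> ennreal" where
  "orbit_density w = ennreal ((2 * pi) ^ CARD('m) * det (hessian \<phi> (log_norm2 w))) *
     (\<Prod>j\<in>UNIV. ennreal (1 / (pi * (norm (w $ j))\<^sup>2)))"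

lemma continuous_det_hessian: "continuous_on UNIV (\<lambda>\<rho>. det (hessian \<phi> \<rho>))"
  unfolding det_def by (intro continuous_intros continuous_on_compose2[OF continuous_hessian]) auto

lemma borel_measurable_log_norm2 [measurable]: "log_norm2 \<in> borel_measurable borel"
  unfolding log_norm2_def[abs_def] by (intro borel_measurable_vec_lambda) measurable

lemma borel_measurable_det_hessian: "(\<lambda>\<rho>. det (hessian \<phi> \<rho>)) \<in> borel_measurable borel"
  by (rule borel_measurable_continuous_onI[OF continuous_det_hessian])

lemma borel_measurable_orbit_density [measurable]: "orbit_density \<in> borel_measurable borel"
  unfolding orbit_density_def[abs_def]
  using measurable_compose[OF borel_measurable_log_norm2 borel_measurable_det_hessian] by measurable

lemma emeasure_vol_orbit_triv:
  assumes A: "A \<in> sets borel" "A \<subseteq> orbit X \<inter> triv X i"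
  shows "emeasure (vol X) A = (\<integral>\<^sup>+w. indicator {w \<in> ctorus. pt w \<in> A} w * orbit_density w \<partial>lborel)"
proof -
  have z: "zcoord X ` A = {w \<in> ctorus. pt w \<in> A}" using A by (intro zcoord_image_subset) auto
  have "emeasure (vol X) A = (\<integral>\<^sup>+ w. indicator (zcoord X ` A) w *
    ennreal (2 ^ CARD('m) * Re (det (levi (local_weight X (orbit X, zcoord X) i) w))) \<partial>lborel)"
    by (rule emeasure_vol_chart[OF orbit_chart(1) A])
  also have "\<dots> = (\<integral>\<^sup>+w. indicator {w \<in> ctorus. pt w \<in> A} w * orbit_density w \<partial>lborel)"
  proof (rule nn_integral_cong)
    fix w
    show "indicator (zcoord X ` A) w * ennreal (2 ^ CARD('m) * Re (det (levi (local_weight X (orbit X, zcoord X) i) w)))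
       = indicator {w \<in> ctorus. pt w \<in> A} w * orbit_density w"
    proof (cases "w \<in> ctorus \<and> pt w \<in> A")
      case True
      then have w: "w \<in> tset i" using A(2) by (auto simp: tset_def)
      have nz: "w $ j \<noteq> 0" for j using True by (auto simp: ctorus_def)
      have dp: "det (hessian \<phi> (log_norm2 w)) > 0" by (rule pos_def_det_pos[OF pos_def_hessian])
      have "orbit_density w = ennreal ((2 * pi) ^ CARD('m) * det (hessian \<phi> (log_norm2 w)) * (\<Prod>j\<in>UNIV. 1 / (pi * (norm (w $ j))\<^sup>2)))"
        unfolding orbit_density_def using dp
        by (subst prod_ennreal) (auto intro!: ennreal_mult[symmetric] prod_nonneg)
      \<comment> \<open>The powers of pi, present to match the density 1/(pi |w_j|^2) of logarithmic
        polar coordinates, cancel and leave the 2^m of the Liouville density.\<close>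
      also have "(2 * pi) ^ CARD('m) * det (hessian \<phi> (log_norm2 w)) * (\<Prod>j\<in>UNIV. 1 / (pi * (norm (w $ j))\<^sup>2)) =
          2 ^ CARD('m) * (det (hessian \<phi> (log_norm2 w)) / (\<Prod>j\<in>UNIV. (norm (w $ j))\<^sup>2))"
        by (simp add: power_mult_distrib prod_dividef prod.distrib)
      also have "\<dots> = 2 ^ CARD('m) * Re (det (levi (local_weight X (orbit X, zcoord X) i) w))"
        by (simp only: det_levi_orbit_chart[OF w] Re_complex_of_real)
      finally show ?thesis using True unfolding z by simp
    qed (simp add: z)
  qed
  finally show ?thesis .
qed

text \<open>The Liouville formula is given on sets inside one trivialization. Compactness provides a
  finite subcover, along which the set is cut by induction; both sides are additive.\<close>

lemma emeasure_vol_orbit: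
  assumes A: "A \<in> sets borel" "A \<subseteq> orbit X"
  shows "emeasure (vol X) A = (\<integral>\<^sup>+w. indicator {w \<in> ctorus. pt w \<in> A} w * orbit_density w \<partial>lborel)"
proof -
  obtain I where I: "finite I" "UNIV \<subseteq> (\<Union>i\<in>I. triv X i)"
    by (rule compactE_image[OF compact, of UNIV "triv X"]) (use open_triv triv_cover in auto)
  have "emeasure (vol X) A = (\<integral>\<^sup>+w. indicator {w \<in> ctorus. pt w \<in> A} w * orbit_density w \<partial>lborel)"
    if "finite I" "A \<in> sets borel" "A \<subseteq> orbit X" "A \<subseteq> (\<Union>i\<in>I. triv X i)" for A I
    using that
  proof (induct I arbitrary: A)
    case (insert i I)
    let ?B = "A \<inter> triv X i" and ?C = "A - triv X i"
    have tm: "triv X i \<in> sets borel" using open_triv by simp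
    have B: "?B \<in> sets borel" and C: "?C \<in> sets borel" using insert(4) tm by auto
    have m: "(\<lambda>w. indicator {w \<in> ctorus. pt w \<in> D} w * orbit_density w) \<in> borel_measurable lborel" if "D \<in> sets borel" for D
      using borel_pt_preimage[OF that] by measurable
    have "emeasure (vol X) A = emeasure (vol X) ?B + emeasure (vol X) ?C"
      using B C by (subst plus_emeasure) (auto simp: sets_vol intro: arg_cong)
    also have "\<dots> = (\<integral>\<^sup>+w. indicator {w \<in> ctorus. pt w \<in> ?B} w * orbit_density w \<partial>lborel) +
        (\<integral>\<^sup>+w. indicator {w \<in> ctorus. pt w \<in> ?C} w * orbit_density w \<partial>lborel)"
      using insert(5,6) by (intro arg_cong2[where f = "(+)"] emeasure_vol_orbit_triv[OF B] insert(3)[OF C]) auto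
    also have "\<dots> = (\<integral>\<^sup>+w. indicator {w \<in> ctorus. pt w \<in> ?B} w * orbit_density w +
        indicator {w \<in> ctorus. pt w \<in> ?C} w * orbit_density w \<partial>lborel)"
      by (rule nn_integral_add[symmetric]) (rule m[OF B] m[OF C])+
    also have "\<dots> = (\<integral>\<^sup>+w. indicator {w \<in> ctorus. pt w \<in> A} w * orbit_density w \<partial>lborel)"
      by (rule nn_integral_cong) (auto simp: indicator_def)
    finally show ?case .
  qed auto
  from this[OF I(1) A] I(2) show ?thesis by auto
qed

lemma borel_rho_preimage:
  assumes "B \<in> sets borel" shows "{p \<in> orbit X. rho X p \<in> B} \<in> sets borel"
proof -
  have "zcoord X \<in> borel_measurable (restrict_space borel (orbit X))"
    by (rule borel_measurable_continuous_on_restrict[OF continuous_zcoord])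
  from measurable_sets[OF this, of "log_norm2 -` B"]
  have "zcoord X -` (log_norm2 -` B) \<inter> orbit X \<in> sets (restrict_space borel (orbit X))"
    using measurable_sets[OF borel_measurable_log_norm2 assms] by (simp add: space_restrict_space)
  then have "zcoord X -` (log_norm2 -` B) \<inter> orbit X \<in> sets borel"
    using open_orbit by (subst (asm) sets_restrict_space_iff) auto
  moreover have "zcoord X -` (log_norm2 -` B) \<inter> orbit X = {p \<in> orbit X. rho X p \<in> B}"
    by (auto simp: rho_def log_norm2_def)
  ultimately show ?thesis by simp
qed

text \<open>\<open>lborel_log_norm2\<close> integrates out the angles and absorbs the factors
  |w_j|^2 of the Levi determinant.\<close>

lemma emeasure_vol_rho:
  assumes B: "B \<in> sets borel"
  shows "emeasure (vol X) {p \<in> orbit X. rho X p \<in> B} =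
    (\<integral>\<^sup>+\<rho>. ennreal ((2 * pi) ^ CARD('m) * det (hessian \<phi> \<rho>)) * indicator B \<rho> \<partial>lborel)"
proof -
  let ?V = "\<lambda>\<rho>. ennreal ((2 * pi) ^ CARD('m) * det (hessian \<phi> \<rho>))"
  let ?d = "\<lambda>w::complex^'m. \<Prod>j\<in>UNIV. ennreal (1 / (pi * (norm (w $ j))\<^sup>2))"
  have Vm[measurable]: "?V \<in> borel_measurable borel"
    using borel_measurable_det_hessian by measurable
  have dm[measurable]: "?d \<in> borel_measurable borel" by measurable
  note B[measurable]
  have "emeasure (vol X) {p \<in> orbit X. rho X p \<in> B} =
      (\<integral>\<^sup>+w. indicator {w \<in> ctorus. pt w \<in> {p \<in> orbit X. rho X p \<in> B}} w * orbit_density w \<partial>lborel)"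
    by (rule emeasure_vol_orbit[OF borel_rho_preimage[OF B]]) auto
  also have "\<dots> = (\<integral>\<^sup>+w. ?d w * (?V (log_norm2 w) * indicator B (log_norm2 w)) \<partial>lborel)"
  proof (rule nn_integral_cong)
    fix w :: "complex^'m"
    show "indicator {w \<in> ctorus. pt w \<in> {p \<in> orbit X. rho X p \<in> B}} w * orbit_density w =
        ?d w * (?V (log_norm2 w) * indicator B (log_norm2 w))"
    proof (cases "w \<in> ctorus")
      case True
      then show ?thesis by (auto simp: indicator_def pt_in_orbit rho_pt orbit_density_def mult_ac)
    next
      case False
      then obtain j where "w $ j = 0" by (auto simp: ctorus_def)
      then have "?d w = 0" by (intro prod_zero) auto
      then show ?thesis using False by simp
    qed
  qed
  also have "\<dots> = (\<integral>\<^sup>+\<rho>. ?V \<rho> * indicator B \<rho> \<partial>distr (density lborel ?d) borel log_norm2)"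
  proof -
    have m: "(\<lambda>\<rho>. ?V \<rho> * indicator B \<rho>) \<in> borel_measurable borel"
      by (rule borel_measurable_times_ennreal[OF Vm borel_measurable_indicator]) (rule B)
    have l: "log_norm2 \<in> measurable (density lborel ?d) borel" by simp
    have m': "(\<lambda>w. ?V (log_norm2 w) * indicator B (log_norm2 w)) \<in> borel_measurable lborel"
      using measurable_compose[OF borel_measurable_log_norm2 m] by simp
    have "(\<integral>\<^sup>+\<rho>. ?V \<rho> * indicator B \<rho> \<partial>distr (density lborel ?d) borel log_norm2) =
        (\<integral>\<^sup>+w. ?V (log_norm2 w) * indicator B (log_norm2 w) \<partial>density lborel ?d)"
      by (rule nn_integral_distr[OF l]) (simp only: measurable_distr_eq1 m)
    also have "\<dots> = (\<integral>\<^sup>+w. ?d w * (?V (log_norm2 w) * indicator B (log_norm2 w)) \<partial>lborel)"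
      by (rule nn_integral_density[OF _ m']) (simp add: dm)
    finally show ?thesis by simp
  qed
  also have "distr (density lborel ?d) borel log_norm2 = (lborel :: (real^'m) measure)"
    unfolding log_norm2_def[abs_def] by (rule lborel_log_norm2[symmetric])
  finally show ?thesis .
qed

end

section \<open>Sections and their norms\<close>

context toric_kaehler
begin

lemma continuous_on_from_charts:
  fixes f :: "'a \<Rightarrow> 'b::real_normed_vector"
  assumes W: "open W"
    and f: "\<And>U c. (U, c) \<in> atlas X \<Longrightarrow> continuous_on (c ` (U \<inter> W)) (\<lambda>w. f (inv_into U c w))"
  shows "continuous_on W f"
proof (rule continuous_at_imp_continuous_on, rule ballI)
  fix p assume p: "p \<in> W"
  obtain U c where C: "(U, c) \<in> atlas X" "p \<in> U" using atlas_cover by blast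
  note t = atlas_top_chart[OF C(1)]
  have "continuous_on (U \<inter> W) c"
    using homeomorphism_cont1[OF top_chartD(3)[OF t]] by (rule continuous_on_subset) auto
  then have "continuous_on (U \<inter> W) (\<lambda>p. f (inv_into U c (c p)))"
    by (rule continuous_on_compose2[OF f[OF C(1)]]) auto
  then have "continuous_on (U \<inter> W) f"
    by (rule continuous_on_eq) (simp add: top_chart_inv[OF t])
  then show "continuous (at p) f"
    using p C(2) W top_chartD(1)[OF t] by (simp add: continuous_on_eq_continuous_at open_Int)
qed

lemma mholo_continuous_on: "open W \<Longrightarrow> mholo X W f \<Longrightarrow> continuous_on W f"
  by (rule continuous_on_from_charts) (auto simp: mholo_def intro: holo_imp_continuous_on)

lemma continuous_hmet: "continuous_on (triv X i) (hmet X i)"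
proof (rule continuous_on_from_charts[OF open_triv])
  fix U c assume C: "(U, c) \<in> atlas X"
  have "msmooth X (triv X i) (hmet X i)" using positive_metric unfolding positive_metric_def by blast
  then have "Cn 0 (c ` (U \<inter> triv X i)) (\<lambda>w. hmet X i (inv_into U c w))"
    using C by (auto simp: msmooth_def smooth_def Ck_eq_Cn simp del: Cn.simps)
  then show "continuous_on (c ` (U \<inter> triv X i)) (\<lambda>w. hmet X i (inv_into U c w))" by simp
qed

lemma H0_continuous: "s \<in> H0 X k \<Longrightarrow> continuous_on (triv X i) (s i)"
proof -
  assume "s \<in> H0 X k"
  then have "mholo X (UNIV \<inter> triv X i) (s i)" unfolding H0_def sections_def by blast
  then show ?thesis using mholo_continuous_on[OF open_triv] by simp
qed

lemma hnorm2_H0: "s \<in> H0 X k \<Longrightarrow> p \<in> triv X i \<Longrightarrow> hnorm2 X k s p = (norm (s i p))\<^sup>2 * hmet X i p ^ k"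
  using hnorm2_eq[of s k UNIV p i] by (simp add: H0_def)

lemma hnorm2_nonneg: "s \<in> H0 X k \<Longrightarrow> hnorm2 X k s p \<ge> 0"
  using triv_cover[of p] hnorm2_H0[of s k p] hmet_pos[of p] by (auto simp: less_imp_le)

lemma hnorm2_continuous:
  assumes s: "s \<in> H0 X k" shows "continuous_on UNIV (hnorm2 X k s)"
proof (rule continuous_at_imp_continuous_on, rule ballI)
  fix p
  obtain i where i: "p \<in> triv X i" using triv_cover by blast
  have "continuous_on (triv X i) (\<lambda>p. (norm (s i p))\<^sup>2 * hmet X i p ^ k)"
    by (intro continuous_intros H0_continuous[OF s] continuous_hmet)
  then have "continuous_on (triv X i) (hnorm2 X k s)"
    by (rule continuous_on_eq) (simp add: hnorm2_H0[OF s])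
  then show "continuous (at p) (hnorm2 X k s)"
    using i open_triv by (simp add: continuous_on_eq_continuous_at)
qed

lemma dense_subset_closed: "closed C \<Longrightarrow> orbit X \<subseteq> C \<Longrightarrow> p \<in> C"
  using closure_minimal[of "orbit X" C] dense_orbit by auto

text \<open>Two extensions agree on the dense orbit, and within a trivialization the set where they
  differ is open, hence empty. This justifies the definite description in
  \<open>toric_section\<close>.\<close>

lemma extends_monomial_unique:
  assumes s: "extends_monomial X k \<alpha> s" and s': "extends_monomial X k \<alpha> s'"
  shows "s = s'"
proof (intro ext)
  fix i p
  have h: "s \<in> H0 X k" "s' \<in> H0 X k" using s s' by (auto simp: extends_monomial_def)
  show "s i p = s' i p"
  proof (cases "p \<in> triv X i")
    case True
    have "continuous_on (triv X i) (\<lambda>p. s i p - s' i p)"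
      by (intro continuous_on_diff H0_continuous[OF h(1)] H0_continuous[OF h(2)])
    then have "open ((\<lambda>p. s i p - s' i p) -` (- {0}) \<inter> triv X i)"
      using open_triv[of i] continuous_on_open_vimage[of "triv X i" "\<lambda>p. s i p - s' i p"] by auto
    then have "closed (- ((\<lambda>p. s i p - s' i p) -` (- {0}) \<inter> triv X i))"
      unfolding closed_def double_complement .
    moreover have "orbit X \<subseteq> - ((\<lambda>p. s i p - s' i p) -` (- {0}) \<inter> triv X i)"
      using s s' by (auto simp: extends_monomial_def)
    ultimately have "p \<in> - ((\<lambda>p. s i p - s' i p) -` (- {0}) \<inter> triv X i)" by (rule dense_subset_closed)
    then show ?thesis using True by auto
  next
    case False
    then have "s i p = 0" "s' i p = 0" using h unfolding H0_def sections_def by blast+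
    then show ?thesis by simp
  qed
qed

lemma toric_section:
  assumes "k \<ge> 1" "\<alpha> \<in> lattice_points X k"
  shows "extends_monomial X k \<alpha> (toric_section X k \<alpha>)" "toric_section X k \<alpha> \<in> H0 X k"
proof -
  have "\<exists>s. extends_monomial X k \<alpha> s"
    using associated_polytope assms by (simp add: associated_polytope_def)
  then have "\<exists>!s. extends_monomial X k \<alpha> s" using extends_monomial_unique by blast
  then show 1: "extends_monomial X k \<alpha> (toric_section X k \<alpha>)"
    unfolding toric_section_def by (rule theI')
  then show "toric_section X k \<alpha> \<in> H0 X k" by (simp add: extends_monomial_def)
qed

lemma norm_monomial:
  assumes "w \<in> ctorus"
  shows "(norm (monomial w \<alpha>))\<^sup>2 = exp (real_vec \<alpha> \<bullet> log_norm2 w)"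
proof -
  have p: "norm (w $ j) > 0" for j using assms by (simp add: ctorus_def)
  have "(norm (w $ j) powi (\<alpha> $ j))\<^sup>2 = exp (real_of_int (\<alpha> $ j) * ln ((norm (w $ j))\<^sup>2))" for j
  proof -
    have "exp (real_of_int (\<alpha> $ j) * ln ((norm (w $ j))\<^sup>2)) = exp (real_of_int (\<alpha> $ j) * ln (norm (w $ j))) ^ 2"
    proof -
      have "real_of_int (\<alpha> $ j) * ln ((norm (w $ j))\<^sup>2) = 2 * (real_of_int (\<alpha> $ j) * ln (norm (w $ j)))"
        by (simp add: ln_realpow)
      then show ?thesis by (simp only: exp_double)
    qed
    also have "exp (real_of_int (\<alpha> $ j) * ln (norm (w $ j))) = norm (w $ j) powr real_of_int (\<alpha> $ j)"
      using p[of j] by (simp add: powr_def)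
    also have "\<dots> = norm (w $ j) powi (\<alpha> $ j)" using p[of j] by (simp add: powr_real_of_int')
    finally show ?thesis by simp
  qed
  moreover have "(norm (monomial w \<alpha>))\<^sup>2 = (\<Prod>j\<in>UNIV. (norm (w $ j) powi (\<alpha> $ j))\<^sup>2)"
    by (simp add: monomial_def prod_norm[symmetric] norm_power_int prod_power_distrib)
  ultimately show ?thesis
    by (simp add: inner_vec_def real_vec_def log_norm2_def exp_sum)
qed

lemma hnorm2_toric_section:
  assumes k: "k \<ge> 1" "\<alpha> \<in> lattice_points X k" and p: "p \<in> orbit X"
  shows "hnorm2 X k (toric_section X k \<alpha>) p = exp (real_vec \<alpha> \<bullet> rho X p - real k * \<phi> (rho X p))"
proof -
  obtain i where i: "p \<in> triv X i" using triv_cover by blast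
  have "toric_section X k \<alpha> i p = monomial (zcoord X p) \<alpha> * frame X i p ^ k"
    using toric_section(1)[OF k] p i unfolding extends_monomial_def by blast
  then have "hnorm2 X k (toric_section X k \<alpha>) p =
      (norm (monomial (zcoord X p) \<alpha>))\<^sup>2 * (hnorm2 X 1 (frame X) p) ^ k"
    unfolding hnorm2_frame[OF p i] hnorm2_H0[OF toric_section(2)[OF k] i]
    by (simp add: norm_mult norm_power power_mult_distrib power_mult[symmetric] mult.commute)
  also have "(norm (monomial (zcoord X p) \<alpha>))\<^sup>2 = exp (real_vec \<alpha> \<bullet> rho X p)"
    using norm_monomial[OF zcoord_in_ctorus[OF p]] by (simp add: log_norm2_def rho_def)
  also have "(hnorm2 X 1 (frame X) p) ^ k = exp (- (real k * \<phi> (rho X p)))"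
    unfolding hnorm2_frame_rho(1)[OF p] by (simp add: exp_of_nat_mult[symmetric])
  finally show ?thesis by (simp add: exp_add[symmetric])
qed

lemma polytope_poly: "polytope (poly X)"
  using associated_polytope by (simp add: associated_polytope_def delzant_def)

lemma bounded_poly: "bounded (poly X)"
  using polytope_imp_bounded[OF polytope_poly] .

lemma finite_int_vectors: "finite {\<alpha>::int^'m. \<forall>j. \<bar>real_of_int (\<alpha> $ j)\<bar> \<le> r}"
proof -
  have "{\<alpha>::int^'m. \<forall>j. \<bar>real_of_int (\<alpha> $ j)\<bar> \<le> r} \<subseteq> vec_lambda ` (UNIV \<rightarrow>\<^sub>E {-\<lceil>r\<rceil>..\<lceil>r\<rceil>})"
  proof
    fix \<alpha> :: "int^'m" assume \<alpha>: "\<alpha> \<in> {\<alpha>. \<forall>j. \<bar>real_of_int (\<alpha> $ j)\<bar> \<le> r}"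
    have "-\<lceil>r\<rceil> \<le> \<alpha> $ j \<and> \<alpha> $ j \<le> \<lceil>r\<rceil>" for j
    proof -
      have "\<bar>real_of_int (\<alpha> $ j)\<bar> \<le> r" using \<alpha> by simp
      then have "\<bar>real_of_int (\<alpha> $ j)\<bar> \<le> real_of_int \<lceil>r\<rceil>" using le_of_int_ceiling order_trans by blast
      then show ?thesis by linarith
    qed
    then have "vec_nth \<alpha> \<in> UNIV \<rightarrow>\<^sub>E {-\<lceil>r\<rceil>..\<lceil>r\<rceil>}" by (auto simp: PiE_UNIV_domain)
    then show "\<alpha> \<in> vec_lambda ` (UNIV \<rightarrow>\<^sub>E {-\<lceil>r\<rceil>..\<lceil>r\<rceil>})"
      by (intro image_eqI[of _ _ "vec_nth \<alpha>"]) (auto simp: vec_nth_inverse)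
  qed
  then show ?thesis by (rule finite_subset) (intro finite_imageI finite_PiE, auto)
qed

lemma finite_lattice_points: "finite (lattice_points X k)"
proof -
  obtain r where r: "\<And>x. x \<in> poly X \<Longrightarrow> norm x \<le> r" using bounded_poly unfolding bounded_iff by blast
  have "lattice_points X k \<subseteq> {\<alpha>. \<forall>j. \<bar>real_of_int (\<alpha> $ j)\<bar> \<le> real k * r}"
  proof safe
    fix \<alpha> j assume "\<alpha> \<in> lattice_points X k"
    then obtain x where x: "x \<in> poly X" "real_vec \<alpha> = real k *\<^sub>R x" by (auto simp: lattice_points_def)
    have "\<bar>real_of_int (\<alpha> $ j)\<bar> = \<bar>real_vec \<alpha> $ j\<bar>" by (simp add: real_vec_def)
    also have "\<dots> \<le> norm (real_vec \<alpha>)" by (rule component_le_norm_cart)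
    also have "\<dots> \<le> real k * r" using r[OF x(1)] by (simp add: x(2) mult_left_mono)
    finally show "\<bar>real_of_int (\<alpha> $ j)\<bar> \<le> real k * r" .
  qed
  then show ?thesis by (rule finite_subset) (rule finite_int_vectors)
qed

lemma rho_surj: "\<exists>p\<in>orbit X. rho X p = \<rho>"
proof -
  have "rho X (pt (cexp (\<chi> j. complex_of_real (\<rho> $ j / 2)))) = \<rho>"
    by (simp add: rho_pt cexp_ctorus log_norm2_cexp) (simp add: twice_Re_def vec_eq_iff)
  then show ?thesis using pt_in_orbit[OF cexp_ctorus] by blast
qed

text \<open>Since some power of the bundle has no base points, the sum of the pointwise norms of the
  monomial sections is bounded from below on the compact manifold.  Hence the potential grows at
  most like the support function of the polytope.\<close>

lemma potential_upper_bound: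
  "\<exists>C. \<forall>\<rho>. \<exists>x\<in>poly X. \<phi> \<rho> \<le> x \<bullet> \<rho> + C"
proof -
  obtain k where k: "k \<ge> 1" "very_ample X k" using ample by (auto simp: ample_def)
  let ?S = "lattice_points X k"
  let ?h = "\<lambda>\<alpha>. hnorm2 X k (toric_section X k \<alpha>)"
  let ?g = "\<lambda>p. \<Sum>\<alpha>\<in>?S. ?h \<alpha> p"
  note H = toric_section(2)[OF k(1)]
  have gp: "?g p > 0" for p
  proof -
    obtain i where i: "p \<in> triv X i" using triv_cover by blast
    have "\<forall>i. \<forall>p\<in>triv X i. \<exists>s\<in>H0 X k. s i p \<noteq> 0"
      using k(2) unfolding very_ample_def by (elim conjE)
    then obtain s where s: "s \<in> H0 X k" "s i p \<noteq> 0" using i by meson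
    \<comment> \<open>The section s, nonzero at p, is expanded in the monomial basis; at least one
      monomial section is then nonzero at p.\<close>
    have "\<exists>!a. (\<forall>\<alpha>. \<alpha> \<notin> ?S \<longrightarrow> a \<alpha> = 0) \<and> s = (\<lambda>i p. \<Sum>\<alpha>\<in>?S. a \<alpha> * toric_section X k \<alpha> i p)"
      by (rule associated_polytope[unfolded associated_polytope_def, THEN conjunct2, THEN spec,
            THEN mp, OF k(1), THEN conjunct2, THEN bspec, OF s(1)])
    then obtain a where a: "s = (\<lambda>i p. \<Sum>\<alpha>\<in>?S. a \<alpha> * toric_section X k \<alpha> i p)"
      by (elim ex1E conjE)
    have "(\<Sum>\<alpha>\<in>?S. a \<alpha> * toric_section X k \<alpha> i p) \<noteq> 0" using s(2) unfolding a .
    then obtain \<alpha> where \<alpha>: "\<alpha> \<in> ?S" "a \<alpha> * toric_section X k \<alpha> i p \<noteq> 0"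
      by (rule sum.not_neutral_contains_not_neutral)
    then have "?h \<alpha> p > 0" using hnorm2_H0[OF H[OF \<alpha>(1)] i] hmet_pos[OF i] by simp
    then show ?thesis using \<alpha>(1) finite_lattice_points hnorm2_nonneg[OF H] by (intro sum_pos2) auto
  qed
  have c: "continuous_on UNIV ?g" by (intro continuous_intros hnorm2_continuous H)
  obtain p0 where p0: "\<And>p. ?g p0 \<le> ?g p" using continuous_attains_inf[OF compact _ c] by auto
  define n where "n = real (card ?S)"
  have "?S \<noteq> {}" using gp[of p0] by auto
  then have n: "n > 0" using finite_lattice_points by (simp add: n_def card_gt_0_iff)
  \<comment> \<open>The minimum of the sum divided by the number of terms: at every point some
    monomial section has squared norm at least m.\<close>
  define m where "m = ?g p0 / n"
  have m: "m > 0" using gp n by (simp add: m_def)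
  have "\<exists>x\<in>poly X. \<phi> \<rho> \<le> x \<bullet> \<rho> + (- ln m / real k)" for \<rho>
  proof -
    obtain p where p: "p \<in> orbit X" "rho X p = \<rho>" using rho_surj by blast
    have "\<exists>\<alpha>\<in>?S. m \<le> ?h \<alpha> p"
    proof (rule ccontr)
      assume "\<not> ?thesis"
      then have "?g p < (\<Sum>\<alpha>\<in>?S. m)" using \<open>?S \<noteq> {}\<close> finite_lattice_points by (intro sum_strict_mono) auto
      also have "\<dots> = ?g p0" using n by (simp add: m_def n_def)
      finally show False using p0[of p] by simp
    qed
    then obtain \<alpha> where \<alpha>: "\<alpha> \<in> ?S" "m \<le> exp (real_vec \<alpha> \<bullet> \<rho> - real k * \<phi> \<rho>)"
      using hnorm2_toric_section[OF k(1) _ p(1)] p(2) by auto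
    then have "ln m \<le> real_vec \<alpha> \<bullet> \<rho> - real k * \<phi> \<rho>" by (subst exp_le_cancel_iff[symmetric]) (simp add: m)
    moreover obtain x where x: "x \<in> poly X" "real_vec \<alpha> = real k *\<^sub>R x" using \<alpha>(1) by (auto simp: lattice_points_def)
    ultimately have "real k * \<phi> \<rho> \<le> real k * (x \<bullet> \<rho> + (- ln m / real k))"
      using k(1) by (simp add: algebra_simps)
    then show ?thesis using x(1) k(1) by (intro bexI[of _ x]) (auto simp: mult_le_cancel_left)
  qed
  then show ?thesis by blast
qed

end

section \<open>The value of the moment map lies in the interior of the polytope\<close>

locale toric_point = toric_kaehler X for X :: "('a::t2_space, 'i, 'm::finite) toric_data" +
  fixes z :: 'a
  assumes z: "z \<in> orbit X"
begin

sublocale centered_potential "potential X" "rho X z"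
  by unfold_locales

abbreviation "\<rho>0 \<equiv> rho X z"

lemma moment_map_eq: "moment_map X z = x0"
  by (simp add: moment_map_def)

text \<open>Let x be close to \<open>x0\<close> but outside P, and separate it from P by a
  hyperplane with normal a. Along \<rho> = - t a the upper bound of \<phi> by the support function
  makes x . \<rho> - \<phi> \<rho> grow at least linearly in t, whereas \<open>dual_bounded\<close>
  keeps it bounded. So a whole ball around \<open>x0\<close> lies in P.\<close>

lemma moment_map_interior: "x0 \<in> interior (poly X)"
proof -
  obtain C where C: "\<And>\<rho>. \<exists>x\<in>poly X. \<phi> \<rho> \<le> x \<bullet> \<rho> + C" using potential_upper_bound by blast
  have "ball x0 (c0 / 2) \<subseteq> poly X"
  proof
    fix x assume x: "x \<in> ball x0 (c0 / 2)"
    show "x \<in> poly X"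
    proof (rule ccontr)
      assume nx: "x \<notin> poly X"
      obtain a b where ab: "a \<bullet> x < b" "\<And>y. y \<in> poly X \<Longrightarrow> b < a \<bullet> y"
        using separating_hyperplane_closed_point[OF polytope_imp_convex[OF polytope_poly]
            polytope_imp_closed[OF polytope_poly] nx] by blast
      define K where "K = x \<bullet> \<rho>0 - \<phi> \<rho>0 + c0 + C"
      have bd: "t * (b - a \<bullet> x) \<le> K" if t: "t > 0" for t
      proof -
        let ?\<rho> = "(- t) *\<^sub>R a"
        obtain y where y: "y \<in> poly X" "\<phi> ?\<rho> \<le> y \<bullet> ?\<rho> + C" using C by blast
        have "norm (x - x0) < c0 / 2" using x by (simp add: dist_norm norm_minus_commute)
        from dual_bounded[OF this, of ?\<rho>]
        have "x \<bullet> ?\<rho> - \<phi> ?\<rho> \<le> x \<bullet> \<rho>0 - \<phi> \<rho>0 + c0" .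
        moreover have "t * b \<le> t * (a \<bullet> y)" using ab(2)[OF y(1)] t by simp
        ultimately show ?thesis using y(2) by (simp add: K_def inner_commute algebra_simps)
      qed
      \<comment> \<open>Makes t (b - a . x) equal to |K| + 1, which exceeds K.\<close>
      define t where "t = (\<bar>K\<bar> + 1) / (b - a \<bullet> x)"
      have d: "b - a \<bullet> x > 0" using ab(1) by simp
      then have "t > 0" by (simp add: t_def add_nonneg_pos)
      from bd[OF this] d have "\<bar>K\<bar> + 1 \<le> K" by (simp add: t_def)
      then show False by linarith
    qed
  qed
  then show ?thesis using c0_pos by (intro interiorI[of "ball x0 (c0/2)"]) auto
qed

end

section \<open>Asymptotics of the normalized norms\<close>

context toric_point
begin

lemma exponent_eq:
  assumes k: "k \<ge> 1"
  shows "(real_vec \<alpha> \<bullet> \<rho> - real k * \<phi> \<rho>) - (real_vec \<alpha> \<bullet> \<rho>0 - real k * \<phi> \<rho>0) =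
    sqrt (real k) * (rescaled x0 k \<alpha> \<bullet> (\<rho> - \<rho>0)) - real k * G (\<rho> - \<rho>0)"
proof -
  have "sqrt (real k) *\<^sub>R rescaled x0 k \<alpha> = (sqrt (real k) * sqrt (real k)) *\<^sub>R ((1 / real k) *\<^sub>R real_vec \<alpha> - x0)"
    by (simp add: rescaled_def)
  also have "\<dots> = real_vec \<alpha> - real k *\<^sub>R x0"
    using k by (simp add: scaleR_diff_right)
  finally have "sqrt (real k) *\<^sub>R rescaled x0 k \<alpha> = real_vec \<alpha> - real k *\<^sub>R x0" .
  then have "sqrt (real k) * (rescaled x0 k \<alpha> \<bullet> (\<rho> - \<rho>0)) = real_vec \<alpha> \<bullet> (\<rho> - \<rho>0) - real k * (x0 \<bullet> (\<rho> - \<rho>0))"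
    by (metis inner_diff_left inner_scaleR_left)
  moreover have "\<rho>0 + (\<rho> - \<rho>0) = \<rho>" by simp
  ultimately show ?thesis unfolding G_def by (simp add: inner_diff_right algebra_simps)
qed

text \<open>Dividing by the value at z centres the exponent at \<open>\<rho>0\<close>; the integral
  over the manifold is the reciprocal of the unnormalized weight of \<alpha>.\<close>

definition ratio :: "nat \<Rightarrow> int^'m \<Rightarrow> 'a \<Rightarrow> real" where
  "ratio k \<alpha> p = hnorm2 X k (toric_section X k \<alpha>) p / hnorm2 X k (toric_section X k \<alpha>) z"

definition weight :: "nat \<Rightarrow> int^'m \<Rightarrow> real^'m \<Rightarrow> real" where
  "weight k \<alpha> s = exp (sqrt (real k) * (rescaled x0 k \<alpha> \<bullet> s) - real k * G s)"

definition near :: "'a set" where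
  "near = {p \<in> orbit X. rho X p \<in> cball \<rho>0 1}"

lemma ratio_orbit:
  assumes "k \<ge> 1" "\<alpha> \<in> lattice_points X k" "p \<in> orbit X"
  shows "ratio k \<alpha> p = weight k \<alpha> (rho X p - \<rho>0)"
  unfolding ratio_def weight_def exponent_eq[OF assms(1), symmetric]
  by (simp add: hnorm2_toric_section[OF assms(1,2)] assms(3) z exp_diff)

lemma ratio_nonneg: "k \<ge> 1 \<Longrightarrow> \<alpha> \<in> lattice_points X k \<Longrightarrow> ratio k \<alpha> p \<ge> 0"
  unfolding ratio_def by (intro divide_nonneg_nonneg hnorm2_nonneg toric_section)

lemma ratio_continuous: "k \<ge> 1 \<Longrightarrow> \<alpha> \<in> lattice_points X k \<Longrightarrow> continuous_on UNIV (ratio k \<alpha>)"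
  unfolding ratio_def[abs_def] divide_inverse
  by (intro continuous_on_mult_right hnorm2_continuous toric_section)

lemma borel_measurable_vol: "f \<in> borel_measurable borel \<Longrightarrow> f \<in> borel_measurable (vol X)"
  using measurable_cong_sets[OF sets_vol refl] by blast

lemma finite_measure_vol: "finite_measure (vol X)"
  using finite_vol by (intro finite_measureI) (simp add: space_vol less_top)

lemma integrable_ratio:
  assumes k: "k \<ge> 1" "\<alpha> \<in> lattice_points X k"
  shows "integrable (vol X) (ratio k \<alpha>)"
proof -
  have "bounded (ratio k \<alpha> ` UNIV)"
    by (intro compact_imp_bounded compact_continuous_image ratio_continuous[OF k] compact)
  then obtain B where B: "\<And>p. norm (ratio k \<alpha> p) \<le> B" unfolding bounded_iff by auto
  show ?thesis
    by (rule finite_measure.integrable_const_bound[OF finite_measure_vol AE_I2[OF B]])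
      (intro borel_measurable_vol borel_measurable_continuous_onI ratio_continuous[OF k])
qed

text \<open>Closedness is not inherited from the ball, since \<open>rho\<close> is controlled only
  on the orbit, which need not be closed. The set is instead a continuous image of a compact set of
  moduli and angles.\<close>

lemma near_closed: "closed near"
proof -
  let ?e = "\<lambda>(\<rho>, \<theta>). (\<chi> j. Complex (\<rho> $ j / 2) (\<theta> $ j)) :: complex^'m"
  let ?K = "cball \<rho>0 1 \<times> cbox (\<chi> j. - pi) (\<chi> j. pi) :: ((real^'m) \<times> (real^'m)) set"
  have ce: "continuous_on ?K ?e"
    unfolding case_prod_beta Complex_eq
    by (intro continuous_intros continuous_on_vec_lambda) auto
  have "continuous_on ?K (\<lambda>x. pt (cexp (?e x)))"
    by (intro continuous_on_compose2[OF continuous_pt] continuous_on_compose2[OF continuous_cexp] ce)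
      (auto simp: cexp_ctorus)
  then have "compact ((\<lambda>x. pt (cexp (?e x))) ` ?K)"
    by (intro compact_continuous_image compact_Times compact_cball compact_cbox)
  moreover have "(\<lambda>x. pt (cexp (?e x))) ` ?K = near"
  proof (rule equalityI; rule subsetI)
    fix p assume "p \<in> (\<lambda>x. pt (cexp (?e x))) ` ?K"
    then obtain \<rho> \<theta> where r: "\<rho> \<in> cball \<rho>0 1" and p: "p = pt (cexp (?e (\<rho>, \<theta>)))" by blast
    have "rho X (pt (cexp (?e (\<rho>, \<theta>)))) = \<rho>"
      by (simp add: rho_pt cexp_ctorus log_norm2_cexp) (simp add: twice_Re_def vec_eq_iff)
    then show "p \<in> near"
      unfolding p using r by (simp add: near_def pt_in_orbit cexp_ctorus)
  next
    fix p assume p: "p \<in> near"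
    then have po: "p \<in> orbit X" and pr: "rho X p \<in> cball \<rho>0 1" by (auto simp: near_def)
    define w where "w = zcoord X p"
    have w: "w \<in> ctorus" "pt w = p" using zcoord_in_ctorus[OF po] pt_zcoord[OF po] by (auto simp: w_def)
    have nz: "w $ j \<noteq> 0" for j using w(1) by (simp add: ctorus_def)
    define \<theta> where "\<theta> = (\<chi> j. Im (Ln (w $ j)))"
    have "?e (rho X p, \<theta>) = (\<chi> j. Ln (w $ j))"
      using nz by (auto simp: vec_eq_iff \<theta>_def rho_def w_def[symmetric] complex_eq_iff ln_realpow Re_Ln)
    then have "cexp (?e (rho X p, \<theta>)) = w" using nz by (simp add: cexp_def vec_eq_iff)
    moreover have "\<theta> \<in> cbox (\<chi> j. - pi) (\<chi> j. pi)"
      using nz mpi_less_Im_Ln Im_Ln_le_pi by (auto simp: mem_box_cart \<theta>_def less_imp_le)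
    ultimately show "p \<in> (\<lambda>x. pt (cexp (?e x))) ` ?K"
      using pr w(2) by (intro image_eqI[of _ _ "(rho X p, \<theta>)"]) auto
  qed
  ultimately show ?thesis using compact_imp_closed by metis
qed

text \<open>The estimate on the orbit extends to the boundary divisor because the orbit is dense.\<close>

lemma ratio_far:
  assumes k: "k \<ge> 1" "\<alpha> \<in> lattice_points X k"
    and B: "\<And>s. norm s \<ge> 1 \<Longrightarrow> weight k \<alpha> s \<le> B" and p: "p \<notin> near"
  shows "ratio k \<alpha> p \<le> B"
proof -
  have "closed {p. ratio k \<alpha> p \<le> B}"
    by (rule closed_Collect_le[OF ratio_continuous[OF k] continuous_on_const])
  then have "closed ({p. ratio k \<alpha> p \<le> B} \<union> near)" using near_closed by (rule closed_Un)
  moreover have "orbit X \<subseteq> {p. ratio k \<alpha> p \<le> B} \<union> near"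
  proof
    fix q assume q: "q \<in> orbit X"
    show "q \<in> {p. ratio k \<alpha> p \<le> B} \<union> near"
    proof (cases "norm (rho X q - \<rho>0) \<le> 1")
      case True
      then show ?thesis using q by (simp add: near_def dist_norm norm_minus_commute)
    next
      case False
      then show ?thesis using B[of "rho X q - \<rho>0"] ratio_orbit[OF k q] by simp
    qed
  qed
  ultimately have "p \<in> {p. ratio k \<alpha> p \<le> B} \<union> near" by (rule dense_subset_closed)
  then show ?thesis using p by simp
qed

text \<open>Lifts the measure identity for \<rho> to Bochner integrals. The restriction to the orbit
  comes first because off it the values of \<open>rho\<close> are arbitrary.\<close>

lemma integral_orbit_rho:
  assumes h[measurable]: "h \<in> borel_measurable borel"
  shows "(\<integral>p. indicator (orbit X) p *\<^sub>R h (rho X p) \<partial>vol X) = (\<integral>\<rho>. vol_density \<rho> * h \<rho> \<partial>lborel)"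
proof -
  let ?R = "restrict_space (vol X) (orbit X)"
  have os: "orbit X \<inter> space (vol X) \<in> sets (vol X)" using open_orbit by (simp add: sets_vol space_vol)
  have "rho X \<in> borel_measurable (restrict_space borel (orbit X))"
  proof -
    have "zcoord X \<in> borel_measurable (restrict_space borel (orbit X))"
      by (rule borel_measurable_continuous_on_restrict[OF continuous_zcoord])
    from measurable_compose[OF this borel_measurable_log_norm2] show ?thesis
      by (simp add: log_norm2_def rho_def[abs_def])
  qed
  then have rm: "rho X \<in> borel_measurable ?R"
    using measurable_cong_sets[of "restrict_space borel (orbit X)" ?R borel borel] sets_vol
    by (simp add: sets_restrict_space)
  have D: "distr ?R borel (rho X) = density lborel (\<lambda>\<rho>. ennreal (vol_density \<rho>))"
  proof (rule measure_eqI)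
    fix B assume "B \<in> sets (distr ?R borel (rho X))"
    then have B: "B \<in> sets borel" by simp
    have "emeasure (distr ?R borel (rho X)) B = emeasure ?R (rho X -` B \<inter> space ?R)"
      by (rule emeasure_distr[OF rm B])
    also have "rho X -` B \<inter> space ?R = {p \<in> orbit X. rho X p \<in> B}"
      by (auto simp: space_restrict_space space_vol)
    also have "emeasure ?R \<dots> = emeasure (vol X) {p \<in> orbit X. rho X p \<in> B}"
      using os by (subst emeasure_restrict_space) auto
    also have "\<dots> = emeasure (density lborel (\<lambda>\<rho>. ennreal (vol_density \<rho>))) B"
      using B borel_measurable_vol_density
      by (simp only: emeasure_vol_rho[OF B] vol_density_def) (subst emeasure_density, auto simp: vol_density_def[abs_def])
    finally show "emeasure (distr ?R borel (rho X)) B = emeasure (density lborel (\<lambda>\<rho>. ennreal (vol_density \<rho>))) B" .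
  qed simp
  have "(\<integral>p. indicator (orbit X) p *\<^sub>R h (rho X p) \<partial>vol X) = (\<integral>p. h (rho X p) \<partial>?R)"
    by (rule integral_restrict_space[OF os, symmetric])
  also have "\<dots> = (\<integral>\<rho>. h \<rho> \<partial>distr ?R borel (rho X))"
    by (rule integral_distr[OF rm h, symmetric])
  also have "\<dots> = (\<integral>\<rho>. vol_density \<rho> *\<^sub>R h \<rho> \<partial>lborel)"
    unfolding D using vol_density_pos borel_measurable_vol_density
    by (subst integral_density) (auto simp: less_imp_le)
  finally show ?thesis by simp
qed

lemma integral_near:
  assumes k: "k \<ge> 1" "\<alpha> \<in> lattice_points X k"
  shows "(\<integral>p. indicator near p * ratio k \<alpha> p \<partial>vol X) = local_int k (rescaled x0 k \<alpha>)"
proof -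
  let ?h = "\<lambda>\<rho>. indicator (cball \<rho>0 1) \<rho> * weight k \<alpha> (\<rho> - \<rho>0)"
  have "continuous_on UNIV (\<lambda>\<rho>. weight k \<alpha> (\<rho> - \<rho>0))"
    unfolding weight_def by (intro continuous_intros continuous_on_compose2[OF continuous_G]) auto
  then have hm: "?h \<in> borel_measurable borel"
    by (intro borel_measurable_times borel_measurable_indicator borel_measurable_continuous_onI) auto
  have "indicator near p * ratio k \<alpha> p = indicator (orbit X) p *\<^sub>R ?h (rho X p)" for p
    using ratio_orbit[OF k] by (auto simp: near_def indicator_def)
  then have "(\<integral>p. indicator near p * ratio k \<alpha> p \<partial>vol X) = (\<integral>p. indicator (orbit X) p *\<^sub>R ?h (rho X p) \<partial>vol X)"
    by (simp only:)
  also have "\<dots> = (\<integral>\<rho>. vol_density \<rho> * ?h \<rho> \<partial>lborel)" by (rule integral_orbit_rho[OF hm])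
  also have "\<dots> = (\<integral>\<rho>. vol_density \<rho> * ?h \<rho> \<partial>distr lborel borel ((+) \<rho>0))" by (simp only: lborel_distr_plus)
  also have "\<dots> = (\<integral>s. vol_density (\<rho>0 + s) * ?h (\<rho>0 + s) \<partial>lborel)"
    using borel_measurable_times[OF borel_measurable_vol_density hm] by (subst integral_distr) auto
  also have "\<dots> = local_int k (rescaled x0 k \<alpha>)"
    unfolding local_int_def weight_def
    by (intro Bochner_Integration.integral_cong refl) (auto simp: indicator_def dist_norm)
  finally show ?thesis .
qed

definition J :: "nat \<Rightarrow> int^'m \<Rightarrow> real" where
  "J k \<alpha> = L2norm2 X k (toric_section X k \<alpha>) / hnorm2 X k (toric_section X k \<alpha>) z"

lemma J_eq: "J k \<alpha> = (\<integral>p. ratio k \<alpha> p \<partial>vol X)"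
  by (simp add: J_def L2norm2_def ratio_def)

lemma near_sets: "near \<in> sets (vol X)"
  using near_closed by (simp add: sets_vol)

text \<open>Off \<open>near\<close> the ratio is at most B at every point, boundary divisor
  included, so that region contributes at most the total volume times B. The lower bound drops
  it.\<close>

lemma J_bounds:
  assumes k: "k \<ge> 1" "\<alpha> \<in> lattice_points X k"
  shows "local_int k (rescaled x0 k \<alpha>) \<le> J k \<alpha>"
    and "B \<ge> 0 \<Longrightarrow> (\<And>s. norm s \<ge> 1 \<Longrightarrow> weight k \<alpha> s \<le> B) \<Longrightarrow>
      J k \<alpha> \<le> local_int k (rescaled x0 k \<alpha>) + measure (vol X) UNIV * B"
proof -
  have i: "integrable (vol X) (\<lambda>p. indicator near p * ratio k \<alpha> p)"
    using integrable_mult_indicator[OF near_sets integrable_ratio[OF k]] by simp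
  show "local_int k (rescaled x0 k \<alpha>) \<le> J k \<alpha>"
    unfolding J_eq integral_near[OF k, symmetric]
    by (rule integral_mono[OF i integrable_ratio[OF k]]) (use ratio_nonneg[OF k] in \<open>auto simp: indicator_def\<close>)
  assume B: "B \<ge> 0" "\<And>s. norm s \<ge> 1 \<Longrightarrow> weight k \<alpha> s \<le> B"
  have c: "integrable (vol X) (\<lambda>p. B)"
    using finite_measure.integrable_const[OF finite_measure_vol] .
  have "J k \<alpha> \<le> (\<integral>p. indicator near p * ratio k \<alpha> p + B \<partial>vol X)"
    unfolding J_eq
  proof (rule integral_mono[OF integrable_ratio[OF k] Bochner_Integration.integrable_add[OF i c]])
    fix p
    show "ratio k \<alpha> p \<le> indicator near p * ratio k \<alpha> p + B"
      using ratio_far[OF k B(2), of p] B(1) by (cases "p \<in> near") auto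
  qed
  also have "\<dots> = local_int k (rescaled x0 k \<alpha>) + measure (vol X) UNIV * B"
    by (simp add: Bochner_Integration.integral_add[OF i c] integral_near[OF k] space_vol)
  finally show "J k \<alpha> \<le> local_int k (rescaled x0 k \<alpha>) + measure (vol X) UNIV * B" .
qed

text \<open>The unnormalized weights are the reciprocals of \<open>J\<close>, and the Bergman
  density at z is their sum. Nonnegativity of \<open>J\<close> makes the passage through extended
  nonnegative reals lossless.\<close>

lemma integral_dilated_measure:
  assumes f: "f \<in> borel_measurable borel" and k: "k \<ge> 1"
  shows "(\<integral>x. f x \<partial>dilated_measure X k z) =
    (\<Sum>\<alpha>\<in>lattice_points X k. f (rescaled x0 k \<alpha>) / J k \<alpha>) / (\<Sum>\<alpha>\<in>lattice_points X k. 1 / J k \<alpha>)"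
proof -
  let ?S = "lattice_points X k"
  let ?q = "\<lambda>\<alpha>. hnorm2 X k (toric_section X k \<alpha>) z / L2norm2 X k (toric_section X k \<alpha>)"
  have q: "?q \<alpha> = 1 / J k \<alpha>" for \<alpha> by (simp add: J_def)
  have b: "bergman X k z = (\<Sum>\<alpha>\<in>?S. 1 / J k \<alpha>)" by (simp add: bergman_def q)
  have Jn: "J k \<alpha> \<ge> 0" if "\<alpha> \<in> ?S" for \<alpha>
    unfolding J_eq by (rule Bochner_Integration.integral_nonneg) (rule ratio_nonneg[OF k that])
  then have bn: "bergman X k z \<ge> 0" unfolding b by (intro sum_nonneg) auto
  have "(\<integral>x. f x \<partial>dilated_measure X k z) =
      (\<integral>\<alpha>. f (rescaled x0 k \<alpha>) \<partial>point_measure ?S (\<lambda>\<alpha>. ennreal (1 / bergman X k z * ?q \<alpha>)))"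
    unfolding dilated_measure_def moment_map_eq
    by (subst integral_distr) (auto simp: rescaled_def measurable_point_measure_eq1 f)
  also have "\<dots> = (\<Sum>\<alpha>\<in>?S. (1 / bergman X k z * ?q \<alpha>) *\<^sub>R f (rescaled x0 k \<alpha>))"
    by (rule lebesgue_integral_point_measure_finite[OF finite_lattice_points])
      (use bn Jn in \<open>auto simp: q\<close>)
  also have "\<dots> = (\<Sum>\<alpha>\<in>?S. f (rescaled x0 k \<alpha>) / J k \<alpha>) / bergman X k z"
    unfolding q by (simp add: sum_divide_distrib mult.commute)
  finally show ?thesis by (simp only: b)
qed

lemma dilated_measure_tendsto_gaussian:
  fixes f :: "real^'m \<Rightarrow> real"
  assumes f: "continuous_on UNIV f" "bounded (range f)"
  shows "(\<lambda>k. \<integral>x. f x \<partial>dilated_measure X k z) \<longlonglongrightarrow> (\<integral>x. f x \<partial>gaussian 0 (hess_potential X z))"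
proof -
  have "(\<lambda>k. (\<Sum>\<alpha>\<in>lattice_points X k. f (rescaled x0 k \<alpha>) / J k \<alpha>) / (\<Sum>\<alpha>\<in>lattice_points X k. 1 / J k \<alpha>))
      \<longlonglongrightarrow> (\<integral>x. f x \<partial>gaussian 0 H)"
  proof (rule normalized_lattice_limit[where P = "poly X" and V = "measure (vol X) UNIV"])
    show "lattice_points X k = {\<alpha>. real_vec \<alpha> \<in> (\<lambda>x. real k *\<^sub>R x) ` poly X}" for k
      by (simp add: lattice_points_def)
    show "J k \<alpha> \<le> local_int k (rescaled x0 k \<alpha>) + measure (vol X) UNIV * B"
      if "1 \<le> k" "\<alpha> \<in> lattice_points X k" "0 \<le> B"
        "\<And>s. 1 \<le> norm s \<Longrightarrow> exp (sqrt (real k) * (rescaled x0 k \<alpha> \<bullet> s) - real k * G s) \<le> B" for k \<alpha> B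
      by (rule J_bounds(2)[OF that(1-3)]) (simp add: weight_def that(4))
  qed (auto intro: finite_lattice_points bounded_poly moment_map_interior J_bounds(1) f)
  then show ?thesis unfolding hess_potential_def
  proof (rule Lim_transform_eventually)
    \<comment> \<open>The monomial sections are controlled for k \<ge> 1, so the formula for the
      measure is used from there on.\<close>
    show "eventually (\<lambda>k. (\<Sum>\<alpha>\<in>lattice_points X k. f (rescaled x0 k \<alpha>) / J k \<alpha>) / (\<Sum>\<alpha>\<in>lattice_points X k. 1 / J k \<alpha>) =
        (\<integral>x. f x \<partial>dilated_measure X k z)) sequentially"
      using eventually_ge_at_top[of 1]
      by eventually_elim (simp only: integral_dilated_measure borel_measurable_continuous_onI[OF f(1)])
  qed
qed

end

theorem theorem1p2:
  fixes X :: "('a::t2_space, 'i, 'm::finite) toric_data"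
    and z :: 'a
    and f :: "real^'m \<Rightarrow> real"
  assumes "polarized_toric_kaehler X"
    and "z \<in> orbit X"
    and "continuous_on UNIV f"
    and "bounded (range f)"
  shows "(\<lambda>k. \<integral>x. f x \<partial>dilated_measure X k z)
           \<longlonglongrightarrow> (\<integral>x. f x \<partial>gaussian 0 (hess_potential X z))"
proof -
  interpret toric_point X z by unfold_locales (rule assms)+
  show ?thesis by (rule dilated_measure_tendsto_gaussian[OF assms(3,4)])
qed

end
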